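(* Let $(G,\mathcal{B},\mathcal{L},\mathcal{F})$ be a quasi-biased graph such that $M=M(G,\mathcal{B},\mathcal{L},\mathcal{F})$ is $3$-connected and unbreakable, $G$ is $3$-connected, and $|V(G)|\ge 7$. Then $\mathrm{si}(G)$ can be obtained from a complete graph by deleting the edges of a path of length at most two.
   Context: Graphs are finite with loops and parallel edges allowed; cycles include loops and 2-cycles. A quasi-biased graph $(G,\mathcal{B},\mathcal{L},\mathcal{F})$ is a graph with a partition $(\mathcal{B},\mathcal{L},\mathcal{F})$ of its cycles such that no theta subgraph contains exactly two cycles of $\mathcal{B}$ and every cycle in $\mathcal{L}$ shares a vertex with every cycle in $\mathcal{F}$. $M(G,\mathcal{B},\mathcal{L},\mathcal{F})$ is the matroid on $E(G)$ with circuits: cycles in $\mathcal{B}$; theta subgraphs with no cycle in $\mathcal{B}$; tight handcuffs (two edge-disjoint cycles sharing exactly one vertex) with neither cycle in $\mathcal{B}$; unions of two vertex-disjoint cycles of $\mathcal{L}$; loose handcuffs (two vertex-disjoint cycles plus a minimal path joining them) with both cycles in $\mathcal{F}$. A matroid is unbreakable if it is connected and $M/F$ is connected for every flat $F$. $\mathrm{si}(G)$ is the simplification. *)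

theory Defs
  imports Main
begin

section \<open>Multigraphs\<close>

text \<open>\<open>ends G e\<close> is the set of end-vertices of \<open>e\<close>: a singleton for a loop, a pair otherwise.\<close>

record ('v, 'e) mgraph =
  verts :: "'v set"
  edges :: "'e set"
  ends :: "'e \<Rightarrow> 'v set"

definition multigraph :: "('v, 'e) mgraph \<Rightarrow> bool" where
  "multigraph G \<longleftrightarrow> finite (verts G) \<and> finite (edges G) \<and>
     (\<forall>e\<in>edges G. ends G e \<subseteq> verts G \<and> (card (ends G e) = 1 \<or> card (ends G e) = 2))"

definition delete_edges :: "('v, 'e) mgraph \<Rightarrow> 'e set \<Rightarrow> ('v, 'e) mgraph" where
  "delete_edges G X = \<lparr>verts = verts G, edges = edges G - X, ends = ends G\<rparr>"

definition delete_verts :: "('v, 'e) mgraph \<Rightarrow> 'v set \<Rightarrow> ('v, 'e) mgraph" where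
  "delete_verts G X =
     \<lparr>verts = verts G - X, edges = {e \<in> edges G. ends G e \<inter> X = {}}, ends = ends G\<rparr>"

text \<open>Subgraphs without isolated vertices (cycles, thetas, handcuffs, non-trivial paths) are
  represented by their edge sets; \<open>vertex_set G X\<close> recovers the vertices.\<close>

definition vertex_set :: "('v, 'e) mgraph \<Rightarrow> 'e set \<Rightarrow> 'v set" where
  "vertex_set G X = (\<Union>e\<in>X. ends G e)"

text \<open>\<open>P\<close> is the edge set of a path from \<open>u\<close> to \<open>v\<close>; it is empty exactly for the trivial path
  \<open>u = v\<close>. The edges of a path are distinct, so its length is \<open>card P\<close>.\<close>

definition path_between :: "('v, 'e) mgraph \<Rightarrow> 'v \<Rightarrow> 'v \<Rightarrow> 'e set \<Rightarrow> bool" where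
  "path_between G u v P \<longleftrightarrow> (\<exists>vs es.
     length vs = Suc (length es) \<and> distinct vs \<and> set vs \<subseteq> verts G \<and> set es \<subseteq> edges G \<and>
     (\<forall>i<length es. ends G (es ! i) = {vs ! i, vs ! Suc i}) \<and>
     hd vs = u \<and> last vs = v \<and> P = set es)"

text \<open>A single loop (\<open>length es = 1\<close>) and a pair of parallel edges (\<open>length es = 2\<close>) are cycles.\<close>

definition is_cycle :: "('v, 'e) mgraph \<Rightarrow> 'e set \<Rightarrow> bool" where
  "is_cycle G C \<longleftrightarrow> (\<exists>vs es.
     es \<noteq> [] \<and> length vs = length es \<and> distinct vs \<and> distinct es \<and>
     set vs \<subseteq> verts G \<and> set es \<subseteq> edges G \<and>
     (\<forall>i<length es. ends G (es ! i) = {vs ! i, vs ! (Suc i mod length es)}) \<and>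
     C = set es)"

definition is_theta :: "('v, 'e) mgraph \<Rightarrow> 'e set \<Rightarrow> bool" where
  "is_theta G T \<longleftrightarrow> (\<exists>u v P Q R. u \<noteq> v \<and>
     path_between G u v P \<and> path_between G u v Q \<and> path_between G u v R \<and>
     P \<inter> Q = {} \<and> P \<inter> R = {} \<and> Q \<inter> R = {} \<and>
     vertex_set G P \<inter> vertex_set G Q = {u, v} \<and>
     vertex_set G P \<inter> vertex_set G R = {u, v} \<and>
     vertex_set G Q \<inter> vertex_set G R = {u, v} \<and>
     T = P \<union> Q \<union> R)"

definition tight_handcuff :: "('v, 'e) mgraph \<Rightarrow> 'e set \<Rightarrow> 'e set \<Rightarrow> 'e set \<Rightarrow> bool" where
  "tight_handcuff G C D X \<longleftrightarrow> is_cycle G C \<and> is_cycle G D \<and> C \<inter> D = {} \<and>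
     card (vertex_set G C \<inter> vertex_set G D) = 1 \<and> X = C \<union> D"

definition loose_handcuff :: "('v, 'e) mgraph \<Rightarrow> 'e set \<Rightarrow> 'e set \<Rightarrow> 'e set \<Rightarrow> bool" where
  "loose_handcuff G C D X \<longleftrightarrow> is_cycle G C \<and> is_cycle G D \<and>
     vertex_set G C \<inter> vertex_set G D = {} \<and>
     (\<exists>u v P. path_between G u v P \<and>
        vertex_set G P \<inter> vertex_set G C = {u} \<and>
        vertex_set G P \<inter> vertex_set G D = {v} \<and>
        X = C \<union> D \<union> P)"

definition connected_graph :: "('v, 'e) mgraph \<Rightarrow> bool" where
  "connected_graph G \<longleftrightarrow> (\<forall>u\<in>verts G. \<forall>v\<in>verts G. \<exists>P. path_between G u v P)"

text \<open>Vertex connectivity; loops and parallel edges have no influence on it.\<close>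

definition graph_k_connected :: "nat \<Rightarrow> ('v, 'e) mgraph \<Rightarrow> bool" where
  "graph_k_connected k G \<longleftrightarrow> card (verts G) > k \<and>
     (\<forall>X\<subseteq>verts G. card X < k \<longrightarrow> connected_graph (delete_verts G X))"

text \<open>The simplification: loops are removed and every parallel class becomes a single edge,
  named by the common pair of ends of its members.\<close>

definition simplification :: "('v, 'e) mgraph \<Rightarrow> ('v, 'v set) mgraph" where
  "simplification G =
     \<lparr>verts = verts G, edges = {ends G e | e. e \<in> edges G \<and> card (ends G e) = 2}, ends = (\<lambda>p. p)\<rparr>"

definition complete_graph :: "'v set \<Rightarrow> ('v, 'v set) mgraph" where
  "complete_graph V = \<lparr>verts = V, edges = {p. p \<subseteq> V \<and> card p = 2}, ends = (\<lambda>p. p)\<rparr>"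


section \<open>Matroids given by their circuits\<close>

text \<open>The notions below are meant for finite ground sets; the circuit axioms are not part of
  the record.\<close>

record 'e circuit_system =
  ground :: "'e set"
  circuits :: "'e set set"

definition indep :: "'e circuit_system \<Rightarrow> 'e set \<Rightarrow> bool" where
  "indep M I \<longleftrightarrow> I \<subseteq> ground M \<and> \<not> (\<exists>C\<in>circuits M. C \<subseteq> I)"

definition rank :: "'e circuit_system \<Rightarrow> 'e set \<Rightarrow> nat" where
  "rank M X = Max {card I | I. I \<subseteq> X \<and> indep M I}"

definition flat :: "'e circuit_system \<Rightarrow> 'e set \<Rightarrow> bool" where
  "flat M F \<longleftrightarrow> F \<subseteq> ground M \<and> (\<forall>e\<in>ground M - F. rank M (insert e F) > rank M F)"

text \<open>The circuits of \<open>M/F\<close> are the minimal non-empty sets \<open>C - F\<close> with \<open>C\<close> a circuit of \<open>M\<close>.\<close>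

definition contract :: "'e circuit_system \<Rightarrow> 'e set \<Rightarrow> 'e circuit_system" where
  "contract M F =
     (let S = {C - F | C. C \<in> circuits M} - {{}}
      in \<lparr>ground = ground M - F, circuits = {D \<in> S. \<not> (\<exists>D'\<in>S. D' \<subset> D)}\<rparr>)"

definition connected_matroid :: "'e circuit_system \<Rightarrow> bool" where
  "connected_matroid M \<longleftrightarrow>
     (\<forall>e\<in>ground M. \<forall>f\<in>ground M. e \<noteq> f \<longrightarrow> (\<exists>C\<in>circuits M. e \<in> C \<and> f \<in> C))"

definition unbreakable :: "'e circuit_system \<Rightarrow> bool" where
  "unbreakable M \<longleftrightarrow>
     connected_matroid M \<and> (\<forall>F. flat M F \<longrightarrow> connected_matroid (contract M F))"

text \<open>Tutte's \<open>k\<close>-separations: the condition \<open>r(X) + r(E - X) - r(M) < k\<close> is written additively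
  to avoid truncated subtraction.\<close>

definition separation :: "nat \<Rightarrow> 'e circuit_system \<Rightarrow> 'e set \<Rightarrow> bool" where
  "separation k M X \<longleftrightarrow> X \<subseteq> ground M \<and> k \<le> card X \<and> k \<le> card (ground M - X) \<and>
     rank M X + rank M (ground M - X) < rank M (ground M) + k"

definition matroid_n_connected :: "nat \<Rightarrow> 'e circuit_system \<Rightarrow> bool" where
  "matroid_n_connected n M \<longleftrightarrow> (\<forall>k X. 1 \<le> k \<and> k < n \<longrightarrow> \<not> separation k M X)"


section \<open>Quasi-biased graphs and their matroids\<close>

text \<open>Members of the tripartition are allowed to be empty.\<close>

definition quasi_biased_graph ::
  "('v, 'e) mgraph \<Rightarrow> 'e set set \<Rightarrow> 'e set set \<Rightarrow> 'e set set \<Rightarrow> bool" where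
  "quasi_biased_graph G \<B> \<L> \<F> \<longleftrightarrow> multigraph G \<and>
     \<B> \<union> \<L> \<union> \<F> = {C. is_cycle G C} \<and> \<B> \<inter> \<L> = {} \<and> \<B> \<inter> \<F> = {} \<and> \<L> \<inter> \<F> = {} \<and>
     (\<forall>T. is_theta G T \<longrightarrow> card {C\<in>\<B>. C \<subseteq> T} \<noteq> 2) \<and>
     (\<forall>C\<in>\<L>. \<forall>D\<in>\<F>. vertex_set G C \<inter> vertex_set G D \<noteq> {})"

definition quasi_graphic_matroid ::
  "('v, 'e) mgraph \<Rightarrow> 'e set set \<Rightarrow> 'e set set \<Rightarrow> 'e set set \<Rightarrow> 'e circuit_system" where
  "quasi_graphic_matroid G \<B> \<L> \<F> =
     \<lparr>ground = edges G,
      circuits =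
        \<B>
        \<union> {T. is_theta G T \<and> \<not> (\<exists>C\<in>\<B>. C \<subseteq> T)}
        \<union> {X. \<exists>C D. tight_handcuff G C D X \<and> C \<notin> \<B> \<and> D \<notin> \<B>}
        \<union> {C \<union> D | C D. C \<in> \<L> \<and> D \<in> \<L> \<and> vertex_set G C \<inter> vertex_set G D = {}}
        \<union> {X. \<exists>C D. loose_handcuff G C D X \<and> C \<in> \<F> \<and> D \<in> \<F>}\<rparr>"

end

theory Submission
  imports Defs
begin

text \<open>
  If \<open>M\<close> is unbreakable and \<open>F\<close> is a flat, the edges outside \<open>F\<close> cannot split into two parts such that
  every circuit meeting both parts contains, modulo \<open>F\<close>, a smaller one. Two kinds of flats suffice:
  \<open>E(G - x - y)\<close> for non-adjacent \<open>x\<close>, \<open>y\<close>, if it contains an unbalanced cycle, and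
  a maximal balanced edge set minus the star of one of its vertices.

  The first kind shows that the vertices outside an unbalanced cycle form a clique. The second kind gives
  an unbalanced cycle avoiding \<open>x\<close> for each non-adjacent \<open>x\<close>, \<open>y\<close>. If there are disjoint non-adjacent
  pairs, they can be chosen as \<open>xy\<close>, \<open>uv\<close> with \<open>G - {x, y, u, v}\<close> connected; then some balanced
  set \<open>S\<close> contains all edges except some between \<open>{x, y}\<close> and \<open>{u, v}\<close>, and every other vertex is a
  cut vertex of \<open>(V, S)\<close>, against the clique property. So non-adjacent pairs meet. The second kind of
  flat excludes triangles of such pairs, and the theta property excludes three of them at one vertex.
\<close>

text \<open>Unbreakability enters only through minimality: two elements outside a flat
  \<open>F\<close> share a circuit of \<open>M/F\<close>, and a circuit of \<open>M\<close> with a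
  smaller non-empty part outside \<open>F\<close> refutes this. So any two edges of the star to be
  separated should be dependent modulo \<open>F\<close>; a balanced cycle through both, or a fixed
  unbalanced cycle inside \<open>F\<close>, achieves this. The classes \<L> and \<F> hardly differ
  here, since two disjoint unbalanced cycles belong to the same class and, with any connecting path,
  contain a circuit; only loops in a star need care. A balanced set restricts adjacency once it is
  maximal: each edge outside it closes only unbalanced cycles, and the vertices missed by such a
  cycle form a clique. The bound 7 is four vertices of two disjoint pairs plus three: one left-over
  vertex and a part of size two when the pairs are chosen, two non-cut vertices and a third one at
  the end.\<close>

section \<open>Paths\<close>

text \<open>The vertex set is carried beside the edge set because the trivial path has no edges, so
  \<open>vertex_set\<close> would lose its only vertex.\<close>

inductive simple_path :: "('v, 'e) mgraph \<Rightarrow> 'v \<Rightarrow> 'v \<Rightarrow> 'e set \<Rightarrow> 'v set \<Rightarrow> bool"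
  for G :: "('v, 'e) mgraph" where
  trivial: "u \<in> verts G \<Longrightarrow> simple_path G u u {} {u}"
| step: "simple_path G w v P W \<Longrightarrow> e \<in> edges G \<Longrightarrow> ends G e = {u, w} \<Longrightarrow> u \<in> verts G \<Longrightarrow> u \<notin> W \<Longrightarrow>
    simple_path G u v (insert e P) (insert u W)"

lemma simple_path_basic:
  assumes "simple_path G u v P W"
  shows "u \<in> W" "v \<in> W" "W \<subseteq> verts G" "P \<subseteq> edges G" "finite P" "finite W"
  using assms by (induction rule: simple_path.induct) auto

lemma simple_path_vertices:
  assumes "simple_path G u v P W"
  shows "W = insert u (vertex_set G P)"
  using assms by (induction rule: simple_path.induct) (auto simp: vertex_set_def)

lemma simple_path_vertices':
  assumes "simple_path G u v P W" "u \<noteq> v"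
  shows "W = vertex_set G P"
  using assms(1)
proof cases
  case trivial
  then show ?thesis using assms(2) by simp
next
  case (step w P' W' e)
  then show ?thesis using simple_path_vertices[OF assms(1)] by (auto simp: vertex_set_def)
qed

lemma simple_path_edge_ends:
  assumes "simple_path G u v P W" "e \<in> P"
  shows "\<exists>a b. ends G e = {a, b} \<and> a \<noteq> b \<and> a \<in> W \<and> b \<in> W"
  using assms
proof (induction rule: simple_path.induct)
  case (step w v P W e' u)
  then show ?case
    using simple_path_basic(1)[OF step.hyps(1)] by (cases "e = e'") (blast, blast)
qed simp

lemma simple_path_ends_subset:
  assumes "simple_path G u v P W" "e \<in> P"
  shows "ends G e \<subseteq> W"
  using simple_path_edge_ends[OF assms] by auto

lemma simple_path_eq_iff:
  assumes "simple_path G u v P W"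
  shows "u = v \<longleftrightarrow> P = {}"
  using assms by (induction rule: simple_path.induct) (auto dest: simple_path_basic)

lemma simple_path_closed_trivial:
  assumes "simple_path G u u P W"
  shows "P = {}" "W = {u}"
  using simple_path_eq_iff[OF assms] simple_path_vertices[OF assms] by (auto simp: vertex_set_def)

lemma simple_path_append:
  assumes "simple_path G u w P W" "simple_path G w v Q X" "W \<inter> X = {w}"
  shows "simple_path G u v (P \<union> Q) (W \<union> X)"
  using assms
proof (induction arbitrary: rule: simple_path.induct)
  case (trivial u)
  then show ?case by (simp add: insert_absorb simple_path_basic)
next
  case (step z w P W e u)
  have "w \<in> W" using simple_path_basic step.hyps(1) by fast
  then have "W \<inter> X = {w}" "u \<notin> X" using step.prems step.hyps by auto
  then have "simple_path G z v (P \<union> Q) (W \<union> X)" using step by blast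
  then show ?case using simple_path.step[of G z v "P \<union> Q" "W \<union> X" e u] step.hyps \<open>u \<notin> X\<close> by simp
qed

lemma simple_path_single:
  assumes "e \<in> edges G" "ends G e = {u, v}" "u \<in> verts G" "v \<in> verts G" "u \<noteq> v"
  shows "simple_path G u v {e} {u, v}"
  using simple_path.step[OF simple_path.trivial, of v G e u] assms by simp

lemma simple_path_rev:
  assumes "simple_path G u v P W"
  shows "simple_path G v u P W"
  using assms
proof (induction rule: simple_path.induct)
  case (trivial u)
  then show ?case by (rule simple_path.trivial)
next
  case (step w v P W e u)
  have w: "w \<in> W" "w \<in> verts G" using simple_path_basic[OF step.hyps(1)] by auto
  then have "w \<noteq> u" using step by auto
  then have "simple_path G w u {e} {w, u}"
    using step w by (intro simple_path_single) (auto simp: insert_commute)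
  then have "simple_path G v u (P \<union> {e}) (W \<union> {w, u})"
    by (rule simple_path_append[OF step.IH]) (use w step in auto)
  then show ?case using w by (simp add: insert_absorb insert_commute)
qed

lemma simple_path_first_hit:
  assumes "simple_path G u v P W" "W \<inter> Z \<noteq> {}"
  obtains z P1 W1 P2 W2 where "simple_path G u z P1 W1" "simple_path G z v P2 W2"
    "P = P1 \<union> P2" "W = W1 \<union> W2" "W1 \<inter> W2 = {z}" "P1 \<inter> P2 = {}" "W1 \<inter> Z = {z}"
  using assms
proof (induction arbitrary: thesis rule: simple_path.induct)
  case (trivial u)
  have "simple_path G u u {} {u}" using trivial by (intro simple_path.trivial)
  then show ?case using trivial by auto
next
  case (step w v P W e u)
  have sp: "simple_path G u v (insert e P) (insert u W)"
    using step.hyps by (rule simple_path.step)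
  have eP: "e \<notin> P" using simple_path_ends_subset[OF step.hyps(1)] step.hyps by auto
  show ?case
  proof (cases "u \<in> Z")
    case True
    show ?thesis
      by (rule step.prems(1)[of u "{}" "{u}" "insert e P" "insert u W"])
        (use True sp step in \<open>auto intro: simple_path.trivial\<close>)
  next
    case False
    then obtain z P1 W1 P2 W2 where *: "simple_path G w z P1 W1" "simple_path G z v P2 W2"
      "P = P1 \<union> P2" "W = W1 \<union> W2" "W1 \<inter> W2 = {z}" "P1 \<inter> P2 = {}" "W1 \<inter> Z = {z}"
      using step by blast
    show ?thesis
    proof (rule step.prems(1)[of z "insert e P1" "insert u W1" P2 W2])
      show "simple_path G u z (insert e P1) (insert u W1)"
        using * step.hyps by (intro simple_path.step) auto
    qed (use * step.hyps eP False in auto)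
  qed
qed

lemma simple_path_split:
  assumes "simple_path G u v P W" "z \<in> W"
  obtains P1 W1 P2 W2 where "simple_path G u z P1 W1" "simple_path G z v P2 W2"
    "P = P1 \<union> P2" "W = W1 \<union> W2" "W1 \<inter> W2 = {z}" "P1 \<inter> P2 = {}"
proof -
  have "W \<inter> {z} \<noteq> {}" using assms(2) by simp
  then obtain y P1 W1 P2 W2 where *: "simple_path G u y P1 W1" "simple_path G y v P2 W2"
    "P = P1 \<union> P2" "W = W1 \<union> W2" "W1 \<inter> W2 = {y}" "P1 \<inter> P2 = {}" "W1 \<inter> {z} = {y}"
    by (rule simple_path_first_hit[OF assms(1)])
  then have "y = z" by blast
  then show ?thesis using that * by simp
qed

lemma simple_path_split_edge:
  assumes "simple_path G u v P W" "f \<in> P"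
  obtains a b P1 W1 P2 W2 where "simple_path G u a P1 W1" "simple_path G b v P2 W2"
    "ends G f = {a, b}" "P = insert f (P1 \<union> P2)" "W = W1 \<union> W2" "W1 \<inter> W2 = {}"
    "f \<notin> P1" "f \<notin> P2"
  using assms
proof (induction arbitrary: thesis rule: simple_path.induct)
  case (step w v P W e u)
  have eP: "e \<notin> P" using simple_path_ends_subset[OF step.hyps(1)] step.hyps by auto
  show ?case
  proof (cases "f = e")
    case True
    show ?thesis
      by (rule step.prems(1)[of u "{}" "{u}" w P W])
        (use True eP step in \<open>auto intro: simple_path.trivial\<close>)
  next
    case False
    then obtain a b P1 W1 P2 W2 where *: "simple_path G w a P1 W1" "simple_path G b v P2 W2"
      "ends G f = {a, b}" "P = insert f (P1 \<union> P2)" "W = W1 \<union> W2" "W1 \<inter> W2 = {}" "f \<notin> P1" "f \<notin> P2"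
      using step by blast
    show ?thesis
    proof (rule step.prems(1)[of a "insert e P1" "insert u W1" b P2 W2])
      show "simple_path G u a (insert e P1) (insert u W1)"
        using * step.hyps by (intro simple_path.step) auto
    qed (use * step.hyps eP False in auto)
  qed
qed simp

lemma simple_path_degree:
  assumes "simple_path G u v P W" "g \<in> P" "z \<in> ends G g" "z \<noteq> u" "z \<noteq> v"
  shows "\<exists>g'\<in>P. g' \<noteq> g \<and> z \<in> ends G g'"
proof -
  have "z \<in> W" using simple_path_ends_subset assms by fast
  then obtain P1 W1 P2 W2 where *: "simple_path G u z P1 W1" "simple_path G z v P2 W2"
    "P = P1 \<union> P2" "P1 \<inter> P2 = {}"
    by (rule simple_path_split[OF assms(1)])
  have "z \<in> vertex_set G P1" "z \<in> vertex_set G P2"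
    using simple_path_vertices'[OF *(1)] simple_path_vertices'[OF *(2)]
      simple_path_basic(2)[OF *(1)] simple_path_basic(1)[OF *(2)] assms(4,5) by auto
  then obtain g1 g2 where "g1 \<in> P1" "z \<in> ends G g1" "g2 \<in> P2" "z \<in> ends G g2"
    unfolding vertex_set_def by fast
  then have "g1 \<noteq> g2" "g1 \<in> P" "g2 \<in> P" using * by auto
  then show ?thesis using \<open>z \<in> ends G g1\<close> \<open>z \<in> ends G g2\<close> by metis
qed

lemma simple_path_between_sets:
  assumes "simple_path G u v P W" "u \<in> A" "v \<in> B" "A \<inter> B = {}"
  obtains a b Q X where "simple_path G a b Q X" "Q \<subseteq> P" "X \<subseteq> W" "X \<inter> A = {a}" "X \<inter> B = {b}"
proof -
  have "W \<inter> B \<noteq> {}" using simple_path_basic assms by fast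
  then obtain b P1 W1 where 1: "simple_path G u b P1 W1" "P1 \<subseteq> P" "W1 \<subseteq> W" "W1 \<inter> B = {b}"
    using simple_path_first_hit[OF assms(1)] by (metis Un_upper1)
  have "W1 \<inter> A \<noteq> {}" using simple_path_basic 1 assms by fast
  then obtain a P2 W2 where 2: "simple_path G b a P2 W2" "P2 \<subseteq> P1" "W2 \<subseteq> W1" "W2 \<inter> A = {a}"
    using simple_path_first_hit[OF simple_path_rev[OF 1(1)]] by (metis Un_upper1)
  have "W2 \<inter> B = {b}" using 1 2 simple_path_basic[OF 2(1)] by auto
  then show ?thesis using that[OF simple_path_rev[OF 2(1)]] 1 2 by auto
qed

lemma simple_path_to_lists:
  assumes "simple_path G u v P W"
  shows "\<exists>vs es. length vs = Suc (length es) \<and> distinct vs \<and> set vs = W \<and> set es \<subseteq> edges G \<and>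
     (\<forall>i<length es. ends G (es ! i) = {vs ! i, vs ! Suc i}) \<and>
     hd vs = u \<and> last vs = v \<and> P = set es"
  using assms
proof (induction rule: simple_path.induct)
  case (trivial u)
  then show ?case by (intro exI[of _ "[u]"] exI[of _ "[]"]) auto
next
  case (step w v P W e u)
  then obtain vs es where *: "length vs = Suc (length es)" "distinct vs" "set vs = W" "set es \<subseteq> edges G"
     "\<forall>i<length es. ends G (es ! i) = {vs ! i, vs ! Suc i}"
     "hd vs = w" "last vs = v" "P = set es" by blast
  have "vs \<noteq> []" using * by auto
  then have "ends G ((e # es) ! i) = {(u # vs) ! i, (u # vs) ! Suc i}" if "i < length (e # es)" for i
    using * that step.hyps by (cases i) (auto simp: hd_conv_nth)
  then show ?case using * step.hyps \<open>vs \<noteq> []\<close>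
    by (intro exI[of _ "u # vs"] exI[of _ "e # es"]) auto
qed

lemma simple_path_of_lists:
  assumes "length vs = Suc (length es)" "distinct vs" "set vs \<subseteq> verts G" "set es \<subseteq> edges G"
     "\<forall>i<length es. ends G (es ! i) = {vs ! i, vs ! Suc i}"
  shows "simple_path G (hd vs) (last vs) (set es) (set vs)"
  using assms
proof (induction es arbitrary: vs)
  case Nil
  then obtain u where "vs = [u]" by (auto simp: length_Suc_conv)
  then show ?case using Nil by (auto intro: simple_path.trivial)
next
  case (Cons e es)
  then obtain u w ws where vs: "vs = u # w # ws" "length ws = length es" by (auto simp: length_Suc_conv)
  have "ends G (es ! i) = {(w # ws) ! i, (w # ws) ! Suc i}" if "i < length es" for i
    using Cons.prems(5) that vs by (metis length_Cons Suc_less_eq nth_Cons_Suc)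
  moreover have "ends G e = {u, w}" using Cons.prems(5) vs by fastforce
  ultimately show ?case
    using Cons.IH[of "w # ws"] Cons.prems vs simple_path.step[of G w _ "set es" "set (w # ws)" e u] by auto
qed

lemma path_between_iff: "path_between G u v P \<longleftrightarrow> (\<exists>W. simple_path G u v P W)"
proof
  assume "path_between G u v P"
  then show "\<exists>W. simple_path G u v P W"
    unfolding path_between_def using simple_path_of_lists by blast
next
  assume "\<exists>W. simple_path G u v P W"
  then obtain W where W: "simple_path G u v P W" by blast
  show "path_between G u v P"
    using simple_path_to_lists[OF W] simple_path_basic[OF W] unfolding path_between_def by metis
qed

text \<open>Opening a cycle at one edge lets cycles inherit the induction on paths. The condition
  \<open>e \<notin> P\<close> only bites for 2-cycles, where the path is a single edge parallel to
  \<open>e\<close>.\<close>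

lemma is_cycle_iff:
  "is_cycle G C \<longleftrightarrow>
    (\<exists>e u. u \<in> verts G \<and> e \<in> edges G \<and> ends G e = {u} \<and> C = {e}) \<or>
    (\<exists>e u v P W. simple_path G u v P W \<and> u \<noteq> v \<and> e \<in> edges G \<and> e \<notin> P \<and> ends G e = {u, v} \<and>
       C = insert e P)" (is "_ \<longleftrightarrow> ?L \<or> ?N")
proof
  assume "is_cycle G C"
  then obtain vs es where *: "es \<noteq> []" "length vs = length es" "distinct vs" "distinct es"
     "set vs \<subseteq> verts G" "set es \<subseteq> edges G"
     "\<forall>i<length es. ends G (es ! i) = {vs ! i, vs ! (Suc i mod length es)}"
     "C = set es" unfolding is_cycle_def by blast
  define n where "n = length es"
  show "?L \<or> ?N"
  proof (cases "n = 1")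
    case True
    then obtain e u where "es = [e]" "vs = [u]" using * n_def by (metis One_nat_def length_0_conv length_Suc_conv)
    then show ?thesis using * by auto
  next
    case False
    then have n: "n \<ge> 2" using * n_def by (metis One_nat_def Suc_leI le_neq_implies_less length_greater_0_conv Suc_1)
    have es: "es = butlast es @ [last es]" using * by simp
    have vs: "vs \<noteq> []" using * by auto
    have "ends G (butlast es ! i) = {vs ! i, vs ! Suc i}" if "i < length (butlast es)" for i
    proof -
      have "i < length es" "Suc i mod length es = Suc i" using that by auto
      then show ?thesis using *(7) that by (simp add: nth_butlast)
    qed
    then have sp: "simple_path G (hd vs) (last vs) (set (butlast es)) (set vs)"
      using * by (intro simple_path_of_lists) (auto dest: in_set_butlastD)
    have "ends G (last es) = {vs ! (n - 1), vs ! 0}"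
    proof -
      have "Suc (n - 1) = length es" using n n_def by simp
      then have "n - 1 < length es" "Suc (n-1) mod length es = 0" using n_def by auto
      then show ?thesis using * n_def by (metis last_conv_nth)
    qed
    then have "ends G (last es) = {hd vs, last vs}"
      using vs * n_def by (simp add: hd_conv_nth last_conv_nth insert_commute)
    moreover have "hd vs \<noteq> last vs"
      using vs n n_def * by (simp add: hd_conv_nth last_conv_nth nth_eq_iff_index_eq)
    moreover have "last es \<notin> set (butlast es)" using *(4) es by (metis distinct_butlast not_distinct_conv_prefix distinct_append disjoint_iff list.set_intros(1))
    moreover have "C = insert (last es) (set (butlast es))" using *(8) es by (metis Un_insert_right list.set(1,2) set_append sup_bot_right)
    moreover have "last es \<in> edges G" using * by auto
    ultimately show ?thesis using sp by blast
  qed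
next
  assume "?L \<or> ?N"
  then show "is_cycle G C"
  proof
    assume ?L
    then obtain e u where "u \<in> verts G" "e \<in> edges G" "ends G e = {u}" "C = {e}" by blast
    then show ?thesis unfolding is_cycle_def by (intro exI[of _ "[u]"] exI[of _ "[e]"]) auto
  next
    assume ?N
    then obtain e u v P W where *: "simple_path G u v P W" "u \<noteq> v" "e \<in> edges G" "e \<notin> P"
      "ends G e = {u, v}" "C = insert e P" by blast
    obtain vs es where l: "length vs = Suc (length es)" "distinct vs" "set vs = W" "set es \<subseteq> edges G"
     "\<forall>i<length es. ends G (es ! i) = {vs ! i, vs ! Suc i}"
     "hd vs = u" "last vs = v" "P = set es" using simple_path_to_lists[OF *(1)] by blast
    \<comment> \<open>The list of a path does not record that its edges are distinct; a repeated
      edge would join two different consecutive pairs of vertices.\<close>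
    have "distinct es"
    proof (rule ccontr)
      assume "\<not> distinct es"
      then obtain i j where ij: "i < j" "j < length es" "es ! i = es ! j"
        by (metis distinct_conv_nth linorder_neqE_nat)
      then have "{vs ! i, vs ! Suc i} = {vs ! j, vs ! Suc j}" using l(5) by (metis less_trans)
      then have "vs ! i = vs ! j \<or> vs ! i = vs ! Suc j" by blast
      then show False using ij l by (auto simp: nth_eq_iff_index_eq)
    qed
    moreover have "ends G ((es @ [e]) ! i) = {vs ! i, vs ! (Suc i mod length (es @ [e]))}"
      if "i < length (es @ [e])" for i
    proof (cases "i = length es")
      case True
      then have "(es @ [e]) ! i = e" "Suc i mod length (es @ [e]) = 0" by auto
      moreover have "vs \<noteq> []" using l by auto
      moreover have "vs ! i = v" using True l calculation by (simp add: last_conv_nth)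
      moreover have "vs ! 0 = u" using l calculation by (simp add: hd_conv_nth)
      ultimately show ?thesis using * by (auto simp: insert_commute)
    next
      case False
      then have "i < length es" using that by simp
      then show ?thesis using l by (simp add: nth_append)
    qed
    ultimately show ?thesis unfolding is_cycle_def
      using * l simple_path_basic[OF *(1)] by (intro exI[of _ vs] exI[of _ "es @ [e]"]) auto
  qed
qed

section \<open>Cycles and thetas\<close>

lemma is_cycleE:
  assumes "is_cycle G C"
  obtains (loop) e u where "u \<in> verts G" "e \<in> edges G" "ends G e = {u}" "C = {e}"
  | (path) e u v P W where "simple_path G u v P W" "u \<noteq> v" "e \<in> edges G" "e \<notin> P" "ends G e = {u, v}"
      "C = insert e P"
  using assms unfolding is_cycle_iff by metis

lemma is_cycle_loopI: "u \<in> verts G \<Longrightarrow> e \<in> edges G \<Longrightarrow> ends G e = {u} \<Longrightarrow> is_cycle G {e}"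
  unfolding is_cycle_iff by blast

lemma is_cycle_pathI:
  "simple_path G u v P W \<Longrightarrow> u \<noteq> v \<Longrightarrow> e \<in> edges G \<Longrightarrow> e \<notin> P \<Longrightarrow> ends G e = {u, v} \<Longrightarrow>
    is_cycle G (insert e P)"
  unfolding is_cycle_iff by blast

lemma cycle_vertex_set:
  assumes "simple_path G u v P W" "u \<noteq> v" "ends G e = {u, v}"
  shows "vertex_set G (insert e P) = W"
  using simple_path_vertices'[OF assms(1,2)] simple_path_basic(1,2)[OF assms(1)] assms(3)
  by (auto simp: vertex_set_def)

lemma cycle_basic:
  assumes "is_cycle G C"
  shows "C \<subseteq> edges G" "finite C" "C \<noteq> {}" "vertex_set G C \<subseteq> verts G"
proof -
  have "C \<subseteq> edges G \<and> finite C \<and> C \<noteq> {} \<and> vertex_set G C \<subseteq> verts G"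
    using assms
  proof (cases rule: is_cycleE)
    case (loop e u)
    then show ?thesis by (auto simp: vertex_set_def)
  next
    case (path e u v P W)
    then show ?thesis
      using simple_path_basic[OF path(1)] cycle_vertex_set[OF path(1,2,5)] by auto
  qed
  then show "C \<subseteq> edges G" "finite C" "C \<noteq> {}" "vertex_set G C \<subseteq> verts G" by auto
qed

text \<open>Any edge can be the closing one: cut the path at \<open>e\<close> and join the two
  pieces through the old closing edge \<open>f\<close>.\<close>

lemma cycle_edge_path:
  assumes "is_cycle G C" "e \<in> C" "ends G e = {a, b}" "a \<noteq> b"
  shows "simple_path G a b (C - {e}) (vertex_set G C)"
  using assms(1)
proof (cases rule: is_cycleE)
  case (loop f u)
  then show ?thesis using assms by auto
next
  case (path f u v P W)
  have W: "vertex_set G C = W" using cycle_vertex_set[OF path(1,2,5)] path by simp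
  have "\<exists>a' b'. simple_path G a' b' (C - {e}) W \<and> ends G e = {a', b'}"
  proof (cases "e = f")
    case True
    then have "C - {e} = P" using path by auto
    then show ?thesis using True path by auto
  next
    case False
    then have "e \<in> P" using path assms by auto
    then obtain x y P1 W1 P2 W2 where *: "simple_path G u x P1 W1" "simple_path G y v P2 W2"
    "ends G e = {x, y}" "P = insert e (P1 \<union> P2)" "W = W1 \<union> W2" "W1 \<inter> W2 = {}"
    "e \<notin> P1" "e \<notin> P2" by (rule simple_path_split_edge[OF path(1)])
    have "simple_path G x u P1 W1" using * simple_path_rev by fast
    moreover have "simple_path G u v {f} {u, v}"
      using path simple_path_basic[OF path(1)] by (intro simple_path_single) auto
    ultimately have "simple_path G x v (P1 \<union> {f}) (W1 \<union> {u, v})"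
      by (rule simple_path_append)
        (use * simple_path_basic(1)[OF *(1)] simple_path_basic(2)[OF *(2)] in auto)
    then have "simple_path G x y (P1 \<union> {f} \<union> P2) (W1 \<union> {u, v} \<union> W2)"
      by (rule simple_path_append[OF _ simple_path_rev[OF *(2)]])
       (use * simple_path_basic(1)[OF *(1)] simple_path_basic(2)[OF *(2)] in auto)
    moreover have "P1 \<union> {f} \<union> P2 = C - {e}" "W1 \<union> {u, v} \<union> W2 = W"
      using * path False simple_path_basic(1)[OF *(1)] simple_path_basic(2)[OF *(2)] by auto
    ultimately show ?thesis using * by auto
  qed
  then obtain a' b' where "simple_path G a' b' (C - {e}) W" "ends G e = {a', b'}" by blast
  then show ?thesis using W assms simple_path_rev by (metis doubleton_eq_iff)
qed

lemma cycle_loop: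
  assumes "is_cycle G C" "e \<in> C" "ends G e = {a}"
  shows "C = {e}"
  using assms(1)
proof (cases rule: is_cycleE)
  case (path f u v P W)
  then show ?thesis using assms simple_path_edge_ends[OF path(1)]
    by (metis doubleton_eq_iff insert_absorb2 insertE)
qed (use assms in auto)

lemma cycle_edge_ends:
  assumes "is_cycle G C" "e \<in> C"
  obtains a b where "ends G e = {a, b}"
  using assms(1)
proof (cases rule: is_cycleE)
  case (loop f u)
  then show ?thesis using assms that[of u u] by auto
next
  case (path f u v P W)
  then show ?thesis using assms that simple_path_edge_ends[OF path(1)] by (metis insertE)
qed

lemma doubleton_other:
  assumes "A = {a, b}" "z \<in> A" "A \<noteq> {z}"
  obtains y where "A = {z, y}" "z \<noteq> y"
  using assms by (cases "z = a") auto

lemma cycle_degree: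
  assumes "is_cycle G C" "e \<in> C" "z \<in> ends G e" "ends G e \<noteq> {z}"
  shows "\<exists>e'\<in>C. e' \<noteq> e \<and> z \<in> ends G e' \<and> ends G e' \<noteq> {z}"
proof -
  obtain a where a: "ends G e = {z, a}" "z \<noteq> a"
    using cycle_edge_ends[OF assms(1,2)] doubleton_other assms(3,4) by metis
  have sp: "simple_path G z a (C - {e}) (vertex_set G C)"
    by (rule cycle_edge_path[OF assms(1,2) a])
  then have "vertex_set G C = vertex_set G (C - {e})" "z \<in> vertex_set G C"
    using simple_path_vertices'[OF sp a(2)] simple_path_basic(1)[OF sp] by auto
  then obtain e' where e': "e' \<in> C - {e}" "z \<in> ends G e'" unfolding vertex_set_def by auto
  then have "ends G e' \<noteq> {z}" using simple_path_edge_ends[OF sp e'(1)] by auto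
  then show ?thesis using e' by blast
qed

text \<open>The first vertex of a path has degree one in it, so no cycle uses the first
  edge.\<close>

lemma path_no_cycle:
  assumes "simple_path G u v P W" "C \<subseteq> P"
  shows "\<not> is_cycle G C"
  using assms
proof (induction rule: simple_path.induct)
  case (trivial u)
  then show ?case using cycle_basic(3) by fast
next
  case (step w v P W e u)
  have w: "w \<noteq> u" using simple_path_basic(1)[OF step.hyps(1)] step.hyps by auto
  show ?case
  proof
    assume C: "is_cycle G C"
    then have "e \<in> C" using step by blast
    then obtain e' where "e' \<in> C" "e' \<noteq> e" "u \<in> ends G e'"
      using cycle_degree[OF C, of e u] step.hyps w by auto
    then show False using step simple_path_ends_subset[OF step.hyps(1), of e'] by auto
  qed
qed

text \<open>An edge of \<open>D\<close> outside \<open>C\<close> would confine \<open>C\<close> to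
  the path that remains of \<open>D\<close>.\<close>

lemma cycle_minimal:
  assumes "is_cycle G C" "is_cycle G D" "C \<subseteq> D"
  shows "C = D"
proof (rule ccontr)
  assume "C \<noteq> D"
  then obtain e where e: "e \<in> D" "e \<notin> C" using assms by auto
  obtain a b where ab: "ends G e = {a, b}" using cycle_edge_ends[OF assms(2) e(1)] .
  show False
  proof (cases "a = b")
    case True
    then have "D = {e}" using cycle_loop assms e ab by fastforce
    then show ?thesis using e assms cycle_basic(3)[OF assms(1)] by auto
  next
    case False
    have "C \<subseteq> D - {e}" using assms e by auto
    then show ?thesis using path_no_cycle[OF cycle_edge_path[OF assms(2) e(1) ab False]] assms by blast
  qed
qed

lemma path_nonempty_ex_edge:
  assumes "simple_path G p q Q X" "p \<noteq> q"
  obtains e z Q' X' where "e \<in> edges G" "ends G e = {p, z}" "z \<noteq> p" "simple_path G z q Q' X'"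
    "p \<notin> X'" "Q = insert e Q'" "e \<notin> Q'" "X = insert p X'"
  using assms(1)
proof cases
  case trivial
  then show ?thesis using assms by simp
next
  case (step w P W e)
  then show ?thesis
    using that[of e w P W] simple_path_basic(1)[OF step(3)] simple_path_ends_subset[OF step(3)] by auto
qed

lemma cycle_of_paths:
  assumes "simple_path G p q P W" "simple_path G p q Q X" "P \<inter> Q = {}" "W \<inter> X = {p, q}" "p \<noteq> q"
  shows "is_cycle G (P \<union> Q)"
proof -
  obtain e z Q' X' where *: "e \<in> edges G" "ends G e = {p, z}" "z \<noteq> p" "simple_path G z q Q' X'"
    "p \<notin> X'" "Q = insert e Q'" "e \<notin> Q'" "X = insert p X'"
    using path_nonempty_ex_edge[OF assms(2,5)] .
  have "simple_path G z p (Q' \<union> P) (X' \<union> W)"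
    by (rule simple_path_append[OF *(4) simple_path_rev[OF assms(1)]])
      (use * assms in auto)
  then have "is_cycle G (insert e (Q' \<union> P))"
    by (rule is_cycle_pathI) (use * assms in \<open>auto simp: insert_commute\<close>)
  moreover have "insert e (Q' \<union> P) = P \<union> Q" using * by auto
  ultimately show ?thesis by simp
qed

lemma cycle_split:
  assumes "is_cycle G C" "p \<in> vertex_set G C" "q \<in> vertex_set G C" "p \<noteq> q"
  obtains P W Q X where "simple_path G p q P W" "simple_path G p q Q X" "P \<inter> Q = {}"
    "W \<inter> X = {p, q}" "C = P \<union> Q" "vertex_set G C = W \<union> X"
proof -
  obtain e where e: "e \<in> C" "p \<in> ends G e" using assms unfolding vertex_set_def by auto
  have nl: "ends G e \<noteq> {p}"
  proof
    assume "ends G e = {p}"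
    moreover have "C = {e}" using cycle_loop[OF assms(1) e(1)] calculation by blast
    ultimately show False using assms unfolding vertex_set_def by auto
  qed
  obtain z where z: "ends G e = {p, z}" "p \<noteq> z"
    using cycle_edge_ends[OF assms(1) e(1)] doubleton_other e nl by metis
  have sp: "simple_path G p z (C - {e}) (vertex_set G C)"
    by (rule cycle_edge_path[OF assms(1) e(1) z])
  obtain P1 W1 P2 W2 where *: "simple_path G p q P1 W1" "simple_path G q z P2 W2"
    "C - {e} = P1 \<union> P2" "vertex_set G C = W1 \<union> W2" "W1 \<inter> W2 = {q}" "P1 \<inter> P2 = {}"
    by (rule simple_path_split[OF sp assms(3)])
  have "p \<in> W1" "z \<in> W2" using simple_path_basic * by metis+
  then have "p \<notin> W2" using * assms by auto
  have "e \<in> edges G" "p \<in> verts G" using cycle_basic[OF assms(1)] e assms by auto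
  have "simple_path G p q (insert e P2) (insert p W2)"
    by (rule simple_path.step[OF simple_path_rev[OF *(2)]]) (fact | rule z)+
  moreover have "P1 \<inter> insert e P2 = {}" "C = P1 \<union> insert e P2" using * e by auto
  moreover have "W1 \<inter> insert p W2 = {p, q}" "vertex_set G C = W1 \<union> insert p W2"
    using * \<open>p \<in> W1\<close> by auto
  ultimately show ?thesis using that[OF *(1), of "insert e P2" "insert p W2"] by blast
qed

text \<open>Walk along \<open>D\<close> from both ends of an edge outside \<open>C\<close> until
  \<open>C\<close> is met. If both walks stopped at the same vertex, the cycles would share only
  that vertex.\<close>

lemma cycle_chord_path:
  assumes C: "is_cycle G C" and D: "is_cycle G D" and "C \<noteq> D"
    and "a0 \<in> vertex_set G C \<inter> vertex_set G D" "b0 \<in> vertex_set G C \<inter> vertex_set G D" "a0 \<noteq> b0"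
  obtains p q Q X where "p \<noteq> q" "simple_path G p q Q X" "Q \<subseteq> D" "Q \<inter> C = {}"
    "X \<inter> vertex_set G C = {p, q}"
proof -
  have "\<not> D \<subseteq> C" using cycle_minimal[OF D C] assms(3) by auto
  then obtain f where f: "f \<in> D" "f \<notin> C" by auto
  obtain a b where ab: "ends G f = {a, b}" using cycle_edge_ends[OF D f(1)] .
  have "a \<noteq> b"
  proof
    assume "a = b"
    then have "D = {f}" using cycle_loop D f ab by fastforce
    then show False using assms ab \<open>a = b\<close> by (auto simp: vertex_set_def)
  qed
  define Z where "Z = vertex_set G C"
  define R where "R = D - {f}"
  define Y where "Y = vertex_set G D"
  have sp: "simple_path G a b R Y" unfolding R_def Y_def by (rule cycle_edge_path[OF D f(1) ab \<open>a \<noteq> b\<close>])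
  have "Y \<inter> Z \<noteq> {}" using assms Z_def Y_def by auto
  obtain p P1 W1 P2 W2 where p: "simple_path G a p P1 W1" "simple_path G p b P2 W2"
    "R = P1 \<union> P2" "Y = W1 \<union> W2" "W1 \<inter> W2 = {p}" "P1 \<inter> P2 = {}" "W1 \<inter> Z = {p}"
    by (rule simple_path_first_hit[OF sp \<open>Y \<inter> Z \<noteq> {}\<close>])
  have "W2 \<inter> Z \<noteq> {}" using p by auto
  obtain q Q1 X1 Q2 X2 where q: "simple_path G b q Q1 X1" "simple_path G q p Q2 X2"
    "P2 = Q1 \<union> Q2" "W2 = X1 \<union> X2" "X1 \<inter> X2 = {q}" "Q1 \<inter> Q2 = {}" "X1 \<inter> Z = {q}"
    by (rule simple_path_first_hit[OF simple_path_rev[OF p(2)] \<open>W2 \<inter> Z \<noteq> {}\<close>])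
  have "p \<noteq> q"
  proof
    assume "p = q"
    then have "X2 = {p}" using q(2) simple_path_closed_trivial by fast
    then have "Y \<inter> Z \<subseteq> {p}" using p q \<open>p = q\<close> by auto
    then show False using assms Y_def Z_def by auto
  qed
  have "p \<in> X2" using simple_path_basic(2)[OF q(2)] .
  then have pX1: "p \<notin> X1" using q \<open>p \<noteq> q\<close> by auto
  have "b \<in> X1" "a \<in> W1" using simple_path_basic q p by metis+
  have "W1 \<inter> X1 = {}" using p q pX1 by auto
  have fE: "f \<in> edges G" using cycle_basic[OF D] f by auto
  have ab': "simple_path G a b {f} {a, b}"
    by (rule simple_path_single) (use ab \<open>a \<noteq> b\<close> fE simple_path_basic[OF sp] in auto)
  have "simple_path G p b (P1 \<union> {f}) (W1 \<union> {a, b})"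
    by (rule simple_path_append[OF simple_path_rev[OF p(1)] ab'])
      (use \<open>W1 \<inter> X1 = {}\<close> \<open>b \<in> X1\<close> \<open>a \<in> W1\<close> in auto)
  then have *: "simple_path G p q (P1 \<union> {f} \<union> Q1) (W1 \<union> {a, b} \<union> X1)"
    by (rule simple_path_append[OF _ q(1)])
      (use \<open>W1 \<inter> X1 = {}\<close> \<open>b \<in> X1\<close> \<open>a \<in> W1\<close> in auto)
  have "P1 \<inter> C = {}" "Q1 \<inter> C = {}"
  proof -
    have "e \<notin> C" if eP: "e \<in> P1" for e
    proof
      assume "e \<in> C"
      then have "ends G e \<subseteq> Z" unfolding Z_def vertex_set_def by auto
      moreover obtain x y where "ends G e = {x, y}" "x \<noteq> y" "x \<in> W1" "y \<in> W1"
        using simple_path_edge_ends[OF p(1) eP] by blast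
      ultimately have "x \<in> W1 \<inter> Z" "y \<in> W1 \<inter> Z" by auto
      then show False using p(7) \<open>x \<noteq> y\<close> by simp
    qed
    then show "P1 \<inter> C = {}" by auto
    have "e \<notin> C" if eP: "e \<in> Q1" for e
    proof
      assume "e \<in> C"
      then have "ends G e \<subseteq> Z" unfolding Z_def vertex_set_def by auto
      moreover obtain x y where "ends G e = {x, y}" "x \<noteq> y" "x \<in> X1" "y \<in> X1"
        using simple_path_edge_ends[OF q(1) eP] by blast
      ultimately have "x \<in> X1 \<inter> Z" "y \<in> X1 \<inter> Z" by auto
      then show False using q(7) \<open>x \<noteq> y\<close> by simp
    qed
    then show "Q1 \<inter> C = {}" by auto
  qed
  show ?thesis
  proof (rule that[OF \<open>p \<noteq> q\<close> *])
    show "P1 \<union> {f} \<union> Q1 \<subseteq> D" using R_def p q f by auto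
    show "(P1 \<union> {f} \<union> Q1) \<inter> C = {}" using \<open>P1 \<inter> C = {}\<close> \<open>Q1 \<inter> C = {}\<close> f by auto
    show "(W1 \<union> {a, b} \<union> X1) \<inter> vertex_set G C = {p, q}"
      using p q \<open>a \<in> W1\<close> \<open>b \<in> X1\<close> Z_def by auto
  qed
qed

text \<open>The start \<open>u\<close> of the path meets nothing else, so a degree count strips the
  edges of the path off the cycle one by one.\<close>

lemma cycle_avoids_pendant_path:
  assumes "simple_path G u v P W" "(W - {v}) \<inter> vertex_set G S = {}" "is_cycle G C" "C \<subseteq> P \<union> S"
  shows "C \<subseteq> S"
  using assms
proof (induction rule: simple_path.induct)
  case (step w v P W e u)
  have w: "w \<in> W" "v \<in> W" using simple_path_basic[OF step.hyps(1)] by auto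
  have "e \<notin> C"
  proof
    assume "e \<in> C"
    then obtain e' where e': "e' \<in> C" "e' \<noteq> e" "u \<in> ends G e'"
      using cycle_degree[OF \<open>is_cycle G C\<close>, of e u] step.hyps w by fastforce
    then have "e' \<in> P \<or> e' \<in> S" using step by auto
    moreover have "e' \<notin> P" using simple_path_ends_subset[OF step.hyps(1)] e' step.hyps by auto
    moreover have "e' \<notin> S" using e' step.prems step.hyps w unfolding vertex_set_def by fastforce
    ultimately show False by blast
  qed
  then show ?case using step by blast
qed simp

section \<open>Theta subgraphs and their cycles\<close>

definition theta_paths where
  "theta_paths G u v P WP Q WQ R WR \<longleftrightarrow> u \<noteq> v \<and>
     simple_path G u v P WP \<and> simple_path G u v Q WQ \<and> simple_path G u v R WR \<and>
     P \<inter> Q = {} \<and> P \<inter> R = {} \<and> Q \<inter> R = {} \<and>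
     WP \<inter> WQ = {u, v} \<and> WP \<inter> WR = {u, v} \<and> WQ \<inter> WR = {u, v}"

lemma theta_paths_sym:
  assumes "theta_paths G u v P WP Q WQ R WR"
  shows "theta_paths G u v Q WQ P WP R WR" "theta_paths G u v R WR Q WQ P WP"
    "theta_paths G u v P WP R WR Q WQ"
  using assms unfolding theta_paths_def by (auto simp: Int_commute)

lemma theta_paths_cycle:
  assumes "theta_paths G u v P WP Q WQ R WR"
  shows "is_cycle G (P \<union> Q)" "is_cycle G (P \<union> R)" "is_cycle G (Q \<union> R)"
  using assms cycle_of_paths unfolding theta_paths_def by metis+

lemma is_theta_iff:
  "is_theta G T \<longleftrightarrow> (\<exists>u v P WP Q WQ R WR. theta_paths G u v P WP Q WQ R WR \<and> T = P \<union> Q \<union> R)"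
proof
  assume "is_theta G T"
  then obtain u v P Q R WP WQ WR where "u \<noteq> v" "simple_path G u v P WP" "simple_path G u v Q WQ"
    "simple_path G u v R WR" "P \<inter> Q = {}" "P \<inter> R = {}" "Q \<inter> R = {}"
    "vertex_set G P \<inter> vertex_set G Q = {u, v}" "vertex_set G P \<inter> vertex_set G R = {u, v}"
     "vertex_set G Q \<inter> vertex_set G R = {u, v}" "T = P \<union> Q \<union> R"
    unfolding is_theta_def path_between_iff by blast
  moreover from this have "WP = vertex_set G P" "WQ = vertex_set G Q" "WR = vertex_set G R"
    using simple_path_vertices' by metis+
  ultimately show "\<exists>u v P WP Q WQ R WR. theta_paths G u v P WP Q WQ R WR \<and> T = P \<union> Q \<union> R"
    unfolding theta_paths_def by blast
next
  assume "\<exists>u v P WP Q WQ R WR. theta_paths G u v P WP Q WQ R WR \<and> T = P \<union> Q \<union> R"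
  then obtain u v P WP Q WQ R WR where *: "theta_paths G u v P WP Q WQ R WR" "T = P \<union> Q \<union> R" by blast
  then have "WP = vertex_set G P" "WQ = vertex_set G Q" "WR = vertex_set G R"
    using simple_path_vertices' unfolding theta_paths_def by metis+
  then show "is_theta G T"
    unfolding is_theta_def path_between_iff using * unfolding theta_paths_def by blast
qed

text \<open>Without \<open>f\<close> the path \<open>P\<close> falls into two dangling pieces, which
  no cycle can enter.\<close>

lemma theta_cycle_missing_edge:
  assumes "theta_paths G u v P WP Q WQ R WR" "is_cycle G C" "C \<subseteq> P \<union> Q \<union> R" "f \<in> P" "f \<notin> C"
  shows "C = Q \<union> R"
proof -
  have th: "u \<noteq> v" "simple_path G u v P WP" "simple_path G u v Q WQ" "simple_path G u v R WR"
     "WP \<inter> WQ = {u, v}" "WP \<inter> WR = {u, v}"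
    using assms unfolding theta_paths_def by auto
  have VQR: "vertex_set G (Q \<union> R) = WQ \<union> WR"
    using simple_path_vertices'[OF th(3,1)] simple_path_vertices'[OF th(4,1)]
    unfolding vertex_set_def by auto
  obtain a b P1 W1 P2 W2 where *: "simple_path G u a P1 W1" "simple_path G b v P2 W2"
    "ends G f = {a, b}" "P = insert f (P1 \<union> P2)" "WP = W1 \<union> W2" "W1 \<inter> W2 = {}"
    by (rule simple_path_split_edge[OF th(2) assms(4)])
  have uv: "u \<in> W1" "v \<in> W2" using simple_path_basic * by metis+
  have V2: "vertex_set G P2 \<subseteq> W2"
    using simple_path_vertices[OF *(2)] by auto
  have 1: "C \<subseteq> P1 \<union> (P2 \<union> (Q \<union> R))" using assms * by auto
  have "vertex_set G (P2 \<union> (Q \<union> R)) = vertex_set G P2 \<union> (WQ \<union> WR)"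
    unfolding VQR[symmetric] vertex_set_def by auto
  then have "(W1 - {u}) \<inter> vertex_set G (P2 \<union> (Q \<union> R)) = {}"
    using * th V2 uv by auto
  from cycle_avoids_pendant_path[OF simple_path_rev[OF *(1)] this assms(2) 1]
  have 2: "C \<subseteq> P2 \<union> (Q \<union> R)" .
  have "(W2 - {v}) \<inter> vertex_set G (Q \<union> R) = {}" using VQR * th uv by auto
  from cycle_avoids_pendant_path[OF *(2) this assms(2) 2]
  have "C \<subseteq> Q \<union> R" .
  then show ?thesis using cycle_minimal assms theta_paths_cycle by metis
qed

lemma theta_cycles:
  assumes th: "theta_paths G u v P WP Q WQ R WR"
  shows "is_cycle G C \<and> C \<subseteq> P \<union> Q \<union> R \<longleftrightarrow> C = P \<union> Q \<or> C = P \<union> R \<or> C = Q \<union> R"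
proof
  assume C: "is_cycle G C \<and> C \<subseteq> P \<union> Q \<union> R"
  show "C = P \<union> Q \<or> C = P \<union> R \<or> C = Q \<union> R"
  proof (cases "P \<union> Q \<union> R \<subseteq> C")
    case True
    then have "P \<union> Q = C" using cycle_minimal[of G "P \<union> Q" C] theta_paths_cycle[OF th] C by auto
    then show ?thesis by simp
  next
    case False
    then consider f where "f \<in> P" "f \<notin> C" | f where "f \<in> Q" "f \<notin> C" | f where "f \<in> R" "f \<notin> C" by auto
    then show ?thesis
    proof cases
      case 1
      then show ?thesis using theta_cycle_missing_edge[OF th] C by blast
    next
      case 2
      then have "C = P \<union> R"
        using theta_cycle_missing_edge[OF theta_paths_sym(1)[OF th]] C by (metis Un_commute)
      then show ?thesis by blast
    next
      case 3
      then have "C = Q \<union> P"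
        using theta_cycle_missing_edge[OF theta_paths_sym(2)[OF th]] C
        by (metis Un_assoc Un_commute)
      then show ?thesis by blast
    qed
  qed
qed (use theta_paths_cycle[OF th] in auto)

lemma theta_edge_in_cycle_with:
  assumes "theta_paths G u v P WP Q WQ R WR" "g \<in> P \<union> Q \<union> R"
  shows "\<exists>C. is_cycle G C \<and> C \<subseteq> P \<union> Q \<union> R \<and> g \<in> C" "\<exists>C. is_cycle G C \<and> C \<subseteq> P \<union> Q \<union> R \<and> g \<notin> C"
proof -
  show "\<exists>C. is_cycle G C \<and> C \<subseteq> P \<union> Q \<union> R \<and> g \<in> C" using theta_cycles[OF assms(1)] assms(2) by blast
  have "P \<inter> Q = {}" "P \<inter> R = {}" "Q \<inter> R = {}" using assms(1) unfolding theta_paths_def by auto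
  then have "g \<notin> P \<union> Q \<or> g \<notin> P \<union> R \<or> g \<notin> Q \<union> R" by auto
  then show "\<exists>C. is_cycle G C \<and> C \<subseteq> P \<union> Q \<union> R \<and> g \<notin> C" using theta_cycles[OF assms(1)] by metis
qed

text \<open>Prepares the descents below: \<open>Q\<close> is an ear of \<open>C\<close> inside
  \<open>D\<close>, and \<open>P\<close> is named to be the side of \<open>C\<close> containing
  \<open>e\<close>. Exchanging \<open>R\<close> for \<open>Q\<close> moves \<open>C\<close> towards
  \<open>D\<close>.\<close>

lemma cycles_theta:
  assumes "is_cycle G C" "is_cycle G D" "C \<noteq> D"
    and "a0 \<in> vertex_set G C \<inter> vertex_set G D" "b0 \<in> vertex_set G C \<inter> vertex_set G D" "a0 \<noteq> b0"
    and "e \<in> C"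
  obtains p q P WP R WR Q WQ where "theta_paths G p q P WP R WR Q WQ" "C = P \<union> R" "Q \<subseteq> D" "Q \<inter> C = {}"
    "e \<in> P" "p \<in> vertex_set G C" "p \<in> vertex_set G D" "q \<in> vertex_set G C" "q \<in> vertex_set G D"
proof -
  obtain p q Q X where Q: "p \<noteq> q" "simple_path G p q Q X" "Q \<subseteq> D" "Q \<inter> C = {}"
    "X \<inter> vertex_set G C = {p, q}"
    by (rule cycle_chord_path[OF assms(1-6)])
  have XV: "X \<subseteq> vertex_set G D" using simple_path_vertices'[OF Q(2,1)] Q(3) unfolding vertex_set_def by auto
  have pq: "p \<in> vertex_set G C" "q \<in> vertex_set G C" "p \<in> X" "q \<in> X" using Q(5) by auto
  obtain P W R Y where PR: "simple_path G p q P W" "simple_path G p q R Y" "P \<inter> R = {}"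
    "W \<inter> Y = {p, q}" "C = P \<union> R" "vertex_set G C = W \<union> Y"
    by (rule cycle_split[OF assms(1) pq(1,2) Q(1)])
  have "p \<in> W" "q \<in> W" "p \<in> Y" "q \<in> Y" using simple_path_basic PR by metis+
  then have "theta_paths G p q P W R Y Q X"
    unfolding theta_paths_def using PR Q by auto
  moreover from this have "theta_paths G p q R Y P W Q X" by (rule theta_paths_sym)
  moreover have "p \<in> vertex_set G D" "q \<in> vertex_set G D" using pq XV by auto
  ultimately show ?thesis using that PR(5) Q(3,4) pq(1,2) assms(7) by (metis Un_commute Un_iff)
qed

section \<open>Connected vertex sets\<close>

text \<open>Taken over an arbitrary relation, so that it serves both for adjacency and for the edges
  of a set \<open>S\<close>. Every vertex reaches itself, even outside \<open>T\<close>.\<close>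

definition reach :: "('v \<Rightarrow> 'v \<Rightarrow> bool) \<Rightarrow> 'v set \<Rightarrow> 'v \<Rightarrow> 'v \<Rightarrow> bool" where
  "reach R T = (\<lambda>a b. a \<in> T \<and> b \<in> T \<and> R a b)\<^sup>*\<^sup>*"

definition conn :: "('v \<Rightarrow> 'v \<Rightarrow> bool) \<Rightarrow> 'v set \<Rightarrow> bool" where
  "conn R T \<longleftrightarrow> (\<forall>a\<in>T. \<forall>b\<in>T. reach R T a b)"

definition eadj :: "('v, 'e) mgraph \<Rightarrow> 'e set \<Rightarrow> 'v \<Rightarrow> 'v \<Rightarrow> bool" where
  "eadj G S a b \<longleftrightarrow> a \<noteq> b \<and> (\<exists>e\<in>S. ends G e = {a, b})"

lemma eadj_sym: "eadj G S a b \<Longrightarrow> eadj G S b a"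
  unfolding eadj_def by (auto simp: insert_commute)

lemma reach_eadj_path:
  assumes "reach (eadj G S) T a b" "a \<in> T" "T \<subseteq> verts G" "S \<subseteq> edges G"
  shows "\<exists>P W. simple_path G a b P W \<and> P \<subseteq> S \<and> W \<subseteq> T"
  using assms(1,2) unfolding reach_def
proof (induction rule: converse_rtranclp_induct)
  case base
  then show ?case using simple_path.trivial[of b G] assms(3) by blast
next
  case (step a c)
  then obtain P W where P: "simple_path G c b P W" "P \<subseteq> S" "W \<subseteq> T" by blast
  show ?case
  proof (cases "a \<in> W")
    case True
    then obtain P2 W2 where "simple_path G a b P2 W2" "P2 \<subseteq> P" "W2 \<subseteq> W"
      using simple_path_split[OF P(1)] by (metis Un_upper2)
    then show ?thesis using P by blast
  next
    case False
    obtain e where e: "e \<in> S" "ends G e = {a, c}" using step unfolding eadj_def by blast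
    then have "simple_path G a b (insert e P) (insert a W)"
      using P step assms False by (intro simple_path.step) auto
    then show ?thesis using e P step by blast
  qed
qed

lemma simple_path_reach:
  assumes "simple_path G u v P W" "P \<subseteq> S" "W \<subseteq> T"
  shows "reach (eadj G S) T u v"
  using assms
proof (induction rule: simple_path.induct)
  case (step w v P W e u)
  have "w \<in> W" using simple_path_basic[OF step.hyps(1)] by auto
  then have "eadj G S u w" "u \<in> T" "w \<in> T" using step unfolding eadj_def by auto
  moreover have "reach (eadj G S) T w v" using step by auto
  ultimately show ?case unfolding reach_def
    by - (rule converse_rtranclp_into_rtranclp[where b = w], simp_all)
qed (simp add: reach_def)

lemma conn_eadj_path:
  assumes "conn (eadj G S) T" "a \<in> T" "b \<in> T" "T \<subseteq> verts G" "S \<subseteq> edges G"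
  obtains P W where "simple_path G a b P W" "P \<subseteq> S" "W \<subseteq> T"
  using reach_eadj_path[of G S T a b] assms unfolding conn_def by blast

lemma reach_refl: "reach R T a a"
  unfolding reach_def by simp

lemma reach_trans: "reach R T a b \<Longrightarrow> reach R T b c \<Longrightarrow> reach R T a c"
  unfolding reach_def by (rule rtranclp_trans)

lemma reach_step: "a \<in> T \<Longrightarrow> b \<in> T \<Longrightarrow> R a b \<Longrightarrow> reach R T a b"
  unfolding reach_def by (simp add: r_into_rtranclp)

lemma reach_mono:
  assumes "reach R T a b" "T \<subseteq> T'" "\<And>c d. c \<in> T \<Longrightarrow> d \<in> T \<Longrightarrow> R c d \<Longrightarrow> R' c d"
  shows "reach R' T' a b"
  using assms(1) unfolding reach_def
  by (rule rtranclp_mono[THEN predicate2D, rotated]) (use assms(2,3) in auto)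

lemma reach_sym:
  assumes "symp R" "reach R T a b"
  shows "reach R T b a"
proof -
  have "symp (\<lambda>a b. a \<in> T \<and> b \<in> T \<and> R a b)" using assms(1) unfolding symp_def by blast
  then show ?thesis using assms(2) unfolding reach_def by (metis sympD symp_rtranclp)
qed

lemma conn_singleton: "conn R {a}"
  unfolding conn_def by (simp add: reach_refl)

lemma conn_Un_edge:
  assumes "symp R" "conn R S" "conn R T" "s \<in> S" "t \<in> T" "R s t"
  shows "conn R (S \<union> T)"
proof -
  have S: "reach R (S \<union> T) a b" if "a \<in> S" "b \<in> S" for a b
    using assms(2) that reach_mono[of R S a b "S \<union> T" R] unfolding conn_def by blast
  have T: "reach R (S \<union> T) a b" if "a \<in> T" "b \<in> T" for a b
    using assms(3) that reach_mono[of R T a b "S \<union> T" R] unfolding conn_def by blast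
  have st: "reach R (S \<union> T) s t" using assms by (intro reach_step) auto
  have ST: "reach R (S \<union> T) a b" if "a \<in> S" "b \<in> T" for a b
    using reach_trans[OF reach_trans[OF S[OF that(1) assms(4)] st] T[OF assms(5) that(2)]] .
  show ?thesis
    unfolding conn_def using S T ST reach_sym[OF assms(1) ST] by blast
qed

lemma conn_insert:
  assumes "symp R" "conn R T" "t \<in> T" "R t a"
  shows "conn R (insert a T)"
  using conn_Un_edge[OF assms(1,2) conn_singleton assms(3) _ assms(4), of a] by simp

lemma conn_cross:
  assumes "conn R T" "A \<subseteq> T" "a0 \<in> A" "b0 \<in> T - A"
  obtains a b where "a \<in> A" "b \<in> T - A" "R a b"
proof -
  have "b0 \<in> A" if no: "\<And>a b. a \<in> A \<Longrightarrow> b \<in> T - A \<Longrightarrow> \<not> R a b"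
  proof -
    have "reach R T a0 b0" using assms unfolding conn_def by blast
    then show "b0 \<in> A" unfolding reach_def
      by (induction rule: rtranclp_induct) (use assms no in auto)
  qed
  then show ?thesis using assms(4) that by blast
qed

section \<open>Components, non-cut vertices and minimal connected sets\<close>

definition comp :: "('v \<Rightarrow> 'v \<Rightarrow> bool) \<Rightarrow> 'v set \<Rightarrow> 'v \<Rightarrow> 'v set" where
  "comp R T a = {b. reach R T a b}"

lemma comp_self: "a \<in> comp R T a"
  unfolding comp_def by (simp add: reach_refl)

lemma comp_subset:
  assumes "a \<in> T"
  shows "comp R T a \<subseteq> T"
proof
  fix b assume "b \<in> comp R T a"
  then have "reach R T a b" unfolding comp_def by simp
  then show "b \<in> T" unfolding reach_def by (induction rule: rtranclp_induct) (use assms in auto)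
qed

lemma comp_closed:
  assumes "a \<in> T" "b \<in> comp R T a" "R b c" "c \<in> T"
  shows "c \<in> comp R T a"
proof -
  have "b \<in> T" using comp_subset assms by fast
  then show ?thesis using assms unfolding comp_def by (auto intro: reach_trans reach_step)
qed

lemma conn_comp:
  assumes "symp R" "a \<in> T"
  shows "conn R (comp R T a)"
proof -
  have *: "reach R (comp R T a) a b" if "b \<in> comp R T a" for b
  proof -
    have "reach R T a b" using that unfolding comp_def by simp
    then have "reach R (comp R T a) a b \<and> b \<in> comp R T a"
      unfolding reach_def
    proof (induction rule: rtranclp_induct)
      case base
      then show ?case using comp_self by simp
    next
      case (step y z)
      then have "z \<in> comp R T a" using comp_closed[OF assms(2)] by blast
      then show ?case using step by (auto intro: rtranclp.rtrancl_into_rtrancl)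
    qed
    then show ?thesis by simp
  qed
  show ?thesis unfolding conn_def using * reach_sym[OF assms(1) *] reach_trans by metis
qed

text \<open>Enlarge \<open>T\<close> to an inclusion-maximal connected proper subset of
  \<open>S\<close>. One more vertex adjacent to it must complete \<open>S\<close>, and this is the
  non-cut vertex \<open>w\<close>.\<close>

lemma conn_grow:
  assumes "symp R" "finite S" "conn R S" "conn R T" "T \<subset> S" "T \<noteq> {}"
  obtains w where "w \<in> S - T" "conn R (S - {w})"
proof -
  define A where "A = {T'. T \<subseteq> T' \<and> T' \<subset> S \<and> conn R T'}"
  have "finite A" using assms(2) unfolding A_def by (simp add: finite_subset[of _ "Pow S"] subset_iff psubset_eq)
  moreover have "T \<in> A" using assms unfolding A_def by simp
  ultimately obtain T' where T': "T' \<in> A" "\<And>X. X \<in> A \<Longrightarrow> T' \<subseteq> X \<Longrightarrow> T' = X"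
    using finite_has_maximal2 by metis
  have *: "T \<subseteq> T'" "T' \<subset> S" "conn R T'" using T' unfolding A_def by auto
  obtain a0 b0 where ab0: "a0 \<in> T'" "b0 \<in> S - T'" using * assms(6) by blast
  have "T' \<subseteq> S" using * by blast
  from assms(3) this ab0 obtain a b where ab: "a \<in> T'" "b \<in> S - T'" "R a b"
    by (rule conn_cross)
  have c: "conn R (insert b T')" by (rule conn_insert) (use ab * assms in auto)
  have "insert b T' = S"
  proof (rule ccontr)
    assume "insert b T' \<noteq> S"
    then have "insert b T' \<in> A" using * ab c unfolding A_def by auto
    then have "T' = insert b T'" using T'(2) by blast
    then show False using ab by blast
  qed
  then have "S - {b} = T'" using ab by auto
  then show ?thesis using that[of b] * ab by auto
qed

lemma conn_remove_leaf:
  assumes "conn R T" "symp R" "\<And>t. t \<in> T \<Longrightarrow> R z t \<Longrightarrow> t = c" "c \<noteq> z"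
  shows "conn R (T - {z})"
  unfolding conn_def
proof (intro ballI)
  fix a b assume ab: "a \<in> T - {z}" "b \<in> T - {z}"
  then have "reach R T a b" using assms(1) unfolding conn_def by blast
  \<comment> \<open>Walks are followed with every visit to \<open>z\<close> replaced by
    \<open>c\<close>, the only vertex through which \<open>z\<close> can be entered or left.\<close>
  then have "reach R (T - {z}) a (if b = z then c else b)"
    unfolding reach_def
  proof (induction rule: rtranclp_induct)
    case base
    then show ?case using ab by simp
  next
    case (step y w)
    then have yw: "y \<in> T" "w \<in> T" "R y w" "R w y" using assms(2) by (auto dest: sympD)
    show ?case
    proof (cases "w = z")
      case True
      show ?thesis
      proof (cases "y = z")
        case True
        then show ?thesis using step \<open>w = z\<close> by simp
      next
        case False
        then have "y = c" using assms(3) yw True by blast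
        then show ?thesis using step False True by simp
      qed
    next
      case False
      show ?thesis
      proof (cases "y = z")
        case True
        then have "w = c" using assms(3) yw by blast
        then show ?thesis using step True False by simp
      next
        case y: False
        then have "(\<lambda>a b. a \<in> T - {z} \<and> b \<in> T - {z} \<and> R a b)\<^sup>*\<^sup>* a y" using step by simp
        then have "(\<lambda>a b. a \<in> T - {z} \<and> b \<in> T - {z} \<and> R a b)\<^sup>*\<^sup>* a w"
          by (rule rtranclp.rtrancl_into_rtrancl) (use yw y False in simp)
        then show ?thesis using False by simp
      qed
    qed
  qed
  then show "reach R (T - {z}) a b" using ab by simp
qed

text \<open>Take the component of \<open>b\<close> in \<open>D - {z1}\<close>; if it misses
  \<open>z2\<close>, adding \<open>z1\<close> to it still leaves out \<open>z2\<close>.\<close>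

lemma conn_separate_one:
  assumes "symp R" "conn R D" "b \<in> D" "z1 \<in> D" "z2 \<in> D" "z1 \<noteq> z2"
  shows "\<exists>T\<subset>D. conn R T \<and> b \<in> T \<and> (z1 \<in> T \<or> z2 \<in> T)"
proof (cases "b = z1 \<or> b = z2")
  case True
  then show ?thesis using conn_singleton[of R b] assms by (intro exI[of _ "{b}"]) auto
next
  case False
  define C where "C = comp R (D - {z1}) b"
  have b: "b \<in> D - {z1}" using False assms by simp
  have C: "conn R C" "C \<subseteq> D - {z1}" "b \<in> C"
    unfolding C_def using conn_comp[OF assms(1) b] comp_subset[OF b, of R] comp_self by auto
  show ?thesis
  proof (cases "z2 \<in> C")
    case True
    then show ?thesis using C assms(4) by (intro exI[of _ C]) auto
  next
    case z2: False
    have "C \<subseteq> D" "z1 \<in> D - C" using C assms by auto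
    from assms(2) this(1) C(3) this(2) obtain s t where st: "s \<in> C" "t \<in> D - C" "R s t"
      by (rule conn_cross)
    then have "t = z1" using comp_closed[OF b, of s R t] unfolding C_def by blast
    then have "conn R (insert z1 C)" using conn_insert[OF assms(1) C(1)] st by blast
    then show ?thesis using C assms z2 by (intro exI[of _ "insert z1 C"]) auto
  qed
qed

lemma four_set_sym:
  "{u, v, x, y} = {x, y, u, v}" "{y, x, u, v} = {x, y, u, v}" "{x, y, v, u} = {x, y, u, v}"
  by auto

lemma card_subset_pair: "A \<subseteq> {s, t} \<Longrightarrow> card A \<le> 2"
  using card_mono[of "{s, t}" A] by (auto simp: card_insert_if split: if_splits)

lemma card_ge_3:
  assumes "\<not> card S \<le> 2"
  obtains a b c where "a \<in> S" "b \<in> S" "c \<in> S" "a \<noteq> b" "a \<noteq> c" "b \<noteq> c"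
proof -
  have "3 \<le> card S" using assms by simp
  then obtain T where T: "T \<subseteq> S" "card T = 3" by (rule obtain_subset_with_card_n)
  obtain a b c where "T = {a, b, c}" "a \<noteq> b" "b \<noteq> c" "a \<noteq> c" using T(2) unfolding card_3_iff by blast
  then show ?thesis using that T(1) by blast
qed

text \<open>In graph terms \<open>S\<close> is an induced path. A third neighbour of
  \<open>z\<close> would allow a component left by \<open>z\<close> to shrink while it still touches
  \<open>z\<close>.\<close>

lemma minimal_connector_degree:
  assumes R: "symp R" "\<And>v. \<not> R v v" and S: "conn R S" "a \<in> S" "b \<in> S"
    and min: "\<And>T. T \<subseteq> S \<Longrightarrow> conn R T \<Longrightarrow> a \<in> T \<Longrightarrow> b \<in> T \<Longrightarrow> T = S"
    and z: "z \<in> S"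
  shows "card {t \<in> S. R z t} \<le> 2"
proof (rule ccontr)
  assume "\<not> card {t \<in> S. R z t} \<le> 2"
  then obtain z1 z2 z3 where "z1 \<in> {t \<in> S. R z t}" "z2 \<in> {t \<in> S. R z t}" "z3 \<in> {t \<in> S. R z t}"
    "z1 \<noteq> z2" "z1 \<noteq> z3" "z2 \<noteq> z3" by (rule card_ge_3)
  then have zz: "z1 \<in> S - {z}" "z2 \<in> S - {z}" "z3 \<in> S - {z}" "R z z1" "R z z2" "R z z3"
    "z1 \<noteq> z2" "z1 \<noteq> z3" "z2 \<noteq> z3" using R(2) by auto
  have RS: "R c d" if "R d c" for c d using R(1) that by (auto dest: sympD)
  have cross: "\<exists>t\<in>comp R (S - {z}) c. R z t" if "c \<in> S" "c \<noteq> z" for c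
  proof -
    have c: "c \<in> S - {z}" using that by simp
    have s: "comp R (S - {z}) c \<subseteq> S" "z \<in> S - comp R (S - {z}) c"
      using comp_subset[OF c, of R] z by auto
    from S(1) s(1) comp_self s(2) obtain s' t where "s' \<in> comp R (S - {z}) c" "t \<in> S - comp R (S - {z}) c" "R s' t"
      by (rule conn_cross)
    moreover from this have "t = z" using comp_closed[OF c, of s' R t] by blast
    ultimately show ?thesis using RS by blast
  qed
  text \<open>A part \<open>D\<close> of \<open>S - {z}\<close> containing two neighbours of \<open>z\<close> could be made smaller.\<close>
  have key: False if D: "conn R D" "D \<subseteq> S - {z}" "c \<in> D" "conn R D'" "D' \<subseteq> S" "z \<in> D'" "D \<inter> D' = {}"
     "a \<in> D \<union> D'" "b \<in> D \<union> D'" "a \<in> D' \<or> a = c" "b \<in> D' \<or> b = c"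
     "y1 \<in> D" "y2 \<in> D" "y1 \<noteq> y2" "R z y1" "R z y2" for D D' c y1 y2
  proof -
    obtain T where T: "T \<subset> D" "conn R T" "c \<in> T" "y1 \<in> T \<or> y2 \<in> T"
      using conn_separate_one[OF R(1) D(1,3,12,13,14)] by blast
    then obtain y where "y \<in> T" "R z y" using D by blast
    then have "conn R (T \<union> D')"
      using conn_Un_edge[OF R(1) D(4) T(2) D(6)] by (metis Un_commute)
    moreover have "T \<union> D' \<subseteq> S" "a \<in> T \<union> D'" "b \<in> T \<union> D'" using T D by auto
    ultimately have "T \<union> D' = S" using min by blast
    then show False using T D by blast
  qed
  \<comment> \<open>If \<open>z\<close> is a terminal, minimality makes \<open>S\<close> consist of
    \<open>z\<close> and the component of the other terminal; otherwise of \<open>z\<close> and the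
    components of both, and two of the three neighbours share one.\<close>
  show False
  proof (cases "z = a \<or> z = b")
    case True
    obtain c where c: "c = a \<or> c = b" "{a, b} = {z, c}" using True by blast
    show False
    proof (cases "c = z")
      case True
      then have "{z} = S" using min[of "{z}"] conn_singleton[of R z] z c by auto
      then show False using zz by auto
    next
      case False
      define D where "D = comp R (S - {z}) c"
      have cS: "c \<in> S - {z}" using c False S by auto
      have D: "conn R D" "D \<subseteq> S - {z}" "c \<in> D"
        unfolding D_def using conn_comp[OF R(1) cS] comp_subset[OF cS, of R] comp_self by auto
      obtain t where "t \<in> D" "R z t" using cross[of c] cS unfolding D_def by blast
      then have "conn R (insert z D)" using conn_insert[OF R(1) D(1)] RS by blast
      moreover have "insert z D \<subseteq> S" "a \<in> insert z D" "b \<in> insert z D" using D z c by blast+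
      ultimately have "insert z D = S" using min by blast
      then have "z1 \<in> D" "z2 \<in> D" using zz by auto
      then show False using key[of D c "{z}" z1 z2] D z c zz conn_singleton[of R z] by blast
    qed
  next
    case False
    then have ab: "a \<in> S - {z}" "b \<in> S - {z}" using S by auto
    define A where "A = comp R (S - {z}) a"
    define B where "B = comp R (S - {z}) b"
    have A: "conn R A" "A \<subseteq> S - {z}" "a \<in> A"
      unfolding A_def using conn_comp[OF R(1) ab(1)] comp_subset[OF ab(1), of R] comp_self by auto
    have B: "conn R B" "B \<subseteq> S - {z}" "b \<in> B"
      unfolding B_def using conn_comp[OF R(1) ab(2)] comp_subset[OF ab(2), of R] comp_self by auto
    obtain s t where s: "s \<in> A" "R z s" and t: "t \<in> B" "R z t"
      using cross[of a] cross[of b] ab unfolding A_def B_def by blast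
    have cA: "conn R (insert z A)" using conn_insert[OF R(1) A(1) s(1)] RS s by blast
    have cB: "conn R (insert z B)" using conn_insert[OF R(1) B(1) t(1)] RS t by blast
    have "conn R (insert z A \<union> B)" using conn_Un_edge[OF R(1) cA B(1) _ t(1), of z] t by simp
    moreover have "insert z A \<union> B \<subseteq> S" "a \<in> insert z A \<union> B" "b \<in> insert z A \<union> B" using A B z by auto
    ultimately have SAB: "insert z A \<union> B = S" using min by blast
    have "A \<inter> B = {}"
    proof (rule ccontr)
      assume "A \<inter> B \<noteq> {}"
      then obtain d where "reach R (S - {z}) a d" "reach R (S - {z}) b d" unfolding A_def B_def comp_def by blast
      then have "reach R (S - {z}) a b" using reach_trans reach_sym[OF R(1)] by metis
      then have "b \<in> A" unfolding A_def comp_def by simp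
      then have "A = S" using min[OF _ A(1,3)] A(2) by blast
      then show False using A z by blast
    qed
    have kA: "\<not> (y1 \<in> A \<and> y2 \<in> A)" if "y1 \<noteq> y2" "R z y1" "R z y2" for y1 y2
      using key[of A a "insert z B" y1 y2] A B cB z \<open>A \<inter> B = {}\<close> that by blast
    have kB: "\<not> (y1 \<in> B \<and> y2 \<in> B)" if "y1 \<noteq> y2" "R z y1" "R z y2" for y1 y2
      using key[of B b "insert z A" y1 y2] A B cA z \<open>A \<inter> B = {}\<close> that by blast
    have "z1 \<in> A \<union> B" "z2 \<in> A \<union> B" "z3 \<in> A \<union> B" using zz SAB by auto
    then show False using kA kB zz by blast
  qed
qed

section \<open>Flats and minimal circuits\<close>

text \<open>A largest independent subset of \<open>F\<close> stays independent after adding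
  \<open>e\<close>, since a circuit in the result would have \<open>e\<close> as its only element
  outside \<open>F\<close>.\<close>

lemma flat_if_no_circuit_adds_one:
  assumes "finite (ground M)" "{} \<notin> circuits M" "F \<subseteq> ground M"
    and "\<And>C g. C \<in> circuits M \<Longrightarrow> C - F \<noteq> {g}"
  shows "flat M F"
  unfolding flat_def
proof (intro conjI ballI)
  fix e assume e: "e \<in> ground M - F"
  define A where "A X = {card I | I. I \<subseteq> X \<and> indep M I}" for X
  have fin: "finite (A X)" if "X \<subseteq> ground M" for X
  proof -
    have "A X \<subseteq> card ` Pow X" unfolding A_def by auto
    then show ?thesis using that assms(1) finite_subset by (metis finite_Pow_iff finite_imageI)
  qed
  \<comment> \<open>Ensures that \<open>Max\<close> is taken over a non-empty set.\<close>
  have "indep M {}" using assms(2) unfolding indep_def by auto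
  then have "A F \<noteq> {}" unfolding A_def by auto
  then have "Max (A F) \<in> A F" using fin assms(3) by simp
  then obtain I where I: "I \<subseteq> F" "indep M I" "card I = Max (A F)" unfolding A_def by auto
  have "indep M (insert e I)"
    unfolding indep_def
  proof (intro conjI notI)
    show "insert e I \<subseteq> ground M" using e I assms by auto
    assume "\<exists>C\<in>circuits M. C \<subseteq> insert e I"
    then obtain C where C: "C \<in> circuits M" "C \<subseteq> insert e I" by blast
    then have "\<not> C \<subseteq> I" using I unfolding indep_def by blast
    then have "C - F = {e}" using C I e by auto
    then show False using assms(4) C by blast
  qed
  then have "card (insert e I) \<in> A (insert e F)" using I unfolding A_def by blast
  then have "card (insert e I) \<le> Max (A (insert e F))" using fin e assms(3) by simp
  moreover have "card (insert e I) = Suc (card I)"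
    using I e assms finite_subset by (metis DiffE card_insert_disjoint subsetD)
  ultimately show "rank M F < rank M (insert e F)" using I unfolding rank_def A_def by simp
qed fact

text \<open>The form in which unbreakability is applied: for a contradiction it suffices to find one
  circuit whose part outside \<open>F\<close> is non-empty and properly inside that of
  \<open>C\<close>.\<close>

lemma unbreakable_minimal_circuit:
  assumes "unbreakable M" "finite (ground M)" "{} \<notin> circuits M" "F \<subseteq> ground M"
    and "\<And>C g. C \<in> circuits M \<Longrightarrow> C - F \<noteq> {g}"
    and "e \<in> ground M - F" "f \<in> ground M - F" "e \<noteq> f"
  obtains C where "C \<in> circuits M" "e \<in> C" "f \<in> C"
    "\<And>C'. C' \<in> circuits M \<Longrightarrow> C' - F \<noteq> {} \<Longrightarrow> \<not> C' - F \<subset> C - F"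
proof -
  have "flat M F" using flat_if_no_circuit_adds_one assms(2-5) by blast
  then have "connected_matroid (contract M F)" using assms(1) unfolding unbreakable_def by blast
  moreover have "ground (contract M F) = ground M - F" unfolding contract_def Let_def by simp
  ultimately obtain D where D: "D \<in> circuits (contract M F)" "e \<in> D" "f \<in> D"
    unfolding connected_matroid_def using assms by metis
  then have "D \<in> {C - F | C. C \<in> circuits M} - {{}}"
    "\<not> (\<exists>D'\<in>{C - F | C. C \<in> circuits M} - {{}}. D' \<subset> D)"
    unfolding contract_def Let_def by auto
  then obtain C where "D = C - F" "C \<in> circuits M" "\<And>C'. C' \<in> circuits M \<Longrightarrow> C' - F \<noteq> {} \<Longrightarrow> \<not> C' - F \<subset> D"
    by blast
  then show ?thesis using that[of C] D by auto
qed

section \<open>Balance\<close>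

locale quasi_biased =
  fixes G :: "('v, 'e) mgraph" and \<B> \<L> \<F> :: "'e set set"
  assumes quasi_biased: "quasi_biased_graph G \<B> \<L> \<F>"
begin

abbreviation "M \<equiv> quasi_graphic_matroid G \<B> \<L> \<F>"
abbreviation "V \<equiv> verts G"
abbreviation "E \<equiv> edges G"
abbreviation "cycle \<equiv> is_cycle G"
abbreviation "VS \<equiv> vertex_set G"

lemma multigraph: "multigraph G" and finite_verts: "finite V" and finite_edges: "finite E"
  using quasi_biased unfolding quasi_biased_graph_def multigraph_def by auto

lemma cycle_iff: "cycle C \<longleftrightarrow> C \<in> \<B> \<or> C \<in> \<L> \<or> C \<in> \<F>"
  using quasi_biased unfolding quasi_biased_graph_def by blast

lemma classes_disjoint: "C \<in> \<B> \<Longrightarrow> C \<notin> \<L>" "C \<in> \<B> \<Longrightarrow> C \<notin> \<F>" "C \<in> \<L> \<Longrightarrow> C \<notin> \<F>"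
  using quasi_biased unfolding quasi_biased_graph_def by auto

lemma LF_meet: "C \<in> \<L> \<Longrightarrow> D \<in> \<F> \<Longrightarrow> VS C \<inter> VS D \<noteq> {}"
  using quasi_biased unfolding quasi_biased_graph_def by auto

lemma edge_ends:
  assumes "e \<in> E"
  obtains a b where "ends G e = {a, b}" "a \<in> V" "b \<in> V"
proof -
  have "ends G e \<subseteq> V" "card (ends G e) = 1 \<or> card (ends G e) = 2"
    using multigraph assms unfolding multigraph_def by auto
  then show ?thesis using that by (metis card_1_singletonE card_2_iff insert_absorb2 insert_subset)
qed

lemma theta_balanced:
  assumes th: "theta_paths G u v P WP Q WQ R WR" and B: "P \<union> Q \<in> \<B>" "P \<union> R \<in> \<B>"
  shows "Q \<union> R \<in> \<B>"
proof (rule ccontr)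
  assume n: "Q \<union> R \<notin> \<B>"
  have "{C \<in> \<B>. C \<subseteq> P \<union> Q \<union> R} = {P \<union> Q, P \<union> R}"
  proof (intro set_eqI iffI)
    fix C assume "C \<in> {C \<in> \<B>. C \<subseteq> P \<union> Q \<union> R}"
    then show "C \<in> {P \<union> Q, P \<union> R}" using theta_cycles[OF th, of C] n cycle_iff by auto
  qed (use B in auto)
  moreover have "P \<union> Q \<noteq> P \<union> R"
  proof -
    have "Q \<noteq> {}" "P \<inter> Q = {}" "Q \<inter> R = {}" using th simple_path_eq_iff unfolding theta_paths_def by metis+
    then show ?thesis by blast
  qed
  ultimately have "card {C \<in> \<B>. C \<subseteq> P \<union> Q \<union> R} = 2" by simp
  moreover have "is_theta G (P \<union> Q \<union> R)" unfolding is_theta_iff using th by blast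
  ultimately show False using quasi_biased unfolding quasi_biased_graph_def by blast
qed

definition balanced :: "'e set \<Rightarrow> bool" where
  "balanced S \<longleftrightarrow> (\<forall>C. cycle C \<longrightarrow> C \<subseteq> S \<longrightarrow> C \<in> \<B>)"

lemma balancedD: "balanced S \<Longrightarrow> cycle C \<Longrightarrow> C \<subseteq> S \<Longrightarrow> C \<in> \<B>"
  unfolding balanced_def by blast

lemma common_edge_two_vertices:
  assumes "cycle C" "cycle D" "e \<in> C" "e \<in> D" "C \<noteq> D"
  obtains a b where "a \<in> VS C \<inter> VS D" "b \<in> VS C \<inter> VS D" "a \<noteq> b"
proof -
  obtain a b where ab: "ends G e = {a, b}" using cycle_edge_ends[OF assms(1,3)] .
  have "a \<noteq> b"
  proof
    assume "a = b"
    then have "C = {e}" "D = {e}" using cycle_loop ab assms by (metis insert_absorb2)+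
    then show False using assms by simp
  qed
  moreover have "a \<in> VS C \<inter> VS D" "b \<in> VS C \<inter> VS D" using ab assms unfolding vertex_set_def by auto
  ultimately show ?thesis using that by blast
qed

text \<open>An ear \<open>Q\<close> of \<open>C\<close> in \<open>D\<close> yields a cycle
  \<open>R \<union> Q\<close> inside \<open>S\<close> and a cycle \<open>P \<union> Q\<close>
  through \<open>e\<close> nearer to \<open>D\<close>. Both are balanced, the latter by induction,
  and the theta condition passes this on to \<open>C\<close>.\<close>

lemma reroute:
  assumes S: "balanced S" and "cycle C" "C \<subseteq> insert e S" "e \<in> C" "D \<in> \<B>" "D \<subseteq> insert e S" "e \<in> D"
  shows "C \<in> \<B>"
  using assms(2-4)
proof (induction "card (C - D)" arbitrary: C rule: less_induct)
  case less
  show ?case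
  proof (rule ccontr)
    assume nB: "C \<notin> \<B>"
    then have "C \<noteq> D" using assms by blast
    have D: "cycle D" using assms cycle_iff by blast
    obtain a b where ab: "a \<in> VS C \<inter> VS D" "b \<in> VS C \<inter> VS D" "a \<noteq> b"
      by (rule common_edge_two_vertices[OF less.prems(1) D less.prems(3) assms(7) \<open>C \<noteq> D\<close>])
    obtain p q P WP R WR Q WQ where th: "theta_paths G p q P WP R WR Q WQ" "C = P \<union> R" "Q \<subseteq> D"
      "Q \<inter> C = {}" "e \<in> P"
      by (rule cycles_theta[OF less.prems(1) D \<open>C \<noteq> D\<close> ab less.prems(3)])
    have PR: "P \<inter> R = {}" using th(1) unfolding theta_paths_def by blast
    have cyc: "cycle (R \<union> Q)" "cycle (P \<union> Q)" using theta_paths_cycle[OF th(1)] by auto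
    have eRQ: "e \<notin> R \<union> Q" using th PR by blast
    then have "R \<union> Q \<in> \<B>" using balancedD[OF S cyc(1)] th less.prems(2) assms(6) by blast
    have "\<not> R \<subseteq> D"
    proof
      assume "R \<subseteq> D"
      then have "R \<union> Q = D" using cycle_minimal[OF cyc(1) D] th by blast
      then show False using eRQ assms by blast
    qed
    then have "(P \<union> Q) - D \<subset> C - D" using th PR by blast
    moreover have "finite (C - D)" using cycle_basic[OF less.prems(1)] by blast
    ultimately have "card ((P \<union> Q) - D) < card (C - D)" by (rule psubset_card_mono[rotated])
    then have "P \<union> Q \<in> \<B>" using less.hyps cyc(2) th less.prems(2) assms(6) by blast
    then have "P \<union> R \<in> \<B>"
      using theta_balanced[of p q Q WQ P WP R WR] theta_paths_sym[OF th(1)] \<open>R \<union> Q \<in> \<B>\<close> th(1)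
      by (metis theta_paths_sym(1,2,3) Un_commute)
    then show False using th nB by blast
  qed
qed

text \<open>Add the star edges one by one. A cycle through the new edge leaves \<open>z\<close> by
  an earlier one, and \<open>reroute\<close> compares it with the given balanced cycle through
  both.\<close>

lemma balanced_Un_star:
  assumes "balanced S" "finite R" "\<And>e. e \<in> R \<Longrightarrow> z \<in> ends G e \<and> ends G e \<noteq> {z}"
    "\<And>e. e \<in> S \<Longrightarrow> z \<in> ends G e \<Longrightarrow> ends G e = {z}"
    "\<And>e e'. e \<in> R \<Longrightarrow> e' \<in> R \<Longrightarrow> e \<noteq> e' \<Longrightarrow> \<exists>C\<in>\<B>. e \<in> C \<and> e' \<in> C \<and> C \<subseteq> insert e (insert e' S)"
  shows "balanced (S \<union> R)"
  using assms(2,3,5)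
proof (induction R rule: finite_induct)
  case empty
  then show ?case using assms by simp
next
  case (insert e R)
  have bal: "balanced (S \<union> R)" using insert by blast
  show ?case
    unfolding balanced_def
  proof (intro allI impI)
    fix C assume C: "cycle C" "C \<subseteq> S \<union> insert e R"
    show "C \<in> \<B>"
    proof (cases "e \<in> C")
      case True
      then obtain e' where e': "e' \<in> C" "e' \<noteq> e" "z \<in> ends G e'" "ends G e' \<noteq> {z}"
        using cycle_degree[OF C(1), of e z] insert.prems by blast
      then have "e' \<in> R" using C assms by blast
      then obtain D where "D \<in> \<B>" "e \<in> D" "D \<subseteq> insert e (insert e' S)"
        using insert.prems(2)[of e e'] e' by blast
      then show ?thesis using reroute[OF bal C(1), of e D] C True \<open>e' \<in> R\<close> by blast
    next
      case False
      then show ?thesis using bal C balancedD by blast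
    qed
  qed
qed

text \<open>Subsets of balanced sets are balanced, so testing single edges amounts to maximality
  under inclusion.\<close>

definition max_balanced :: "'e set \<Rightarrow> bool" where
  "max_balanced S \<longleftrightarrow> S \<subseteq> E \<and> balanced S \<and> (\<forall>e\<in>E - S. \<not> balanced (insert e S))"

lemma max_balanced_extend:
  assumes "balanced S" "S \<subseteq> E"
  obtains S' where "S \<subseteq> S'" "max_balanced S'"
proof -
  define A where "A = {S'. S \<subseteq> S' \<and> S' \<subseteq> E \<and> balanced S'}"
  have "finite A" using finite_edges unfolding A_def by (simp add: finite_subset[of _ "Pow E"] subsetI)
  moreover have "S \<in> A" using assms A_def by blast
  ultimately obtain S' where S': "S' \<in> A" "\<And>X. X \<in> A \<Longrightarrow> S' \<subseteq> X \<Longrightarrow> S' = X"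
    using finite_has_maximal2 by (metis)
  have 1: "S \<subseteq> S'" "S' \<subseteq> E" "balanced S'" using S'(1) unfolding A_def by auto
  have "\<not> balanced (insert e S')" if e: "e \<in> E - S'" for e
  proof
    assume "balanced (insert e S')"
    then have "insert e S' \<in> A" using 1 e unfolding A_def by auto
    then have "S' = insert e S'" using S'(2) by blast
    then show False using e by blast
  qed
  then show ?thesis using that[of S'] 1 unfolding max_balanced_def by simp
qed

lemma max_balanced_unbalanced_cycle:
  assumes "max_balanced S" "f \<in> E - S"
  obtains D where "cycle D" "D \<notin> \<B>" "f \<in> D" "D \<subseteq> insert f S"
proof -
  obtain D where "cycle D" "D \<subseteq> insert f S" "D \<notin> \<B>"
    using assms unfolding max_balanced_def balanced_def by blast
  moreover from this have "f \<in> D" using assms unfolding max_balanced_def balanced_def by blast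
  ultimately show ?thesis using that by blast
qed

text \<open>Were one such cycle balanced, \<open>reroute\<close> would make all cycles closed by
  \<open>f\<close> balanced, and \<open>S\<close> could be enlarged.\<close>

lemma max_balanced_unbalanced:
  assumes "max_balanced S" "f \<in> E - S" "cycle C" "f \<in> C" "C \<subseteq> insert f S"
  shows "C \<notin> \<B>"
  using max_balanced_unbalanced_cycle[OF assms(1,2)] reroute assms unfolding max_balanced_def by metis

section \<open>Circuits of the quasi-graphic matroid\<close>

abbreviation circuit :: "'e set \<Rightarrow> bool" where
  "circuit X \<equiv> X \<in> circuits M"

lemma circuitE:
  assumes "circuit X"
  obtains (balanced) "X \<in> \<B>"
  | (theta) u v P WP Q WQ R WR where "theta_paths G u v P WP Q WQ R WR" "X = P \<union> Q \<union> R"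
      "\<And>C. C \<in> \<B> \<Longrightarrow> \<not> C \<subseteq> X"
  | (tight) C D where "cycle C" "cycle D" "C \<inter> D = {}" "card (VS C \<inter> VS D) = 1" "X = C \<union> D"
      "C \<notin> \<B>" "D \<notin> \<B>"
  | (lift) C D where "C \<in> \<L>" "D \<in> \<L>" "VS C \<inter> VS D = {}" "X = C \<union> D"
  | (loose) C D u v P W where "C \<in> \<F>" "D \<in> \<F>" "VS C \<inter> VS D = {}" "simple_path G u v P W"
      "W \<inter> VS C = {u}" "W \<inter> VS D = {v}" "u \<noteq> v" "X = C \<union> D \<union> P"
proof -
  have "X \<in> \<B> \<or> (is_theta G X \<and> \<not> (\<exists>C\<in>\<B>. C \<subseteq> X))
    \<or> (\<exists>C D. tight_handcuff G C D X \<and> C \<notin> \<B> \<and> D \<notin> \<B>)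
    \<or> (\<exists>C D. X = C \<union> D \<and> C \<in> \<L> \<and> D \<in> \<L> \<and> vertex_set G C \<inter> vertex_set G D = {})
    \<or> (\<exists>C D. loose_handcuff G C D X \<and> C \<in> \<F> \<and> D \<in> \<F>)"
    using assms unfolding quasi_graphic_matroid_def
    by (simp only: circuit_system.simps Un_iff mem_Collect_eq disj_assoc)
  then show ?thesis
  proof (elim disjE, goal_cases)
    case 5
    then obtain C D u v P W where *: "C \<in> \<F>" "D \<in> \<F>" "VS C \<inter> VS D = {}" "simple_path G u v P W"
      "VS P \<inter> VS C = {u}" "VS P \<inter> VS D = {v}" "X = C \<union> D \<union> P"
      unfolding loose_handcuff_def path_between_iff by blast
    moreover have "u \<noteq> v" using * by blast
    moreover have "W = VS P" using * simple_path_vertices' \<open>u \<noteq> v\<close> by metis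
    ultimately show ?thesis using loose by blast
  next
    case 1
    then show ?thesis by (rule balanced)
  next
    case 2
    from 2 have "is_theta G X" and nB: "\<And>C. C \<in> \<B> \<Longrightarrow> \<not> C \<subseteq> X" by auto
    then obtain u v P WP Q WQ R WR where th: "theta_paths G u v P WP Q WQ R WR" "X = P \<union> Q \<union> R"
      unfolding is_theta_iff by (elim exE conjE)
    show ?thesis by (rule theta[OF th nB])
  next
    case 3
    then show ?thesis using tight unfolding tight_handcuff_def by blast
  next
    case 4
    then obtain C D where "C \<in> \<L>" "D \<in> \<L>" "VS C \<inter> VS D = {}" "X = C \<union> D" by blast
    then show ?thesis by (rule lift)
  qed
qed

lemma circuit_balancedI: "X \<in> \<B> \<Longrightarrow> circuit X"
  unfolding quasi_graphic_matroid_def by simp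

lemma circuit_thetaI:
  assumes th: "theta_paths G u v P WP Q WQ R WR" and "P \<union> Q \<notin> \<B>" "P \<union> R \<notin> \<B>" "Q \<union> R \<notin> \<B>"
  shows "circuit (P \<union> Q \<union> R)"
proof -
  have "is_theta G (P \<union> Q \<union> R)" unfolding is_theta_iff using th by blast
  moreover have "\<not> (\<exists>C\<in>\<B>. C \<subseteq> P \<union> Q \<union> R)"
  proof
    assume "\<exists>C\<in>\<B>. C \<subseteq> P \<union> Q \<union> R"
    then obtain C where "C \<in> \<B>" "C \<subseteq> P \<union> Q \<union> R" by blast
    then show False using theta_cycles[OF th, of C] cycle_iff assms(2-4) by auto
  qed
  ultimately show ?thesis unfolding quasi_graphic_matroid_def by simp
qed

lemma circuit_tightI:
  "cycle C \<Longrightarrow> cycle D \<Longrightarrow> C \<inter> D = {} \<Longrightarrow> card (VS C \<inter> VS D) = 1 \<Longrightarrow> C \<notin> \<B> \<Longrightarrow> D \<notin> \<B> \<Longrightarrow>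
    circuit (C \<union> D)"
  unfolding quasi_graphic_matroid_def tight_handcuff_def by auto

lemma circuit_liftI: "C \<in> \<L> \<Longrightarrow> D \<in> \<L> \<Longrightarrow> VS C \<inter> VS D = {} \<Longrightarrow> circuit (C \<union> D)"
  unfolding quasi_graphic_matroid_def by auto

lemma circuit_looseI:
  assumes "C \<in> \<F>" "D \<in> \<F>" "VS C \<inter> VS D = {}" "simple_path G u v P W"
    "W \<inter> VS C = {u}" "W \<inter> VS D = {v}"
  shows "circuit (C \<union> D \<union> P)"
proof -
  have "u \<noteq> v" using assms by blast
  then have "W = VS P" using assms simple_path_vertices' by metis
  then have "loose_handcuff G C D (C \<union> D \<union> P)"
    unfolding loose_handcuff_def path_between_iff using assms cycle_iff by blast
  then show ?thesis unfolding quasi_graphic_matroid_def using assms by auto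
qed

lemma circuit_basic: "circuit X \<Longrightarrow> X \<subseteq> E" "circuit X \<Longrightarrow> X \<noteq> {}"
proof -
  have cyc: "X \<subseteq> E \<and> X \<noteq> {}" if "cycle X" for X using cycle_basic[OF that] by blast
  assume "circuit X"
  then have "X \<subseteq> E \<and> X \<noteq> {}"
  proof (cases rule: circuitE)
    case (theta u v P WP Q WQ R WR)
    then show ?thesis using cyc theta_paths_cycle[OF theta(1)] by (metis Un_empty Un_subset_iff)
  next
    case (loose C D u v P W)
    then show ?thesis using cyc[of C] cyc[of D] cycle_iff simple_path_basic[OF loose(4)] by blast
  qed (use cyc cycle_iff in blast)+
  then show "X \<subseteq> E" "X \<noteq> {}" by auto
qed

lemma ground_M: "ground M = E"
  unfolding quasi_graphic_matroid_def by simp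

text \<open>A vertex of a circuit can lie on just one non-loop edge only at an end of the path of a
  loose handcuff, and the cycle there is then a single loop in \<F>.\<close>

lemma circuit_degree:
  assumes "circuit X" "g \<in> X" "w \<in> ends G g" "ends G g \<noteq> {w}"
  shows "(\<exists>g'\<in>X. g' \<noteq> g \<and> w \<in> ends G g' \<and> ends G g' \<noteq> {w}) \<or> (\<exists>l\<in>X. ends G l = {w} \<and> {l} \<in> \<F>)"
proof -
  have cyc: ?thesis if "cycle C" "C \<subseteq> X" "g \<in> C" for C
    using cycle_degree[OF that(1,3) assms(3,4)] that(2) by blast
  from assms(1) show ?thesis
  proof (cases rule: circuitE)
    case (theta u v P WP Q WQ R WR)
    then show ?thesis using theta_edge_in_cycle_with(1)[OF theta(1)] assms cyc by metis
  next
    case (loose C D u v P W)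
    have CD: "cycle C" "cycle D" using loose cycle_iff by auto
    show ?thesis
    proof (cases "g \<in> C \<union> D")
      case True
      then show ?thesis using cyc CD loose by blast
    next
      case False
      then have gP: "g \<in> P" using assms loose by auto
      have ends_cycle: ?thesis if K: "cycle K" "K \<in> \<F>" "K \<subseteq> X" "g \<notin> K" "w \<in> VS K" for K
      proof -
        obtain k where k: "k \<in> K" "w \<in> ends G k" using K unfolding vertex_set_def by auto
        show ?thesis
        proof (cases "ends G k = {w}")
          case True
          then have "K = {k}" using cycle_loop K k by metis
          then show ?thesis using k K True by blast
        next
          case False
          then have "k \<noteq> g" "k \<in> X" using k K by auto
          then show ?thesis using k False by blast
        qed
      qed
      show ?thesis
      proof (cases "w = u \<or> w = v")
        case True
        then have "w \<in> VS C \<or> w \<in> VS D" using loose by blast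
        then show ?thesis using ends_cycle[OF CD(1)] ends_cycle[OF CD(2)] loose False by blast
      next
        case False
        then obtain g' where "g' \<in> P" "g' \<noteq> g" "w \<in> ends G g'"
          using simple_path_degree[OF loose(4) gP assms(3)] by blast
        moreover from this have "ends G g' \<noteq> {w}" using simple_path_edge_ends[OF loose(4)] by fastforce
        ultimately show ?thesis using loose by blast
      qed
    qed
  qed (use assms cyc cycle_iff in blast)+
qed

lemma cycles_edge_disjoint:
  assumes "cycle C" "VS C \<inter> VS D = {}"
  shows "C \<inter> D = {}"
proof (rule ccontr)
  assume "C \<inter> D \<noteq> {}"
  then obtain e where e: "e \<in> C" "e \<in> D" by blast
  obtain a b where "ends G e = {a, b}" by (rule cycle_edge_ends[OF assms(1) e(1)])
  then show False using e assms(2) unfolding vertex_set_def by auto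
qed

text \<open>No edge lies in all cycles of a theta, of a handcuff or of two disjoint cycles. Hence,
  over a balanced \<open>S\<close>, only balanced cycles can be circuits with a single edge outside
  \<open>S\<close>.\<close>

lemma circuit_unbalanced_cycle:
  assumes "circuit X" "X \<notin> \<B>"
  shows "\<exists>C. cycle C \<and> C \<notin> \<B> \<and> C \<subseteq> X - {g}"
  using assms(1)
proof (cases rule: circuitE)
  case balanced
  then show ?thesis using assms by simp
next
  case (theta u v P WP Q WQ R WR)
  show ?thesis
  proof (cases "g \<in> X")
    case True
    then show ?thesis using theta_edge_in_cycle_with(2)[OF theta(1)] theta by (metis subset_Diff_insert Diff_empty)
  next
    case False
    then show ?thesis using theta_paths_cycle(1)[OF theta(1)] theta by blast
  qed
next
  case (tight C D)
  then show ?thesis by (metis Un_upper1 Un_upper2 disjoint_iff subset_Diff_insert Diff_empty)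
next
  case (lift C D)
  have "C \<inter> D = {}" using cycles_edge_disjoint[of C D] lift cycle_iff by simp
  then show ?thesis using lift cycle_iff classes_disjoint
    by (metis Un_upper1 Un_upper2 disjoint_iff subset_Diff_insert Diff_empty)
next
  case (loose C D u v P W)
  have "C \<inter> D = {}" using cycles_edge_disjoint[of C D] loose cycle_iff by simp
  moreover have "cycle C" "cycle D" "C \<notin> \<B>" "D \<notin> \<B>" using loose cycle_iff classes_disjoint by auto
  ultimately show ?thesis using loose(8) by (cases "g \<in> C") blast+
qed

end

section \<open>Circuits contained in two linked unbalanced cycles\<close>

context quasi_biased
begin

lemma edge_other_end:
  assumes "e \<in> E" "w \<in> ends G e" "ends G e \<noteq> {w}"
  obtains a where "ends G e = {w, a}" "w \<noteq> a" "a \<in> V" "w \<in> V"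
proof -
  obtain x y where xy: "ends G e = {x, y}" "x \<in> V" "y \<in> V" by (rule edge_ends[OF assms(1)])
  obtain a where a: "ends G e = {w, a}" "w \<noteq> a" by (rule doubleton_other[OF xy(1) assms(2,3)])
  have "{w, a} \<subseteq> V" using a xy by auto
  then show ?thesis using that a by simp
qed

lemma cycle_via_vertex:
  assumes "simple_path G a b P W" "w \<notin> W" "w \<in> V" "e1 \<in> E" "e2 \<in> E" "ends G e1 = {w, a}"
    "ends G e2 = {w, b}" "e1 \<noteq> e2"
  shows "cycle (insert e1 (insert e2 P))" "VS (insert e1 (insert e2 P)) = insert w W"
proof -
  have e: "e1 \<notin> P" "e2 \<notin> P" using simple_path_ends_subset[OF assms(1)] assms(2,6,7) by auto
  have sp: "simple_path G w b (insert e1 P) (insert w W)"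
    using assms by (intro simple_path.step)
  have "b \<in> W" using simple_path_basic[OF assms(1)] by auto
  then have "w \<noteq> b" using assms(2) by auto
  have "cycle (insert e2 (insert e1 P))"
    by (rule is_cycle_pathI[OF sp \<open>w \<noteq> b\<close>]) (use assms e in auto)
  then show "cycle (insert e1 (insert e2 P))" by (simp add: insert_commute)
  have "VS (insert e2 (insert e1 P)) = insert w W"
    by (rule cycle_vertex_set[OF sp \<open>w \<noteq> b\<close>]) (use assms in auto)
  then show "VS (insert e1 (insert e2 P)) = insert w W" by (simp add: insert_commute)
qed

text \<open>Take the theta given by an ear of \<open>D\<close> in \<open>C\<close>. If
  \<open>P \<union> Q\<close> is balanced, or all three cycles are unbalanced, a circuit is at hand;
  if only \<open>R \<union> Q\<close> is balanced, replace \<open>D\<close> by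
  \<open>P \<union> Q\<close>, which is nearer to \<open>C\<close>.\<close>

lemma circuit_of_two_unbalanced_cycles:
  assumes "cycle D" "D \<notin> \<B>" "cycle C" "C \<notin> \<B>" "e \<in> D" "e \<notin> C"
    "a \<in> VS D \<inter> VS C" "b \<in> VS D \<inter> VS C" "a \<noteq> b"
  shows "\<exists>X. circuit X \<and> X \<subseteq> D \<union> C \<and> e \<in> X"
  using assms
proof (induction "card (D - C)" arbitrary: D a b rule: less_induct)
  case less
  have "D \<noteq> C" using less.prems by blast
  obtain p q P WP R WR Q WQ where th: "theta_paths G p q P WP R WR Q WQ" "D = P \<union> R" "Q \<subseteq> C"
      "Q \<inter> D = {}" "e \<in> P" "p \<in> VS D" "p \<in> VS C" "q \<in> VS D" "q \<in> VS C"
    by (rule cycles_theta[OF less.prems(1,3) \<open>D \<noteq> C\<close> less.prems(7,8,9,5)])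
  have cyc: "cycle (P \<union> Q)" "cycle (R \<union> Q)" using theta_paths_cycle[OF th(1)] by auto
  have PR: "P \<inter> R = {}" "p \<noteq> q" using th(1) unfolding theta_paths_def by auto
  show ?case
  proof (cases "P \<union> Q \<in> \<B>")
    case True
    then show ?thesis using circuit_balancedI th by blast
  next
    case PQ: False
    show ?thesis
    proof (cases "R \<union> Q \<in> \<B>")
      case False
      then have "circuit (P \<union> R \<union> Q)"
        using circuit_thetaI[OF th(1)] PQ less.prems(2) th(2) by blast
      then show ?thesis using th by blast
    next
      case True
      have "\<not> R \<subseteq> C"
      proof
        assume "R \<subseteq> C"
        then have "R \<union> Q = C" using cycle_minimal[OF cyc(2) less.prems(3)] th by blast
        then show False using True less.prems by blast
      qed
      then have "(P \<union> Q) - C \<subset> D - C" using th PR by blast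
      moreover have "finite (D - C)" using cycle_basic[OF less.prems(1)] by blast
      ultimately have lt: "card ((P \<union> Q) - C) < card (D - C)" by (rule psubset_card_mono[rotated])
      have sp: "simple_path G p q P WP" using th(1) unfolding theta_paths_def by blast
      have "p \<in> VS P" "q \<in> VS P"
        using simple_path_vertices'[OF sp PR(2)] simple_path_basic(1,2)[OF sp] by auto
      then have "p \<in> VS (P \<union> Q) \<inter> VS C" "q \<in> VS (P \<union> Q) \<inter> VS C"
        using th unfolding vertex_set_def by auto
      then obtain X where "circuit X" "X \<subseteq> P \<union> Q \<union> C" "e \<in> X"
        using less.hyps[OF lt cyc(1) PQ less.prems(3,4) _ less.prems(6) _ _ PR(2)] th by blast
      then show ?thesis using th by blast
    qed
  qed
qed

text \<open>Disjoint cycles cannot lie one in \<L> and one in \<F>, so they form a circuit alone or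
  with part of the path. Cycles sharing one vertex form a tight handcuff, and two shared vertices
  allow the descent above.\<close>

lemma circuit_connecting_unbalanced_cycles:
  assumes D: "cycle D" "D \<notin> \<B>" "e \<in> D" and C: "cycle C" "C \<notin> \<B>" "e \<notin> C"
    and P: "simple_path G a b P W" "a \<in> VS D" "b \<in> VS C"
  shows "\<exists>X. circuit X \<and> X \<subseteq> D \<union> C \<union> P \<and> e \<in> X"
proof (cases "VS D \<inter> VS C = {}")
  case True
  obtain c d Q X where Q: "simple_path G c d Q X" "Q \<subseteq> P" "X \<inter> VS D = {c}" "X \<inter> VS C = {d}"
    using simple_path_between_sets[OF P True] by metis
  consider "D \<in> \<L>" "C \<in> \<L>" | "D \<in> \<F>" "C \<in> \<F>"
    using D C LF_meet[of D C] LF_meet[of C D] True cycle_iff by blast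
  then show ?thesis
  proof cases
    case 1
    then have "circuit (D \<union> C)" using circuit_liftI True by blast
    then show ?thesis using D by blast
  next
    case 2
    then have "circuit (D \<union> C \<union> Q)" using circuit_looseI Q True by metis
    then show ?thesis using D Q by blast
  qed
next
  case False
  then obtain x where x: "x \<in> VS D \<inter> VS C" by blast
  show ?thesis
  proof (cases "VS D \<inter> VS C = {x}")
    case True
    have "D \<inter> C = {}"
    proof (rule ccontr)
      assume "D \<inter> C \<noteq> {}"
      then obtain g where g: "g \<in> D" "g \<in> C" by blast
      have "D \<noteq> C" using D C by blast
      obtain a' b' where "a' \<in> VS D \<inter> VS C" "b' \<in> VS D \<inter> VS C" "a' \<noteq> b'"
        by (rule common_edge_two_vertices[OF D(1) C(1) g \<open>D \<noteq> C\<close>])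
      then show False using True by simp
    qed
    then have "circuit (D \<union> C)" using circuit_tightI D C True by simp
    then show ?thesis using D by blast
  next
    case False
    then obtain y where "y \<in> VS D \<inter> VS C" "x \<noteq> y" using x by blast
    then show ?thesis using circuit_of_two_unbalanced_cycles[OF D(1,2) C(1,2) D(3) C(3) x] by blast
  qed
qed

definition adj :: "'v \<Rightarrow> 'v \<Rightarrow> bool" where
  "adj = eadj G E"

lemma adj_iff: "adj a b \<longleftrightarrow> a \<noteq> b \<and> (\<exists>e\<in>E. ends G e = {a, b})"
  unfolding adj_def eadj_def by simp

lemma adj_sym: "adj a b \<Longrightarrow> adj b a"
  unfolding adj_def by (rule eadj_sym)

lemma adj_verts: "adj a b \<Longrightarrow> a \<in> V \<and> b \<in> V"
  unfolding adj_iff by (metis edge_ends insertCI insertE singletonD)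

end

section \<open>Separating the star of a vertex in a contraction\<close>

locale unbreakable_quasi_biased = quasi_biased G \<B> \<L> \<F>
  for G :: "('v, 'e) mgraph" and \<B> \<L> \<F> +
  assumes unbreakable: "unbreakable (quasi_graphic_matroid G \<B> \<L> \<F>)"
begin

lemma minimal_circuit:
  assumes "F \<subseteq> E" "\<And>C g. circuit C \<Longrightarrow> C - F \<noteq> {g}" "e \<in> E - F" "f \<in> E - F" "e \<noteq> f"
  obtains C where "circuit C" "e \<in> C" "f \<in> C"
    "\<And>C'. circuit C' \<Longrightarrow> C' - F \<noteq> {} \<Longrightarrow> \<not> C' - F \<subset> C - F"
  using unbreakable_minimal_circuit[OF unbreakable _ _ _ assms(2)] assms circuit_basic finite_edges
  unfolding ground_M by metis

text \<open>Contracting \<open>S\<close> minus the star of \<open>w\<close> would separate the star of \<open>w\<close> from \<open>E - S\<close>.\<close>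

lemma balanced_star_separation:
  assumes S: "balanced S" "S \<subseteq> E" "e \<in> E - S"
    and w: "\<And>f. f \<in> E \<Longrightarrow> w \<in> ends G f \<Longrightarrow> f \<in> S"
    and closed: "\<And>C g. C \<in> \<B> \<Longrightarrow> w \<notin> VS C \<Longrightarrow> C - S \<noteq> {g}"
    and nb: "adj w c" "\<And>a b. adj w a \<Longrightarrow> adj w b \<Longrightarrow> reach (eadj G S) (V - {w}) a b"
  shows False
proof -
  define \<delta> where "\<delta> = {f \<in> E. w \<in> ends G f \<and> ends G f \<noteq> {w}}"
  define F where "F = S - \<delta>"
  have \<delta>S: "\<delta> \<subseteq> S" using w unfolding \<delta>_def by auto
  \<comment> \<open>Loops at \<open>w\<close> lie in \<open>S\<close> and so are balanced; this
    rules out the loop alternative of \<open>circuit_degree\<close> at \<open>w\<close>.\<close>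
  have loopB: "{l} \<in> \<B>" if l: "l \<in> E" "ends G l = {w}" for l
  proof -
    have "w \<in> V" using l multigraph unfolding multigraph_def by auto
    then show ?thesis using is_cycle_loopI[of w G l] l balancedD[OF S(1), of "{l}"] w[of l] by simp
  qed
  have \<delta>2: "\<exists>g'\<in>X. g' \<noteq> g \<and> g' \<in> \<delta>" if X: "circuit X" "g \<in> X" "g \<in> \<delta>" for X g
  proof -
    have g: "w \<in> ends G g" "ends G g \<noteq> {w}" using X unfolding \<delta>_def by auto
    have "\<not> (\<exists>l\<in>X. ends G l = {w} \<and> {l} \<in> \<F>)"
      using loopB classes_disjoint(2) circuit_basic(1)[OF X(1)] by blast
    then show ?thesis using circuit_degree[OF X(1,2) g] circuit_basic(1)[OF X(1)] unfolding \<delta>_def by auto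
  qed
  \<comment> \<open>This makes \<open>F\<close> a flat. A star edge in \<open>X\<close> would bring
    a second one, so the single extra edge lies outside \<open>S\<close>. Then \<open>X\<close> is a
    balanced cycle by \<open>circuit_unbalanced_cycle\<close>, and \<open>closed\<close> forces it
    through \<open>w\<close>, where only loops in \<open>S\<close> remain.\<close>
  have "X - F \<noteq> {g}" if X: "circuit X" for X g
  proof
    assume eq: "X - F = {g}"
    have no\<delta>: "X \<inter> \<delta> = {}"
    proof (rule ccontr)
      assume "X \<inter> \<delta> \<noteq> {}"
      then obtain h where h: "h \<in> X" "h \<in> \<delta>" by blast
      then obtain h' where "h' \<in> X" "h' \<noteq> h" "h' \<in> \<delta>" using \<delta>2 X by blast
      then have "h \<in> X - F" "h' \<in> X - F" using h unfolding F_def by auto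
      then show False using eq \<open>h' \<noteq> h\<close> by auto
    qed
    then have eqS: "X - S = {g}" using eq \<delta>S unfolding F_def by auto
    show False
    proof (cases "X \<in> \<B>")
      case True
      then have cX: "cycle X" using cycle_iff by simp
      have "w \<in> VS X" using closed[OF True] eqS by blast
      then obtain k where k: "k \<in> X" "w \<in> ends G k" unfolding vertex_set_def by auto
      have kE: "k \<in> E" using k circuit_basic(1)[OF X] by blast
      then have "ends G k = {w}" using k no\<delta> unfolding \<delta>_def by auto
      then have "X = {k}" using cycle_loop[OF cX] k by blast
      then show False using w[OF kE k(2)] eqS by auto
    next
      case False
      then obtain C where C: "cycle C" "C \<notin> \<B>" "C \<subseteq> X - {g}"
        using circuit_unbalanced_cycle[OF X] by blast
      then have "C \<subseteq> S" using eqS by blast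
      then show False using C balancedD[OF S(1)] by blast
    qed
  qed
  moreover obtain f where f: "f \<in> E" "ends G f = {w, c}" "w \<noteq> c" using nb(1) unfolding adj_iff by blast
  then have f\<delta>: "f \<in> \<delta>" unfolding \<delta>_def by auto
  moreover have "F \<subseteq> E" "e \<in> E - F" "f \<in> E - F" "e \<noteq> f" using S f\<delta> \<delta>S f unfolding F_def by auto
  ultimately obtain X where X: "circuit X" "e \<in> X" "f \<in> X"
    "\<And>C'. circuit C' \<Longrightarrow> C' - F \<noteq> {} \<Longrightarrow> \<not> C' - F \<subset> X - F"
    using minimal_circuit[of F e f] by metis
  \<comment> \<open>\<open>f\<close> and a second star edge of \<open>X\<close> close a cycle inside
    \<open>S\<close> whose part outside \<open>F\<close> is just these two edges, while
    \<open>X\<close> also contains \<open>e\<close>.\<close>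
  obtain f' where f': "f' \<in> X" "f' \<noteq> f" "f' \<in> \<delta>" using \<delta>2[OF X(1,3) f\<delta>] by blast
  then obtain b where b: "ends G f' = {w, b}" "w \<noteq> b" "b \<in> V" "w \<in> V"
    using edge_other_end[of f' w] unfolding \<delta>_def by blast
  have fE: "f' \<in> E" using f' unfolding \<delta>_def by simp
  have ad: "adj w b" using b fE unfolding adj_iff by blast
  have "c \<in> V - {w}" using nb(1) adj_verts f by blast
  then obtain P W where P: "simple_path G c b P W" "P \<subseteq> S" "W \<subseteq> V - {w}"
    using reach_eadj_path[OF nb(2)[OF nb(1) ad]] S(2) by blast
  define D where "D = insert f (insert f' P)"
  have "w \<notin> W" using P by auto
  have D: "cycle D" unfolding D_def
    by (rule cycle_via_vertex[OF P(1) \<open>w \<notin> W\<close> b(4) f(1) fE f(2) b(1)]) (use f' in simp)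
  have "D \<subseteq> S" unfolding D_def using P f\<delta> f' \<delta>S by auto
  then have "circuit D" using circuit_balancedI balancedD[OF S(1) D] by blast
  have "P \<inter> \<delta> = {}"
    using simple_path_ends_subset[OF P(1)] \<open>w \<notin> W\<close> unfolding \<delta>_def by blast
  then have "D - F = {f, f'}" unfolding D_def F_def using P f\<delta> f' \<delta>S by auto
  moreover have "e \<in> X - F" "e \<noteq> f" "e \<noteq> f'" "{f, f'} \<subseteq> X - F"
    using X f' f\<delta> \<delta>S S(3) unfolding F_def by auto
  then have "{f, f'} \<subset> X - F" by blast
  ultimately show False using X(4)[OF \<open>circuit D\<close>] by (metis insert_not_empty)
qed

text \<open>Maximality supplies the closure condition: every cycle with exactly one edge outside
  \<open>S\<close> is unbalanced.\<close>

lemma max_balanced_star_separation: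
  assumes S: "max_balanced S" "e \<in> E - S"
    and w: "\<And>f. f \<in> E \<Longrightarrow> w \<in> ends G f \<Longrightarrow> f \<in> S"
    and nb: "adj w c" "\<And>a b. adj w a \<Longrightarrow> adj w b \<Longrightarrow> reach (eadj G S) (V - {w}) a b"
  shows False
proof (rule balanced_star_separation[OF _ _ S(2) w _ nb])
  show "balanced S" "S \<subseteq> E" using S unfolding max_balanced_def by auto
  show "C - S \<noteq> {g}" if C: "C \<in> \<B>" for C g
  proof
    assume eq: "C - S = {g}"
    have cC: "cycle C" using C cycle_iff by simp
    then have "g \<in> E - S" using eq cycle_basic(1) by blast
    then show False using max_balanced_unbalanced[OF S(1) _ cC] eq C by blast
  qed
qed

text \<open>Loops in \<open>\<L>\<close> are left out, as they complete a circuit with any disjoint cycle in \<open>\<L>\<close> and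
  so may lie in the closure of \<open>E(G - x)\<close>.\<close>

definition proper_star :: "'v \<Rightarrow> 'e set" where
  "proper_star x = {e \<in> E. x \<in> ends G e \<and> (ends G e = {x} \<longrightarrow> {e} \<in> \<F>)}"

text \<open>The count could fail only for a tight handcuff of a loop in \<F> and a loop in \<L> at
  \<open>x\<close>. Then \<open>C0\<close>, disjoint from both loops, could belong to neither
  class.\<close>

lemma circuit_proper_star_two:
  assumes X: "circuit X" "g \<in> X" "g \<in> proper_star x" and C0: "cycle C0" "C0 \<notin> \<B>" "x \<notin> VS C0"
  shows "\<exists>g'\<in>X. g' \<noteq> g \<and> g' \<in> proper_star x"
proof (cases "ends G g = {x}")
  case False
  have "x \<in> ends G g" using X unfolding proper_star_def by simp
  from circuit_degree[OF X(1,2) this False] show ?thesis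
    using False circuit_basic(1)[OF X(1)] unfolding proper_star_def by (auto 4 3)
next
  case True
  then have gF: "{g} \<in> \<F>" using X unfolding proper_star_def by simp
  have Vg: "VS {g} = {x}" using True unfolding vertex_set_def by simp
  have tight_case: ?thesis if CD: "cycle C" "cycle D" "C \<inter> D = {}" "card (VS C \<inter> VS D) = 1" "X = C \<union> D"
      "C \<notin> \<B>" "D \<notin> \<B>" "g \<in> C" for C D
  proof -
    have "C = {g}" using cycle_loop CD True by metis
    then have "VS C \<inter> VS D \<subseteq> {x}" using Vg by auto
    then have "VS C \<inter> VS D = {x}" using CD(4) by (metis card.empty subset_singletonD zero_neq_one)
    then obtain k where k: "k \<in> D" "x \<in> ends G k" unfolding vertex_set_def by auto
    have kE: "k \<in> E" "k \<noteq> g" "k \<in> X" using k CD cycle_basic by blast+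
    show ?thesis
    proof (cases "ends G k = {x}")
      case True
      then have D: "D = {k}" using cycle_loop[OF CD(2)] k by blast
      have "D \<notin> \<L>"
      proof
        assume DL: "D \<in> \<L>"
        have "VS D = {x}" using D True unfolding vertex_set_def by simp
        then have "C0 \<notin> \<F>" "C0 \<notin> \<L>" using LF_meet[OF DL, of C0] LF_meet[OF _ gF, of C0] Vg C0 by auto
        then show False using C0 cycle_iff by auto
      qed
      then have "{k} \<in> \<F>" using CD cycle_iff D by auto
      then show ?thesis using k kE unfolding proper_star_def by auto
    next
      case False
      then show ?thesis using k kE unfolding proper_star_def by auto
    qed
  qed
  from X(1) show ?thesis
  proof (cases rule: circuitE)
    case balanced
    then have "X = {g}" using cycle_loop[of G X g x] X True cycle_iff by simp
    then show ?thesis using balanced gF classes_disjoint by blast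
  next
    case (theta u v P WP Q WQ R WR)
    then have "\<exists>a b. ends G g = {a, b} \<and> a \<noteq> b"
      using X simple_path_edge_ends unfolding theta_paths_def by (metis UnE)
    then show ?thesis using True by auto
  next
    case (tight C D)
    then show ?thesis using tight_case[of C D] tight_case[of D C] X(2) by (auto simp: Int_commute Un_commute)
  next
    case (lift C D)
    then have "C = {g} \<or> D = {g}" using cycle_loop[of G _ g x] True X cycle_iff by (metis UnE)
    then show ?thesis using lift gF classes_disjoint by blast
  next
    case (loose C D u v P W)
    have CD: "cycle C" "cycle D" using loose cycle_iff by auto
    have "g \<notin> P" using simple_path_edge_ends[OF loose(4)] True by (metis insert_absorb2 doubleton_eq_iff)
    then have "C = {g} \<or> D = {g}" using cycle_loop CD True X loose by (metis UnE)
    then have "x = u \<or> x = v" using Vg loose by auto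
    moreover have "W = VS P" using simple_path_vertices'[OF loose(4,7)] .
    moreover have "u \<in> W" "v \<in> W" using simple_path_basic[OF loose(4)] by auto
    ultimately obtain k where k: "k \<in> P" "x \<in> ends G k" unfolding vertex_set_def by auto
    then have "ends G k \<noteq> {x}" using simple_path_edge_ends[OF loose(4)] by fastforce
    moreover have "k \<in> E" using k simple_path_basic[OF loose(4)] by auto
    ultimately show ?thesis using k loose True unfolding proper_star_def by auto
  qed
qed

end

section \<open>Disjoint non-adjacent pairs with connected complement\<close>

text \<open>Only adjacency matters in this section. The assumption \<open>cut\<close> is
  3-connectivity in terms of neighbourhoods: fewer than three neighbours would separate
  \<open>A\<close> from the rest.\<close>

locale three_connected_relation =
  fixes V :: "'v set" and R :: "'v \<Rightarrow> 'v \<Rightarrow> bool"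
  assumes finite_V: "finite V" and card_V: "card V \<ge> 7"
    and symp_R: "symp R" and irrefl_R: "\<not> R v v"
    and cut: "A \<subseteq> V \<Longrightarrow> A \<noteq> {} \<Longrightarrow> V - A - {u \<in> V - A. \<exists>a\<in>A. R a u} \<noteq> {} \<Longrightarrow>
      3 \<le> card {u \<in> V - A. \<exists>a\<in>A. R a u}"
begin

lemma R_sym: "R a b \<Longrightarrow> R b a"
  using symp_R by (auto dest: sympD)

lemma degree_ge_3:
  assumes "v \<in> V"
  shows "3 \<le> card {t \<in> V. R v t}"
proof -
  have eq: "{t \<in> V. R v t} = {u \<in> V - {v}. \<exists>a\<in>{v}. R a u}" using irrefl_R by auto
  show ?thesis
  proof (cases "V - {v} - {t \<in> V. R v t} = {}")
    case True
    then have "V - {v} \<subseteq> {t \<in> V. R v t}" by blast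
    then have "card (V - {v}) \<le> card {t \<in> V. R v t}" using finite_V by (intro card_mono) auto
    then show ?thesis using card_V assms finite_V by simp
  next
    case False
    then show ?thesis using cut[of "{v}"] assms unfolding eq by simp
  qed
qed

definition nonedge_pair :: "'v \<Rightarrow> 'v \<Rightarrow> 'v \<Rightarrow> 'v \<Rightarrow> bool" where
  "nonedge_pair x y u v \<longleftrightarrow> distinct [x, y, u, v] \<and> {x, y, u, v} \<subseteq> V \<and> \<not> R x y \<and> \<not> R u v"

lemma nonedge_pair_sym:
  assumes "nonedge_pair x y u v"
  shows "nonedge_pair u v x y" "nonedge_pair y x u v" "nonedge_pair x y v u"
  using assms R_sym unfolding nonedge_pair_def by auto

definition part :: "'v set \<Rightarrow> 'v \<Rightarrow> 'v \<Rightarrow> 'v \<Rightarrow> 'v \<Rightarrow> bool" where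
  "part A x y u v \<longleftrightarrow> nonedge_pair x y u v \<and> A \<subseteq> V - {x, y, u, v} \<and> conn R A \<and> A \<noteq> {}"

text \<open>A hypothetical counterexample. The size is largest over all choices of the two pairs,
  which is what permits exchanging pairs; \<open>b\<close> witnesses that \<open>A\<close> does not
  fill the complement.\<close>

definition max_part :: "'v set \<Rightarrow> 'v \<Rightarrow> 'v \<Rightarrow> 'v \<Rightarrow> 'v \<Rightarrow> 'v \<Rightarrow> bool" where
  "max_part A x y u v b \<longleftrightarrow> part A x y u v \<and> b \<in> V - {x, y, u, v} - A \<and>
     (\<forall>A' x' y' u' v'. part A' x' y' u' v' \<longrightarrow> card A' \<le> card A)"

lemma max_part_sym:
  assumes "max_part A x y u v b"
  shows "max_part A u v x y b" "max_part A y x u v b" "max_part A x y v u b"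
proof -
  note eq = four_set_sym[where x = x and y = y and u = u and v = v]
  have p: "part A x y u v" and b: "b \<in> V - {x, y, u, v} - A"
    and mx: "\<forall>A' x' y' u' v'. part A' x' y' u' v' \<longrightarrow> card A' \<le> card A"
    using assms unfolding max_part_def by blast+
  have "part A u v x y" "part A y x u v" "part A x y v u"
    using p nonedge_pair_sym unfolding part_def eq by blast+
  then show "max_part A u v x y b" "max_part A y x u v b" "max_part A x y v u b"
    using b mx unfolding max_part_def eq by blast+
qed

lemma max_partD:
  assumes "max_part A x y u v b"
  shows "nonedge_pair x y u v" "A \<subseteq> V - {x, y, u, v}" "conn R A" "A \<noteq> {}" "b \<in> V - {x, y, u, v} - A"
    "finite A" "\<And>A' x' y' u' v'. part A' x' y' u' v' \<Longrightarrow> card A' \<le> card A"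
proof -
  have p: "part A x y u v" and b: "b \<in> V - {x, y, u, v} - A"
    and mx: "\<And>A' x' y' u' v'. part A' x' y' u' v' \<Longrightarrow> card A' \<le> card A"
    using assms unfolding max_part_def by blast+
  show "nonedge_pair x y u v" "A \<subseteq> V - {x, y, u, v}" "conn R A" "A \<noteq> {}"
    using p unfolding part_def by auto
  then show "finite A" using finite_V finite_subset[of A V] by blast
  show "b \<in> V - {x, y, u, v} - A" by (rule b)
  show "\<And>A' x' y' u' v'. part A' x' y' u' v' \<Longrightarrow> card A' \<le> card A" by (rule mx)
qed

lemma rest_cases:
  assumes "V - {x, y, u, v} - A = {b}" "t \<in> V"
  shows "t = b \<or> t \<in> A \<or> t = x \<or> t = y \<or> t = u \<or> t = v"
  using assms by blast

lemma max_part_closed: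
  assumes m: "max_part A x y u v b" and "a \<in> A" "c \<in> V - {x, y, u, v} - A"
  shows "\<not> R a c"
proof
  assume r: "R a c"
  note m' = max_partD[OF m]
  have "conn R (insert c A)" by (rule conn_insert[OF symp_R m'(3) assms(2) r])
  then have "part (insert c A) x y u v" using m' assms(3) unfolding part_def by auto
  then have "card (insert c A) \<le> card A" by (rule m'(7))
  then show False using m'(6) assms(3) by simp
qed

text \<open>Replace \<open>u\<close>, \<open>v\<close> by the non-adjacent pair \<open>a\<close>,
  \<open>b\<close> and \<open>A\<close> by \<open>insert u A - {a}\<close>. The new part has the
  same size, so it cannot grow either.\<close>

lemma max_part_swap:
  assumes m: "max_part A x y u v b" and a: "a \<in> A" "conn R (insert u A - {a})"
    and w: "w \<in> V - {x, y, a, b} - (insert u A - {a})" and t: "t \<in> insert u A - {a}"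
  shows "\<not> R t w"
proof
  assume r: "R t w"
  note m' = max_partD[OF m]
  have ab: "\<not> R a b" by (rule max_part_closed[OF m a(1)]) (use m' in auto)
  have "conn R (insert w (insert u A - {a}))" by (rule conn_insert[OF symp_R a(2) t r])
  moreover have "nonedge_pair x y a b" using m' a ab unfolding nonedge_pair_def by auto
  moreover have "insert w (insert u A - {a}) \<subseteq> V - {x, y, a, b}"
    using m' w unfolding nonedge_pair_def by auto
  ultimately have "part (insert w (insert u A - {a})) x y a b" unfolding part_def by blast
  then have "card (insert w (insert u A - {a})) \<le> card A" by (rule m'(7))
  moreover have "u \<notin> A" using m'(2) by auto
  then have "card (insert u A - {a}) = card A" using m'(6) a(1) by simp
  moreover have "w \<notin> insert u A - {a}" "finite (insert u A - {a})" using w m'(6) by auto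
  ultimately show False by simp
qed

lemma max_part_noncut:
  assumes m: "max_part A x y u v b" and "\<exists>t\<in>A. R u t"
  obtains a where "a \<in> A" "conn R (insert u A - {a})"
proof -
  note m' = max_partD[OF m]
  obtain t where t: "t \<in> A" "R t u" using assms R_sym by blast
  have c: "conn R (insert u A)" by (rule conn_insert[OF symp_R m'(3) t])
  have "{u} \<subset> insert u A" using m' t by auto
  from conn_grow[OF symp_R _ c conn_singleton this] m'(6)
  obtain w where "w \<in> insert u A - {u}" "conn R (insert u A - {w})" by auto
  then show ?thesis using that by blast
qed

text \<open>Were several vertices left over, then for each such \<open>d\<close> another one could
  play \<open>b\<close> in a swap, so \<open>d\<close> would not be adjacent to \<open>u\<close> or
  \<open>v\<close>. The left-over vertices would see only \<open>x\<close> and \<open>y\<close>,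
  contrary to \<open>cut\<close>.\<close>

lemma max_part_rest:
  assumes m: "max_part A x y u v b" and "\<exists>t\<in>A. R u t" "\<exists>t\<in>A. R v t"
  shows "V - {x, y, u, v} - A = {b}"
proof (rule ccontr)
  assume ne: "V - {x, y, u, v} - A \<noteq> {b}"
  note m' = max_partD[OF m]
  define B where "B = V - {x, y, u, v} - A"
  have half: "\<not> R d u" if d: "d \<in> B" and m: "max_part A x y u v b" and ex: "\<exists>t\<in>A. R u t"
    and B: "B = V - {x, y, u, v} - A" "B \<noteq> {b}" "b \<in> B" for d u v
  proof -
    obtain b' where b': "b' \<in> B" "b' \<noteq> d" using B by blast
    then have mb: "max_part A x y u v b'" using m B unfolding max_part_def by blast
    obtain a where a: "a \<in> A" "conn R (insert u A - {a})" by (rule max_part_noncut[OF m ex])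
    have "d \<in> V - {x, y, a, b'} - (insert u A - {a})" "u \<in> insert u A - {a}"
      using d b' a B max_partD(2)[OF m] by auto
    from max_part_swap[OF mb a this] show ?thesis using R_sym by blast
  qed
  have bB: "b \<in> B" "B \<noteq> {b}" using m' ne B_def by auto
  have u: "\<not> R d u" if "d \<in> B" for d using half[OF that m assms(2)] bB B_def by blast
  have v: "\<not> R d v" if "d \<in> B" for d
    using half[OF that max_part_sym(3)[OF m] assms(3)] bB B_def by (simp add: insert_commute)
  have A: "\<not> R d a" if "d \<in> B" "a \<in> A" for d a
    using max_part_closed[OF m that(2)] that(1) R_sym B_def by blast
  have sub: "{w \<in> V - B. \<exists>d\<in>B. R d w} \<subseteq> {x, y}" using u v A B_def by blast
  have "card {w \<in> V - B. \<exists>d\<in>B. R d w} \<le> 2" using sub by (rule card_subset_pair)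
  moreover have "3 \<le> card {w \<in> V - B. \<exists>d\<in>B. R d w}"
  proof (rule cut)
    obtain a where a: "a \<in> A" using m'(4) by blast
    then have "a \<in> V - B" "a \<notin> {x, y}" using m'(2) B_def by auto
    then show "V - B - {w \<in> V - B. \<exists>d\<in>B. R d w} \<noteq> {}" using sub by blast
  qed (use bB B_def in auto)
  ultimately show False by simp
qed

text \<open>After the swap that moves \<open>u\<close> into the part, \<open>v\<close> is an outside
  vertex; its only possible neighbour in \<open>A\<close> is the removed \<open>a\<close>.\<close>

lemma max_part_unique_nbr:
  assumes m: "max_part A x y u v b" and a: "a \<in> A" "conn R (insert u A - {a})"
    and "\<exists>t\<in>A. R v t"
  shows "{t \<in> A. R v t} = {a}"
proof -
  note m' = max_partD[OF m]
  have "\<not> R t v" if "t \<in> A" "t \<noteq> a" for t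
  proof (rule max_part_swap[OF m a])
    show "v \<in> V - {x, y, a, b} - (insert u A - {a})"
      using m' a unfolding nonedge_pair_def by auto
  qed (use that in simp)
  then show ?thesis using assms(4) R_sym a by blast
qed

text \<open>\<open>A \<union> {u, v}\<close> is a minimal connected set containing \<open>u\<close>
  and \<open>v\<close>: a smaller \<open>T\<close>, stripped of its leaf \<open>v\<close>, would
  miss a non-cut vertex \<open>w\<close> of \<open>insert u A\<close>. Then \<open>w\<close>, like
  \<open>a\<close>, would be the only neighbour of \<open>v\<close>, although \<open>T\<close>
  contains \<open>a\<close>.\<close>

lemma max_part_degree:
  assumes m: "max_part A x y u v b" and u: "\<exists>t\<in>A. R u t" and v: "\<exists>t\<in>A. R v t" and z: "z \<in> A"
  shows "card {t \<in> A \<union> {u, v}. R z t} \<le> 2"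
proof -
  note m' = max_partD[OF m]
  have uv: "u \<noteq> v" "\<not> R u v" "\<not> R v u" "u \<notin> A" "v \<notin> A"
    using m' R_sym unfolding nonedge_pair_def by auto
  obtain a where a: "a \<in> A" "conn R (insert u A - {a})" by (rule max_part_noncut[OF m u])
  have Nv: "{t \<in> A. R v t} = {a}" by (rule max_part_unique_nbr[OF m a v])
  obtain s where "s \<in> A" "R s u" using u R_sym by blast
  then have cu: "conn R (insert u A)" by (intro conn_insert[OF symp_R m'(3)])
  have "R a v" using Nv R_sym by blast
  then have cuv: "conn R (insert v (insert u A))" using a by (intro conn_insert[OF symp_R cu, of a]) auto
  have eq: "insert v (insert u A) = A \<union> {u, v}" by auto
  have "T = A \<union> {u, v}" if T: "T \<subseteq> A \<union> {u, v}" "conn R T" "u \<in> T" "v \<in> T" for T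
  proof -
    have leaf: "t = a" if "t \<in> T" "R v t" for t
      using that T Nv uv irrefl_R by blast
    have "a \<in> T"
    proof -
      have "{v} \<subseteq> T" "u \<in> T - {v}" using T uv by auto
      from T(2) this(1) _ this(2) obtain p q where "p \<in> {v}" "q \<in> T - {v}" "R p q"
        by (rule conn_cross) simp
      then show ?thesis using leaf by blast
    qed
    have "a \<noteq> v" using a uv by auto
    have c: "conn R (T - {v})" by (rule conn_remove_leaf[OF T(2) symp_R leaf \<open>a \<noteq> v\<close>])
    have "T - {v} = insert u A"
    proof (rule ccontr)
      assume "T - {v} \<noteq> insert u A"
      then have "T - {v} \<subset> insert u A" using T by auto
      from conn_grow[OF symp_R _ cu c this] m'(6) T uv
      obtain w where w: "w \<in> insert u A - (T - {v})" "conn R (insert u A - {w})" by auto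
      then have wA: "w \<in> A" using T uv by auto
      then have "{t \<in> A. R v t} = {w}" by (rule max_part_unique_nbr[OF m _ w(2) v])
      then have "w = a" using Nv by auto
      then show False using w \<open>a \<in> T\<close> \<open>a \<noteq> v\<close> by auto
    qed
    then show ?thesis using T by auto
  qed
  then show ?thesis
    using minimal_connector_degree[of R "A \<union> {u, v}" u v z] symp_R irrefl_R cuv z unfolding eq by auto
qed

lemma max_part_card:
  assumes m: "max_part A x y u v b" and "V - {x, y, u, v} - A = {b}"
  shows "card A \<ge> 2"
proof -
  note m' = max_partD[OF m]
  have V: "V = insert b (A \<union> {x, y, u, v})" using assms(2) m' unfolding nonedge_pair_def by auto
  have "card V \<le> Suc (card (A \<union> {x, y, u, v}))" unfolding V by (rule card_insert_le_m1) (auto simp: card_insert_if m'(6))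
  moreover have "card (A \<union> {x, y, u, v}) \<le> card A + card {x, y, u, v}" by (rule card_Un_le)
  moreover have "card {x, y, u, v} \<le> 4" by (simp add: card_insert_if)
  ultimately show ?thesis using card_V by linarith
qed

lemma max_part_nbr_exists:
  assumes m: "max_part A x y u v b" and "card A \<ge> 2" "z \<in> A"
  shows "\<exists>t\<in>A. R z t"
proof -
  note m' = max_partD[OF m]
  have "A \<noteq> {z}" using assms by auto
  then obtain t where "t \<in> A - {z}" using assms by blast
  with m'(3) _ _ obtain p q where "p \<in> {z}" "q \<in> A - {z}" "R p q"
    by (rule conn_cross[of R A "{z}" z t]) (use assms in auto)
  then show ?thesis by blast
qed

text \<open>By \<open>max_part_degree\<close>, at most two of the at least three neighbours of
  \<open>z\<close> lie in \<open>A \<union> {u, v}\<close>, and \<open>b\<close> is not a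
  neighbour.\<close>

lemma max_part_vertex_outside:
  assumes m: "max_part A x y u v b" and att: "\<exists>t\<in>A. R u t" "\<exists>t\<in>A. R v t" and z: "z \<in> A"
  shows "R z x \<or> R z y"
proof (rule ccontr)
  assume n: "\<not> (R z x \<or> R z y)"
  note m' = max_partD[OF m]
  have rest: "V - {x, y, u, v} - A = {b}" by (rule max_part_rest[OF m att])
  have "\<not> R z b" using max_part_closed[OF m z] rest by blast
  then have "{t \<in> V. R z t} \<subseteq> {t \<in> A \<union> {u, v}. R z t}" using n rest_cases[OF rest] by auto
  then have "card {t \<in> V. R z t} \<le> card {t \<in> A \<union> {u, v}. R z t}" using m'(6) by (intro card_mono) auto
  then show False using max_part_degree[OF m att z] degree_ge_3[of z] z m' by auto
qed

text \<open>All of \<open>A\<close> is adjacent to \<open>x\<close>, and so is \<open>b\<close>,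
  since otherwise \<open>y\<close> and \<open>b\<close> would see only \<open>u\<close> and
  \<open>v\<close>. The star at \<open>x\<close> on \<open>b\<close> and \<open>A - {a}\<close> is
  then a larger part for the pairs \<open>y\<close>, \<open>a\<close> and \<open>u\<close>,
  \<open>v\<close>.\<close>

lemma max_part_only_one_attached:
  assumes m: "max_part A x y u v b" and att: "\<exists>t\<in>A. R u t" "\<exists>t\<in>A. R v t"
    and y: "\<not> (\<exists>t\<in>A. R y t)"
  shows False
proof -
  note m' = max_partD[OF m]
  note np = m'(1)[unfolded nonedge_pair_def]
  have rest: "V - {x, y, u, v} - A = {b}" by (rule max_part_rest[OF m att])
  have cardA: "card A \<ge> 2" by (rule max_part_card[OF m rest])
  have b: "\<not> R b a" if "a \<in> A" for a using max_part_closed[OF m that] rest R_sym by blast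
  have yx: "\<not> R y x" "\<not> R x y" using np R_sym by auto
  have Ny: "{t \<in> V. R y t} \<subseteq> {b, u, v}" using y yx rest_cases[OF rest] irrefl_R by blast
  have "R y b"
  proof (rule ccontr)
    assume "\<not> R y b"
    then have "{t \<in> V. R y t} \<subseteq> {u, v}" using Ny by blast
    then have "card {t \<in> V. R y t} \<le> 2" by (rule card_subset_pair)
    then show False using degree_ge_3[of y] np by simp
  qed
  have "R b x"
  proof (rule ccontr)
    assume nb: "\<not> R b x"
    define N where "N = {w \<in> V - {y, b}. \<exists>d\<in>{y, b}. R d w}"
    have sub: "N \<subseteq> {u, v}" using nb b y yx rest_cases[OF rest] R_sym unfolding N_def by blast
    have "card N \<le> 2" using sub by (rule card_subset_pair)
    moreover have "3 \<le> card N" unfolding N_def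
    proof (rule cut)
      show "{y, b} \<subseteq> V" using np m' by auto
      obtain a where "a \<in> A" using m' by blast
      then have "a \<in> V - {y, b} - N" using sub m' by auto
      then show "V - {y, b} - {w \<in> V - {y, b}. \<exists>d\<in>{y, b}. R d w} \<noteq> {}" unfolding N_def by blast
    qed simp
    ultimately show False by simp
  qed
  have Ax: "R a x" if "a \<in> A" for a using max_part_vertex_outside[OF m att that] y that R_sym by blast
  obtain a where a: "a \<in> A" using m' by blast
  have star: "conn R (insert x S)" if "finite S" "\<And>s. s \<in> S \<Longrightarrow> R s x" for S
    using that
  proof (induction S rule: finite_induct)
    case empty
    then show ?case by (simp add: conn_singleton)
  next
    case (insert s S)
    then have "conn R (insert s (insert x S))"
      using conn_insert[OF symp_R _ _ R_sym, of "insert x S" x s] by blast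
    then show ?case by (simp add: insert_commute)
  qed
  have "conn R (insert x (insert b (A - {a})))"
    using star[of "insert b (A - {a})"] Ax \<open>R b x\<close> m'(6) by auto
  moreover have "nonedge_pair y a u v" using np m' a y unfolding nonedge_pair_def by auto
  moreover have "insert x (insert b (A - {a})) \<subseteq> V - {y, a, u, v}" using np m' a by auto
  ultimately have "part (insert x (insert b (A - {a}))) y a u v" unfolding part_def by blast
  then have "card (insert x (insert b (A - {a}))) \<le> card A" by (rule m'(7))
  moreover have "x \<notin> insert b (A - {a})" "b \<notin> A - {a}" using m' by auto
  then have "card (insert x (insert b (A - {a}))) = Suc (Suc (card (A - {a})))" using m'(6) by simp
  moreover have "Suc (card (A - {a})) = card A" using a m'(6) by (intro card.remove[symmetric])
  ultimately show False by simp
qed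

lemma max_part_unique_nbr_ex:
  assumes m: "max_part A x y u v b" and att: "\<exists>t\<in>A. R u t" "\<exists>t\<in>A. R v t"
  obtains a where "a \<in> A" "{t \<in> A. R v t} = {a}"
proof -
  obtain a where a: "a \<in> A" "conn R (insert u A - {a})" by (rule max_part_noncut[OF m att(1)])
  then show ?thesis using max_part_unique_nbr[OF m a att(2)] that by blast
qed

text \<open>Each vertex of \<open>A\<close> has at most two neighbours in
  \<open>A \<union> {u, v}\<close> and spends one of them on \<open>u\<close> or \<open>v\<close>,
  so the connected set \<open>A\<close> is a single edge.\<close>

lemma max_part_two:
  assumes m: "max_part A x y u v b" and att: "\<exists>t\<in>A. R u t" "\<exists>t\<in>A. R v t" "\<exists>t\<in>A. R x t" "\<exists>t\<in>A. R y t"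
  shows "card A = 2" "z \<in> A \<Longrightarrow> R z u \<or> R z v"
proof -
  note m' = max_partD[OF m]
  have rest: "V - {x, y, u, v} - A = {b}" by (rule max_part_rest[OF m att(1,2)])
  have cardA: "card A \<ge> 2" by (rule max_part_card[OF m rest])
  have m2: "max_part A u v x y b" by (rule max_part_sym(1)[OF m])
  show out: "R z u \<or> R z v" if "z \<in> A" for z by (rule max_part_vertex_outside[OF m2 att(3,4) that])
  have one: "t = t'" if zt: "z \<in> A" "t \<in> A" "t' \<in> A" "R z t" "R z t'" for z t t'
  proof (rule ccontr)
    assume "t \<noteq> t'"
    obtain w where w: "w \<in> {u, v}" "R z w" using out[OF zt(1)] by blast
    have "w \<noteq> t" "w \<noteq> t'" using w m'(2) zt by auto
    have "{t, t', w} \<subseteq> {t \<in> A \<union> {u, v}. R z t}" using zt w by auto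
    then have "card {t, t', w} \<le> card {t \<in> A \<union> {u, v}. R z t}" using m'(6) by (intro card_mono) auto
    then show False using max_part_degree[OF m att(1,2) zt(1)] \<open>t \<noteq> t'\<close> \<open>w \<noteq> t\<close> \<open>w \<noteq> t'\<close> by auto
  qed
  obtain z where z: "z \<in> A" using m' by blast
  obtain t where t: "t \<in> A" "R z t" using max_part_nbr_exists[OF m cardA z] by blast
  have "A \<subseteq> {z, t}"
  proof (rule ccontr)
    assume "\<not> A \<subseteq> {z, t}"
    then obtain w where "w \<in> A - {z, t}" by blast
    with m'(3) _ _ obtain p q where "p \<in> {z, t}" "q \<in> A - {z, t}" "R p q"
      by (rule conn_cross[of R A "{z, t}" z w]) (use z t in auto)
    then show False using one[of z t q] one[of t z q] z t R_sym by blast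
  qed
  then have "card A \<le> 2" by (rule card_subset_pair)
  then show "card A = 2" using cardA by simp
qed

text \<open>Here \<open>A = {p, q}\<close> with \<open>p\<close> adjacent to \<open>v\<close> but
  not \<open>u\<close>, and \<open>q\<close> to \<open>u\<close> but not \<open>v\<close>. The path
  from \<open>x\<close> through \<open>b\<close> to \<open>y\<close> is a part of size three for the
  crossed pairs \<open>q\<close>, \<open>v\<close> and \<open>p\<close>, \<open>u\<close>.\<close>

lemma max_part_b_half:
  assumes m: "max_part A x y u v b" and att: "\<exists>t\<in>A. R u t" "\<exists>t\<in>A. R v t" "\<exists>t\<in>A. R x t" "\<exists>t\<in>A. R y t"
    and b: "R b x" "R b y"
  shows False
proof -
  note m' = max_partD[OF m]
  note np = m'(1)[unfolded nonedge_pair_def]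
  obtain p where p: "p \<in> A" "{t \<in> A. R v t} = {p}" by (rule max_part_unique_nbr_ex[OF m att(1,2)])
  obtain q where q: "q \<in> A" "{t \<in> A. R u t} = {q}" by (rule max_part_unique_nbr_ex[OF max_part_sym(3)[OF m] att(2,1)])
  have "p \<noteq> q"
  proof
    assume "p = q"
    have "A \<noteq> {p}" using max_part_two(1)[OF m att] by auto
    then obtain z where "z \<in> A" "z \<noteq> p" using p by blast
    then show False using max_part_two(2)[OF m att, of z] p q \<open>p = q\<close> R_sym by blast
  qed
  have "q \<notin> {t \<in> A. R v t}" "p \<notin> {t \<in> A. R u t}" using p(2) q(2) \<open>p \<noteq> q\<close> by simp_all
  then have pq: "\<not> R q v" "\<not> R p u" using R_sym p(1) q(1) by auto
  have "conn R (insert y (insert b {x}))"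
  proof (rule conn_insert[OF symp_R _ _ b(2)])
    show "conn R (insert b {x})" by (rule conn_insert[OF symp_R conn_singleton _ R_sym[OF b(1)]]) simp
  qed simp
  moreover have "nonedge_pair q v p u" using np m' p q pq \<open>p \<noteq> q\<close> unfolding nonedge_pair_def by auto
  moreover have "insert y (insert b {x}) \<subseteq> V - {q, v, p, u}" using np m' p q by auto
  ultimately have "part (insert y (insert b {x})) q v p u" unfolding part_def by blast
  then have "card (insert y (insert b {x})) \<le> card A" by (rule m'(7))
  moreover have "card (insert y (insert b {x})) = 3" using np m' by auto
  ultimately show False using max_part_two(1)[OF m att] by simp
qed

text \<open>Once all four vertices are attached, \<open>b\<close> has at most one neighbour in each
  pair and none in \<open>A\<close>, against minimum degree three.\<close>

lemma max_part_False_attached: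
  assumes m: "max_part A x y u v b" and att: "\<exists>t\<in>A. R u t" "\<exists>t\<in>A. R v t"
  shows False
proof -
  note m' = max_partD[OF m]
  note np = m'(1)[unfolded nonedge_pair_def]
  have rest: "V - {x, y, u, v} - A = {b}" by (rule max_part_rest[OF m att])
  have att2: "\<exists>t\<in>A. R y t" "\<exists>t\<in>A. R x t"
    using max_part_only_one_attached[OF m att] max_part_only_one_attached[OF max_part_sym(2)[OF m] att] by auto
  have b: "\<not> R b a" if "a \<in> A" for a using max_part_closed[OF m that] rest R_sym by blast
  have nx: "\<not> (R b x \<and> R b y)" using max_part_b_half[OF m att att2(2,1)] by blast
  have nu: "\<not> (R b u \<and> R b v)" using max_part_b_half[OF max_part_sym(1)[OF m] att2(2,1) att] by blast
  obtain s t where "{w \<in> V. R b w} \<subseteq> {s, t}"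
  proof -
    have "{w \<in> V. R b w} \<subseteq> {x, y, u, v}" using b rest_cases[OF rest] irrefl_R by blast
    then have "{w \<in> V. R b w} \<subseteq> {if R b x then x else y, if R b u then u else v}" using nx nu by auto
    then show ?thesis using that by blast
  qed
  then have "card {w \<in> V. R b w} \<le> 2" by (rule card_subset_pair)
  then show False using degree_ge_3[of b] m' by simp
qed

text \<open>By \<open>cut\<close>, at least three of the four vertices have neighbours in
  \<open>A\<close>, so both vertices of some pair do.\<close>

lemma max_part_False: "\<not> max_part A x y u v b"
proof
  assume m: "max_part A x y u v b"
  note m' = max_partD[OF m]
  define N where "N = {w \<in> V - A. \<exists>a\<in>A. R a w}"
  have sub: "N \<subseteq> {x, y, u, v}" using max_part_closed[OF m] unfolding N_def by blast
  have N: "3 \<le> card N" unfolding N_def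
    by (rule cut) (use m' sub N_def in auto)
  have "(u \<in> N \<and> v \<in> N) \<or> (x \<in> N \<and> y \<in> N)"
  proof (rule ccontr)
    assume "\<not> ?thesis"
    then have "N \<subseteq> {if x \<in> N then x else y, if u \<in> N then u else v}" using sub by auto
    then have "card N \<le> 2" by (rule card_subset_pair)
    then show False using N by simp
  qed
  then show False
    using max_part_False_attached[OF m] max_part_False_attached[OF max_part_sym(1)[OF m]] R_sym
    unfolding N_def by blast
qed

text \<open>Single vertices are parts, so a largest part exists; by \<open>max_part_False\<close>
  nothing is left outside it.\<close>

lemma connected_complement_of_nonedges:
  assumes "nonedge_pair x y u v"
  obtains x' y' u' v' where "nonedge_pair x' y' u' v'" "conn R (V - {x', y', u', v'})"
proof -
  define \<A> where "\<A> = {A. \<exists>x y u v. part A x y u v}"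
  have fin: "finite \<A>"
    by (rule finite_subset[of _ "Pow V"]) (use finite_V in \<open>auto simp: \<A>_def part_def\<close>)
  have "\<not> V \<subseteq> {x, y, u, v}"
  proof
    assume "V \<subseteq> {x, y, u, v}"
    then have "card V \<le> card {x, y, u, v}" by (intro card_mono) auto
    also have "\<dots> \<le> 4" by (simp add: card_insert_if)
    finally show False using card_V by simp
  qed
  then obtain c where "c \<in> V - {x, y, u, v}" by blast
  then have "part {c} x y u v" using assms conn_singleton[of R c] unfolding part_def by auto
  then have "\<A> \<noteq> {}" unfolding \<A>_def by blast
  then have "Max (card ` \<A>) \<in> card ` \<A>" using fin by simp
  then obtain A where A: "A \<in> \<A>" "card A = Max (card ` \<A>)" by auto
  then obtain x' y' u' v' where p: "part A x' y' u' v'" unfolding \<A>_def by blast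
  have "card A' \<le> card A" if "part A' x'' y'' u'' v''" for A' x'' y'' u'' v''
  proof -
    have "A' \<in> \<A>" unfolding \<A>_def using that by blast
    then show ?thesis unfolding A(2) using fin by simp
  qed
  then have "V - {x', y', u', v'} - A = {}"
    using max_part_False[of A x' y' u' v'] p unfolding max_part_def by blast
  then have "V - {x', y', u', v'} = A" using p unfolding part_def by blast
  then show ?thesis using that p unfolding part_def by blast
qed

end

section \<open>Non-adjacent vertices\<close>

locale unbreakable_3_connected = unbreakable_quasi_biased G \<B> \<L> \<F>
  for G :: "('v, 'e) mgraph" and \<B> \<L> \<F> +
  assumes k_connected: "graph_k_connected 3 G" and card_verts: "card (verts G) \<ge> 7"
begin

lemma conn_delete:
  assumes "X \<subseteq> V" "card X < 3"
  shows "conn adj (V - X)"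
  unfolding conn_def
proof (intro ballI)
  fix a b assume ab: "a \<in> V - X" "b \<in> V - X"
  have "connected_graph (delete_verts G X)" using k_connected assms unfolding graph_k_connected_def by blast
  moreover have "verts (delete_verts G X) = V - X" unfolding delete_verts_def by simp
  ultimately obtain P W where "simple_path (delete_verts G X) a b P W"
    using ab unfolding connected_graph_def path_between_iff by blast
  moreover from this have "P \<subseteq> edges (delete_verts G X)" "W \<subseteq> verts (delete_verts G X)"
    using simple_path_basic by metis+
  ultimately have "reach (eadj (delete_verts G X) (edges (delete_verts G X))) (verts (delete_verts G X)) a b"
    by (rule simple_path_reach)
  then show "reach adj (V - X) a b"
    by (rule reach_mono) (auto simp: delete_verts_def adj_def eadj_def)
qed

sublocale graph: three_connected_relation V adj
proof
  fix A assume A: "A \<subseteq> V" "A \<noteq> {}" "V - A - {u \<in> V - A. \<exists>a\<in>A. adj a u} \<noteq> {}"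
  define N where "N = {u \<in> V - A. \<exists>a\<in>A. adj a u}"
  show "3 \<le> card {u \<in> V - A. \<exists>a\<in>A. adj a u}"
  proof (rule ccontr)
    assume "\<not> ?thesis"
    then have c: "conn adj (V - N)" unfolding N_def by (intro conn_delete) auto
    obtain a0 b0 where ab: "a0 \<in> A" "b0 \<in> V - N - A" using A N_def by blast
    have "A \<subseteq> V - N" using A(1) N_def by blast
    from c this ab obtain a b where "a \<in> A" "b \<in> V - N - A" "adj a b" by (rule conn_cross)
    then show False unfolding N_def by blast
  qed
next
  show "symp adj" by (rule sympI) (rule adj_sym)
  show "\<not> adj v v" for v by (simp add: adj_iff)
qed (rule finite_verts card_verts)+

lemma ex_adj:
  assumes "v \<in> V"
  obtains c where "adj v c"
proof -
  have "{t \<in> V. adj v t} \<noteq> {}" using graph.degree_ge_3[OF assms] by (metis card.empty not_numeral_le_zero)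
  then show ?thesis using that by blast
qed

lemma nonadj_ends:
  assumes "\<not> adj x y" "x \<noteq> y" "e \<in> E" "y \<in> ends G e"
  shows "x \<notin> ends G e"
proof
  assume x: "x \<in> ends G e"
  moreover have "ends G e \<noteq> {x}" using assms by auto
  ultimately obtain a where "ends G e = {x, a}" using edge_other_end assms(3) by metis
  then have "ends G e = {x, y}" using assms by auto
  then show False using assms unfolding adj_iff by blast
qed

lemma nonadj_neighbour: "\<not> adj x y \<Longrightarrow> adj y a \<Longrightarrow> a \<in> V - {x, y}"
  using adj_sym adj_verts unfolding adj_iff by blast

lemma reach_in_edge_set:
  assumes "conn adj T" "\<And>e. e \<in> E \<Longrightarrow> ends G e \<subseteq> T \<Longrightarrow> e \<in> S" "a \<in> T" "b \<in> T" "T \<subseteq> T'"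
  shows "reach (eadj G S) T' a b"
proof (rule reach_mono)
  show "reach adj T a b" using assms(1,3,4) unfolding conn_def by blast
  show "eadj G S c d" if "c \<in> T" "d \<in> T" "adj c d" for c d
    using that assms(2) unfolding adj_iff eadj_def by auto
qed fact

lemma conn_path:
  assumes "conn adj T" "a \<in> T" "b \<in> T" "T \<subseteq> V"
  obtains P W where "simple_path G a b P W" "P \<subseteq> {e \<in> E. ends G e \<subseteq> T}" "W \<subseteq> T"
proof -
  obtain P W where P: "simple_path G a b P W" "P \<subseteq> E" "W \<subseteq> T"
    using conn_eadj_path[of G E T a b] assms unfolding adj_def by blast
  then have "P \<subseteq> {e \<in> E. ends G e \<subseteq> T}" using simple_path_ends_subset[OF P(1)] by blast
  then show ?thesis using that P by blast
qed

text \<open>Otherwise contracting the edges avoiding \<open>x\<close> and \<open>y\<close> would separate the two stars.\<close>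

lemma unbalanced_meets_nonedge:
  assumes xy: "x \<in> V" "y \<in> V" "x \<noteq> y" "\<not> adj x y" and C0: "cycle C0" "C0 \<notin> \<B>"
  shows "x \<in> VS C0 \<or> y \<in> VS C0"
proof (rule ccontr)
  assume "\<not> ?thesis"
  then have nx: "x \<notin> VS C0" "y \<notin> VS C0" by auto
  define H where "H = V - {x, y}"
  define K where "K = {e \<in> E. ends G e \<subseteq> H}"
  \<comment> \<open>Besides \<open>K\<close>, the flat takes in the loops at \<open>x\<close> and
    \<open>y\<close> that are not in \<F>.\<close>
  define F where "F = E - proper_star x - proper_star y"
  have cH: "conn adj H" unfolding H_def by (rule conn_delete) (use xy in auto)
  have KF: "K \<subseteq> F" unfolding K_def F_def proper_star_def H_def by auto
  have C0H: "VS C0 \<subseteq> H" using cycle_basic(4)[OF C0(1)] nx unfolding H_def by auto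
  then have C0K: "C0 \<subseteq> K" using cycle_basic(1)[OF C0(1)] unfolding K_def vertex_set_def by auto
  obtain c0 where c0: "c0 \<in> VS C0"
  proof -
    obtain e where "e \<in> C0" using cycle_basic(3)[OF C0(1)] by blast
    moreover obtain a b where "ends G e = {a, b}" by (rule cycle_edge_ends[OF C0(1) \<open>e \<in> C0\<close>])
    ultimately show ?thesis using that unfolding vertex_set_def by auto
  qed
  have toC0: "\<exists>P W. simple_path G a c0 P W \<and> P \<subseteq> K \<and> W \<subseteq> H" if a: "a \<in> H" for a
  proof -
    have "c0 \<in> H" "H \<subseteq> V" using c0 C0H unfolding H_def by auto
    then show ?thesis using conn_path[OF cH a] unfolding K_def by metis
  qed
  have other: "\<exists>a. ends G e = {p, a} \<and> a \<in> H" if pe: "p = x \<or> p = y" "e \<in> proper_star p" "ends G e \<noteq> {p}" for e p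
  proof -
    have "e \<in> E" "p \<in> ends G e" using pe(2) unfolding proper_star_def by auto
    then obtain a where a: "ends G e = {p, a}" "p \<noteq> a" "a \<in> V" using edge_other_end pe(3) by metis
    then have "adj p a" using \<open>e \<in> E\<close> unfolding adj_iff by auto
    then have "a \<noteq> x" "a \<noteq> y" using pe(1) xy(4) a adj_sym by metis+
    then show ?thesis using a H_def by auto
  qed
  have mixed: "\<exists>X. circuit X \<and> X \<subseteq> insert e1 (insert e2 K) \<and> X \<inter> {e1, e2} \<noteq> {}"
    if p: "p = x \<or> p = y" "e1 \<in> proper_star p" "e2 \<in> proper_star p" "e1 \<noteq> e2" "ends G e1 = {p}" "ends G e2 \<noteq> {p}" for p e1 e2
  proof -
    have "p \<in> V" using p(1) xy by auto
    then have D: "cycle {e1}" "{e1} \<notin> \<B>" "VS {e1} = {p}"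
      using p is_cycle_loopI[of p G e1] classes_disjoint(2) unfolding proper_star_def vertex_set_def by auto
    obtain a where a: "ends G e2 = {p, a}" "a \<in> H" using other[OF p(1,3,6)] by blast
    obtain P W where P: "simple_path G a c0 P W" "P \<subseteq> K" "W \<subseteq> H" using toC0[OF a(2)] by blast
    have "simple_path G p c0 (insert e2 P) (insert p W)"
      using P a p \<open>p \<in> V\<close> by (intro simple_path.step[OF P(1)]) (auto simp: proper_star_def H_def)
    moreover have "e1 \<notin> C0" using C0K p unfolding K_def H_def by auto
    ultimately obtain X where "circuit X" "X \<subseteq> {e1} \<union> C0 \<union> insert e2 P" "e1 \<in> X"
      using circuit_connecting_unbalanced_cycles[OF D(1,2) _ C0, of e1] D(3) c0 by blast
    then show ?thesis using C0K P by blast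
  qed
  \<comment> \<open>Two edges of one star are dependent modulo \<open>K\<close>: they close a
    balanced cycle, form a tight handcuff of loops, or are joined through \<open>K\<close> to the
    unbalanced cycle \<open>C0\<close>.\<close>
  have two: "\<exists>X. circuit X \<and> X \<subseteq> insert e1 (insert e2 K) \<and> X \<inter> {e1, e2} \<noteq> {}"
    if p: "p = x \<or> p = y" "e1 \<in> proper_star p" "e2 \<in> proper_star p" "e1 \<noteq> e2" for p e1 e2
  proof -
    have pV: "p \<in> V" and pC: "p \<notin> VS C0" using p(1) xy nx by auto
    have eE: "e1 \<in> E" "e2 \<in> E" using p unfolding proper_star_def by auto
    consider "ends G e1 = {p}" "ends G e2 = {p}" | "ends G e1 = {p}" "ends G e2 \<noteq> {p}"
      | "ends G e1 \<noteq> {p}" "ends G e2 = {p}" | "ends G e1 \<noteq> {p}" "ends G e2 \<noteq> {p}" by blast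
    then show ?thesis
    proof cases
      case 1
      have D: "cycle {e1}" "{e1} \<notin> \<B>" "VS {e1} = {p}" "cycle {e2}" "{e2} \<notin> \<B>" "VS {e2} = {p}"
        using p 1 pV is_cycle_loopI[of p G] classes_disjoint(2) unfolding proper_star_def vertex_set_def by auto
      then have "circuit ({e1} \<union> {e2})" using circuit_tightI[of "{e1}" "{e2}"] p(4) by simp
      then show ?thesis by (intro exI[of _ "{e1} \<union> {e2}"]) auto
    next
      case 2
      then show ?thesis using mixed[OF p] by blast
    next
      case 3
      then obtain X where "circuit X" "X \<subseteq> insert e2 (insert e1 K)" "X \<inter> {e2, e1} \<noteq> {}"
        using mixed[of p e2 e1] p by metis
      then show ?thesis by (metis insert_commute)
    next
      case 4
      obtain a where a: "ends G e1 = {p, a}" "a \<in> H" using other[OF p(1,2) 4(1)] by blast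
      obtain b where b: "ends G e2 = {p, b}" "b \<in> H" using other[OF p(1,3) 4(2)] by blast
      have "H \<subseteq> V" unfolding H_def by auto
      from conn_path[OF cH a(2) b(2) this] obtain P W
        where P: "simple_path G a b P W" "P \<subseteq> K" "W \<subseteq> H" unfolding K_def by metis
      have pW: "p \<notin> W" using P p(1) unfolding H_def by auto
      note D = cycle_via_vertex[OF P(1) pW pV eE a(1) b(1) p(4)]
      define D' where "D' = insert e1 (insert e2 P)"
      show ?thesis
      proof (cases "D' \<in> \<B>")
        case True
        then show ?thesis using circuit_balancedI P unfolding D'_def by (intro exI[of _ D']) (auto simp: D'_def)
      next
        case False
        obtain Q X where Q: "simple_path G a c0 Q X" "Q \<subseteq> K" "X \<subseteq> H" using toC0[OF a(2)] by blast
        have "a \<in> VS D'" unfolding D'_def D(2) using simple_path_basic(1)[OF P(1)] by simp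
        moreover have "e1 \<notin> C0" using C0K a p(1) unfolding K_def H_def by auto
        moreover have "cycle D'" "e1 \<in> D'" unfolding D'_def using D by auto
        ultimately obtain Y where "circuit Y" "Y \<subseteq> D' \<union> C0 \<union> Q" "e1 \<in> Y"
          using circuit_connecting_unbalanced_cycles[OF _ False _ C0 _ Q(1), of e1] c0 by blast
        then show ?thesis using C0K P Q unfolding D'_def by blast
      qed
    qed
  qed
  have closed: "X - F \<noteq> {g}" if X: "circuit X" for X g
  proof
    assume eq: "X - F = {g}"
    then have gX: "g \<in> X" "g \<in> proper_star x \<or> g \<in> proper_star y" using circuit_basic(1)[OF X] unfolding F_def by auto
    then obtain g' where "g' \<in> X" "g' \<noteq> g" "g' \<in> proper_star x \<or> g' \<in> proper_star y"
      using circuit_proper_star_two[OF X gX(1) _ C0] nx by blast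
    then have "g' \<in> X - F" unfolding F_def by auto
    then show False using eq \<open>g' \<noteq> g\<close> by auto
  qed
  obtain cx where "adj x cx" by (rule ex_adj[OF xy(1)])
  then obtain e where e: "e \<in> E" "ends G e = {x, cx}" "x \<noteq> cx" unfolding adj_iff by blast
  then have ex: "e \<in> proper_star x" unfolding proper_star_def by auto
  obtain cy where "adj y cy" by (rule ex_adj[OF xy(2)])
  then obtain f where f: "f \<in> E" "ends G f = {y, cy}" "y \<noteq> cy" unfolding adj_iff by blast
  then have fy: "f \<in> proper_star y" unfolding proper_star_def by auto
  have disj: "g \<notin> proper_star y" if "g \<in> proper_star x" for g
    using that nonadj_ends[OF xy(4,3), of g] unfolding proper_star_def by blast
  have FE: "F \<subseteq> E" unfolding F_def by auto
  have "e \<in> E - F" "f \<in> E - F" "e \<noteq> f" using e f ex fy disj[OF ex] unfolding F_def by auto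
  from minimal_circuit[OF FE closed this]
  obtain X where X: "circuit X" "e \<in> X" "f \<in> X"
    "\<And>C'. circuit C' \<Longrightarrow> C' - F \<noteq> {} \<Longrightarrow> \<not> C' - F \<subset> X - F" by metis
  \<comment> \<open>A circuit meeting both stars uses two edges at \<open>x\<close>; these already
    contain, modulo \<open>F\<close>, a circuit that avoids \<open>f\<close>.\<close>
  obtain e' where e': "e' \<in> X" "e' \<noteq> e" "e' \<in> proper_star x" using circuit_proper_star_two[OF X(1,2) ex C0 nx(1)] by blast
  obtain Y where Y: "circuit Y" "Y \<subseteq> insert e (insert e' K)" "Y \<inter> {e, e'} \<noteq> {}"
    using two[of x e e'] ex e' by blast
  have eF: "e \<notin> F" "e' \<notin> F" using ex e' unfolding F_def by auto
  have "Y - F \<noteq> {}" using Y eF by blast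
  moreover have "Y - F \<subseteq> {e, e'}" using Y KF by blast
  moreover have "f \<in> X - F" "f \<notin> {e, e'}" "{e, e'} \<subseteq> X - F"
    using X fy disj ex e' eF unfolding F_def by auto
  ultimately show False using X(4)[OF Y(1)] by blast
qed

section \<open>Local restrictions on non-adjacent pairs\<close>

lemma unbalanced_complement_clique:
  assumes "cycle C" "C \<notin> \<B>" "p \<in> V - VS C" "q \<in> V - VS C" "p \<noteq> q"
  shows "adj p q"
  using unbalanced_meets_nonedge[of p q C] assms by blast

text \<open>If all cycles are balanced, \<open>E\<close> without the non-loop edges at
  \<open>x\<close> is a balanced set that no cycle exceeds by exactly one edge. It contains all
  edges at \<open>y\<close>, so the star of \<open>y\<close> could be separated.\<close>

lemma nonedge_unbalanced:
  assumes xy: "x \<in> V" "y \<in> V" "x \<noteq> y" "\<not> adj x y"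
  shows "\<exists>C. cycle C \<and> C \<notin> \<B>"
proof (rule ccontr)
  assume "\<not> ?thesis"
  then have allB: "C \<in> \<B>" if "cycle C" for C using that by blast
  define \<delta> where "\<delta> = {e \<in> E. x \<in> ends G e \<and> ends G e \<noteq> {x}}"
  obtain c where "adj x c" by (rule ex_adj[OF xy(1)])
  then obtain e where e: "e \<in> E" "ends G e = {x, c}" "x \<noteq> c" unfolding adj_iff by blast
  obtain d where d: "adj y d" by (rule ex_adj[OF xy(2)])
  have cH: "conn adj (V - {x, y})" by (rule conn_delete) (use xy in auto)
  note nb = nonadj_neighbour[OF xy(4)]
  show False
  proof (rule balanced_star_separation[of "E - \<delta>" e y d])
    show "balanced (E - \<delta>)" using allB unfolding balanced_def by blast
    show "e \<in> E - (E - \<delta>)" using e unfolding \<delta>_def by auto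
    show "f \<in> E - \<delta>" if "f \<in> E" "y \<in> ends G f" for f
      using that nonadj_ends[OF xy(4,3) that] unfolding \<delta>_def by blast
    show "C - (E - \<delta>) \<noteq> {g}" if C: "C \<in> \<B>" for C g
    proof
      assume eq: "C - (E - \<delta>) = {g}"
      have cC: "cycle C" using C cycle_iff by simp
      have g: "g \<in> C" "g \<in> \<delta>" using eq cycle_basic(1)[OF cC] by auto
      then obtain g' where "g' \<in> C" "g' \<noteq> g" "x \<in> ends G g'" "ends G g' \<noteq> {x}"
        using cycle_degree[OF cC g(1), of x] unfolding \<delta>_def by blast
      then have "g' \<in> C - (E - \<delta>)" using cycle_basic(1)[OF cC] unfolding \<delta>_def by auto
      then show False using eq \<open>g' \<noteq> g\<close> by auto
    qed
    show "reach (eadj G (E - \<delta>)) (V - {y}) a b" if "adj y a" "adj y b" for a b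
      by (rule reach_in_edge_set[OF cH _ nb[OF that(1)] nb[OF that(2)]]) (auto simp: \<delta>_def)
  qed (use d in auto)
qed

lemma max_balanced_proper:
  assumes "max_balanced S" "x \<in> V" "y \<in> V" "x \<noteq> y" "\<not> adj x y"
  obtains e where "e \<in> E - S"
proof -
  obtain C where C: "cycle C" "C \<notin> \<B>" using nonedge_unbalanced assms by blast
  then have "\<not> C \<subseteq> S" using assms(1) balancedD unfolding max_balanced_def by blast
  then show ?thesis using that cycle_basic(1)[OF C(1)] by blast
qed

text \<open>Otherwise the edges of \<open>G - x\<close> form a balanced set. A maximal one above it
  contains all edges at \<open>y\<close>, and \<open>G - x - y\<close> is connected, so the star of
  \<open>y\<close> could be separated.\<close>

lemma nonedge_unbalanced_avoiding:
  assumes xy: "x \<in> V" "y \<in> V" "x \<noteq> y" "\<not> adj x y"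
  obtains C where "cycle C" "C \<notin> \<B>" "x \<notin> VS C"
proof -
  have False if no: "\<And>C. cycle C \<Longrightarrow> x \<notin> VS C \<Longrightarrow> C \<in> \<B>"
  proof -
    define S0 where "S0 = {e \<in> E. x \<notin> ends G e}"
    have "balanced S0" unfolding balanced_def
    proof (intro allI impI)
      fix C assume "cycle C" "C \<subseteq> S0"
      then show "C \<in> \<B>" using no[of C] unfolding S0_def vertex_set_def by auto
    qed
    then obtain S where S: "S0 \<subseteq> S" "max_balanced S"
      using max_balanced_extend[of S0] unfolding S0_def by blast
    obtain e where e: "e \<in> E - S" by (rule max_balanced_proper[OF S(2) xy])
    obtain d where d: "adj y d" by (rule ex_adj[OF xy(2)])
    have cH: "conn adj (V - {x, y})" by (rule conn_delete) (use xy in auto)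
    note nb = nonadj_neighbour[OF xy(4)]
    show False
    proof (rule max_balanced_star_separation[OF S(2) e _ d])
      show "f \<in> S" if "f \<in> E" "y \<in> ends G f" for f
        using that nonadj_ends[OF xy(4,3) that] S unfolding S0_def by blast
      show "reach (eadj G S) (V - {y}) a b" if "adj y a" "adj y b" for a b
        by (rule reach_in_edge_set[OF cH _ nb[OF that(1)] nb[OF that(2)]]) (use S in \<open>auto simp: S0_def\<close>)
    qed
  qed
  then show ?thesis using that by blast
qed

lemma balanced_avoiding_nonedge:
  assumes "x \<in> V" "y \<in> V" "x \<noteq> y" "\<not> adj x y"
  shows "balanced {e \<in> E. ends G e \<inter> {x, y} = {}}"
  unfolding balanced_def
proof (intro allI impI)
  fix C assume "cycle C" "C \<subseteq> {e \<in> E. ends G e \<inter> {x, y} = {}}"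
  then show "C \<in> \<B>" using unbalanced_meets_nonedge[OF assms, of C] unfolding vertex_set_def by auto
qed

text \<open>The edges avoiding \<open>x\<close> and \<open>y\<close> are balanced and include all
  edges at \<open>z\<close>, so the star of \<open>z\<close> could be separated.\<close>

lemma no_nonadjacent_triple:
  assumes V: "x \<in> V" "y \<in> V" "z \<in> V" and d: "x \<noteq> y" "x \<noteq> z" "y \<noteq> z"
    and n: "\<not> adj x y" "\<not> adj x z" "\<not> adj y z" and c: "conn adj (V - {x, y, z})"
  shows False
proof -
  define S0 where "S0 = {e \<in> E. ends G e \<inter> {x, y} = {}}"
  have "balanced S0" unfolding S0_def by (rule balanced_avoiding_nonedge) fact+
  then obtain S where S: "S0 \<subseteq> S" "max_balanced S"
    using max_balanced_extend[of S0] unfolding S0_def by blast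
  obtain e where e: "e \<in> E - S" by (rule max_balanced_proper[OF S(2) V(1,2) d(1) n(1)])
  obtain w where w: "adj z w" by (rule ex_adj[OF V(3)])
  have nb: "a \<in> V - {x, y, z}" if "adj z a" for a
    using that n adj_sym adj_verts unfolding adj_iff by blast
  show False
  proof (rule max_balanced_star_separation[OF S(2) e _ w])
    show "f \<in> S" if "f \<in> E" "z \<in> ends G f" for f
      using that nonadj_ends[OF n(2) d(2) that] nonadj_ends[OF n(3) d(3) that] S unfolding S0_def by blast
    show "reach (eadj G S) (V - {z}) a b" if "adj z a" "adj z b" for a b
      by (rule reach_in_edge_set[OF c _ nb[OF that(1)] nb[OF that(2)]]) (use S in \<open>auto simp: S0_def\<close>)
  qed
qed

lemma cycle_at_vertex:
  assumes "cycle D" "v \<in> VS D" "w \<in> VS D" "v \<noteq> w"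
  obtains e1 e2 a1 a2 P W where "e1 \<noteq> e2" "e1 \<in> E" "e2 \<in> E" "ends G e1 = {v, a1}" "ends G e2 = {v, a2}"
    "simple_path G a1 a2 P W" "v \<notin> W" "D = insert e1 (insert e2 P)" "VS D = insert v W"
proof -
  obtain e1 where e1: "e1 \<in> D" "v \<in> ends G e1" using assms unfolding vertex_set_def by auto
  have DE: "D \<subseteq> E" by (rule cycle_basic(1)[OF assms(1)])
  have "ends G e1 \<noteq> {v}"
  proof
    assume eq: "ends G e1 = {v}"
    then have "D = {e1}" using cycle_loop[OF assms(1)] e1 by blast
    then show False using assms eq unfolding vertex_set_def by auto
  qed
  then obtain a1 where a1: "ends G e1 = {v, a1}" "v \<noteq> a1" using edge_other_end[of e1 v] e1 DE by blast
  have sp: "simple_path G v a1 (D - {e1}) (VS D)" by (rule cycle_edge_path[OF assms(1) e1(1) a1])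
  obtain e2 a2 Q X where Q: "e2 \<in> E" "ends G e2 = {v, a2}" "a2 \<noteq> v" "simple_path G a2 a1 Q X"
    "v \<notin> X" "D - {e1} = insert e2 Q" "e2 \<notin> Q" "VS D = insert v X"
    by (rule path_nonempty_ex_edge[OF sp a1(2)])
  show ?thesis
    by (rule that[of e1 e2 a1 a2 Q X]) (use Q e1 a1 DE simple_path_rev[OF Q(4)] in auto)
qed

text \<open>An unbalanced cycle \<open>D\<close> avoiding \<open>x\<close> contains
  \<open>y1\<close>, \<open>y2\<close> and \<open>y3\<close>, and at \<open>y1\<close> it goes to
  the other two. A third edge at \<open>y1\<close> lies in balanced cycles with each of these two
  edges, and rerouting through them makes \<open>D\<close> balanced.\<close>

lemma no_three_nonneighbours:
  assumes V: "x \<in> V" "y1 \<in> V" "y2 \<in> V" "y3 \<in> V"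
    and d: "x \<noteq> y1" "x \<noteq> y2" "x \<noteq> y3" "y1 \<noteq> y2" "y1 \<noteq> y3" "y2 \<noteq> y3"
    and n: "\<not> adj x y1" "\<not> adj x y2" "\<not> adj x y3"
    and c: "conn adj (V - {x, y1, y2})" "conn adj (V - {x, y1, y3})"
  shows False
proof -
  define S0 where "S0 = {e \<in> E. ends G e \<inter> {x, y1} = {}}"
  have S0: "balanced S0" unfolding S0_def by (rule balanced_avoiding_nonedge) fact+
  have H: "conn adj (V - {x, y1})" by (rule conn_delete) (use V d in auto)
  have pathS0: "P \<subseteq> S0" if "simple_path G a b P W" "x \<notin> W" "y1 \<notin> W" for a b P W
    using simple_path_basic(4)[OF that(1)] simple_path_ends_subset[OF that(1)] that(2,3) unfolding S0_def by blast
  have star: "y1 \<in> ends G e" "ends G e \<noteq> {y1}" if "ends G e = {y1, a}" "a \<noteq> y1" for e a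
    using that by auto
  have S0y: "ends G e = {y1}" if "e \<in> S0" "y1 \<in> ends G e" for e using that unfolding S0_def by auto
  text \<open>An unbalanced cycle avoiding \<open>x\<close> passes through both edges from \<open>y1\<close> to \<open>y2\<close> and \<open>y3\<close>.\<close>
  have hit: "y \<in> {a1, a2}"
    if e: "e1 \<noteq> e2" "e1 \<in> E" "e2 \<in> E" "ends G e1 = {y1, a1}" "ends G e2 = {y1, a2}"
      and P: "simple_path G a1 a2 P W" "y1 \<notin> W" "x \<notin> W" "insert e1 (insert e2 P) \<notin> \<B>"
      and y: "y = y2 \<or> y = y3" for e1 e2 a1 a2 P W y
  proof (rule ccontr)
    assume ny: "y \<notin> {a1, a2}"
    have cy: "conn adj (V - {x, y1, y})" and yy: "y \<in> V" "x \<noteq> y" "\<not> adj x y" "y \<noteq> y1"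
      using y c V d n by auto
    have aW: "a1 \<in> W" "a2 \<in> W" "W \<subseteq> V" using simple_path_basic[OF P(1)] by auto
    then have a: "a1 \<in> V - {x, y1, y}" "a2 \<in> V - {x, y1, y}" using P ny by auto
    \<comment> \<open>A second cycle through the same two edges at \<open>y1\<close> avoids
      \<open>x\<close> and \<open>y\<close>, hence is balanced; \<open>reroute\<close> carries this
      over to the given cycle.\<close>
    obtain Q X where Q: "simple_path G a1 a2 Q X" "X \<subseteq> V - {x, y1, y}"
      by (rule conn_path[OF cy a]) auto
    have yX: "y1 \<notin> X" "x \<notin> X" "y \<notin> X" using Q by auto
    note cQ = cycle_via_vertex[OF Q(1) yX(1) V(2) e(2,3,4,5,1)]
    note cP = cycle_via_vertex[OF P(1,2) V(2) e(2,3,4,5,1)]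
    have QB: "insert e1 (insert e2 Q) \<in> \<B>"
      using unbalanced_meets_nonedge[OF V(1) yy(1,2,3) cQ(1)] cQ(2) yX d yy by auto
    have "a2 \<noteq> y1" using aW P by auto
    have bal: "balanced (S0 \<union> {e2})"
      by (rule balanced_Un_star[OF S0 _ _ S0y]) (use star[OF e(5) \<open>a2 \<noteq> y1\<close>] in auto)
    have "insert e1 (insert e2 P) \<in> \<B>"
      by (rule reroute[OF bal cP(1) _ _ QB, of e1])
        (use pathS0[OF P(1,3,2)] pathS0[OF Q(1) yX(2,1)] in auto)
    then show False using P by blast
  qed
  obtain D where D: "cycle D" "D \<notin> \<B>" "x \<notin> VS D" by (rule nonedge_unbalanced_avoiding[OF V(1,2) d(1) n(1)])
  have yD: "y1 \<in> VS D" "y2 \<in> VS D" "y3 \<in> VS D"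
    using unbalanced_meets_nonedge[OF V(1,2) d(1) n(1) D(1,2)] unbalanced_meets_nonedge[OF V(1,3) d(2) n(2) D(1,2)]
    unbalanced_meets_nonedge[OF V(1,4) d(3) n(3) D(1,2)] D(3) by auto
  obtain f1 f2 b1 b2 P W where f: "f1 \<noteq> f2" "f1 \<in> E" "f2 \<in> E" "ends G f1 = {y1, b1}" "ends G f2 = {y1, b2}"
    "simple_path G b1 b2 P W" "y1 \<notin> W" "D = insert f1 (insert f2 P)" "VS D = insert y1 W"
    by (rule cycle_at_vertex[OF D(1) yD(1,2) d(4)])
  have xW: "x \<notin> W" using f D by auto
  have "y2 \<in> {b1, b2}" "y3 \<in> {b1, b2}"
    using hit[OF f(1-7) xW, of y2] hit[OF f(1-7) xW, of y3] D(2) f(8) by auto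
  then have b: "{b1, b2} = {y2, y3}" "b1 \<noteq> b2" using d by auto
  have "\<not> {t \<in> V. adj y1 t} \<subseteq> {y2, y3}"
  proof
    assume "{t \<in> V. adj y1 t} \<subseteq> {y2, y3}"
    then have "card {t \<in> V. adj y1 t} \<le> card {y2, y3}" by (intro card_mono) auto
    then show False using graph.degree_ge_3[OF V(2)] d by simp
  qed
  then obtain a where a: "a \<in> V" "adj y1 a" "a \<notin> {y2, y3}" by blast
  then obtain g where g: "g \<in> E" "ends G g = {y1, a}" "a \<noteq> y1" unfolding adj_iff by blast
  have aH: "a \<in> V - {x, y1}" using a g n adj_sym by auto
  have bW: "b1 \<in> W" "b2 \<in> W" "W \<subseteq> V" using simple_path_basic[OF f(6)] by auto
  then have bH: "b1 \<in> V - {x, y1}" "b2 \<in> V - {x, y1}" using f xW by auto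
  have anb: "a \<notin> {b1, b2}" using a(3) b(1) by simp
  \<comment> \<open>A cycle entering \<open>y1\<close> from \<open>a\<close> cannot have both
    \<open>y2\<close> and \<open>y3\<close> next to \<open>y1\<close>, so \<open>hit\<close> makes
    it balanced.\<close>
  have third: "\<exists>C\<in>\<B>. g \<in> C \<and> h \<in> C \<and> C \<subseteq> insert g (insert h S0)"
    if h: "h \<in> E" "ends G h = {y1, b}" "b \<in> {b1, b2}" for h b
  proof -
    have bb: "b \<in> V - {x, y1}" "b \<noteq> a" using h(3) bH anb by auto
    obtain Q X where Q: "simple_path G a b Q X" "X \<subseteq> V - {x, y1}"
      by (rule conn_path[OF H aH bb(1)]) auto
    have X: "x \<notin> X" "y1 \<notin> X" using Q by auto
    have gh: "g \<noteq> h" using g h bb by (auto simp: doubleton_eq_iff)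
    have "insert g (insert h Q) \<in> \<B>"
    proof (rule ccontr)
      assume nB: "insert g (insert h Q) \<notin> \<B>"
      have "y2 \<in> {a, b}" "y3 \<in> {a, b}"
        using hit[OF gh g(1) h(1) g(2) h(2) Q(1) X(2,1) nB] by auto
      then show False using a d by auto
    qed
    then show ?thesis using pathS0[OF Q(1) X] by blast
  qed
  have b1y: "b1 \<noteq> y1" "b2 \<noteq> y1" using bH by auto
  have bal: "balanced (S0 \<union> {g, f1})"
  proof (rule balanced_Un_star[OF S0 _ _ S0y])
    show "y1 \<in> ends G e \<and> ends G e \<noteq> {y1}" if "e \<in> {g, f1}" for e
      using that star[OF g(2,3)] star[OF f(4) b1y(1)] by auto
    obtain C where C: "C \<in> \<B>" "g \<in> C" "f1 \<in> C" "C \<subseteq> insert g (insert f1 S0)"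
      using third[OF f(2,4)] by blast
    show "\<exists>C\<in>\<B>. e \<in> C \<and> e' \<in> C \<and> C \<subseteq> insert e (insert e' S0)"
      if "e \<in> {g, f1}" "e' \<in> {g, f1}" "e \<noteq> e'" for e e'
      by (rule bexI[OF _ C(1)]) (use that C in auto)
  qed simp
  obtain C where C: "C \<in> \<B>" "g \<in> C" "f2 \<in> C" "C \<subseteq> insert g (insert f2 S0)"
    using third[OF f(3,5)] by blast
  have "D \<in> \<B>"
    by (rule reroute[OF bal D(1) _ _ C(1), of f2]) (use C f pathS0[OF f(6) xW f(7)] in auto)
  then show False using D by blast
qed

end

section \<open>Non-adjacent pairs meet\<close>

context unbreakable_3_connected
begin

text \<open>Here \<open>S\<close> is a maximal balanced set containing every edge that does not join \<open>{x, y}\<close> to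
  \<open>{u, v}\<close>.\<close>

definition frame :: "'v \<Rightarrow> 'v \<Rightarrow> 'v \<Rightarrow> 'v \<Rightarrow> 'e set \<Rightarrow> bool" where
  "frame x y u v S \<longleftrightarrow> graph.nonedge_pair x y u v \<and> conn adj (V - {x, y, u, v}) \<and> max_balanced S \<and>
     (\<forall>e\<in>E - S. \<exists>p\<in>{x, y}. \<exists>q\<in>{u, v}. ends G e = {p, q})"

lemma frame_sym:
  assumes "frame x y u v S"
  shows "frame u v x y S" "frame y x u v S" "frame x y v u S"
proof -
  have eq': "{y, x} = {x, y}" "{v, u} = {u, v}" by auto
  note eq = four_set_sym[where x = x and y = y and u = u and v = v] eq'
  have *: "conn adj (V - {x, y, u, v})" "max_balanced S"
    "\<forall>e\<in>E - S. \<exists>p\<in>{x, y}. \<exists>q\<in>{u, v}. ends G e = {p, q}"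
    and np: "graph.nonedge_pair x y u v" using assms unfolding frame_def by blast+
  have "\<forall>e\<in>E - S. \<exists>p\<in>{u, v}. \<exists>q\<in>{x, y}. ends G e = {p, q}" using *(3) by (metis insert_commute)
  then show "frame u v x y S" "frame y x u v S" "frame x y v u S"
    unfolding frame_def eq using * graph.nonedge_pair_sym[OF np] by simp_all
qed

text \<open>Cycles missing one of the pairs are balanced. To the edges avoiding \<open>x\<close> and
  \<open>y\<close> and all loops one can add the edges from \<open>x\<close>, then from
  \<open>y\<close>, into the middle part: paths there close them to cycles missing \<open>u\<close>
  and \<open>v\<close>.\<close>

lemma frame_exists:
  assumes np: "graph.nonedge_pair x y u v" and c: "conn adj (V - {x, y, u, v})"
  obtains S where "frame x y u v S"
proof -
  define V0 where "V0 = V - {x, y, u, v}"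
  have V: "x \<in> V" "y \<in> V" "u \<in> V" "v \<in> V" and d: "x \<noteq> y" "u \<noteq> v" "x \<noteq> u" "x \<noteq> v" "y \<noteq> u" "y \<noteq> v"
    and n: "\<not> adj x y" "\<not> adj u v" using np unfolding graph.nonedge_pair_def by auto
  have B: "C \<in> \<B>" if "cycle C" "VS C \<inter> {x, y} = {} \<or> VS C \<inter> {u, v} = {}" for C
    using unbalanced_meets_nonedge[OF V(1,2) d(1) n(1) that(1)]
      unbalanced_meets_nonedge[OF V(3,4) d(2) n(2) that(1)] that(2) by auto
  define S1 where "S1 = {e \<in> E. ends G e \<inter> {x, y} = {} \<or> (\<exists>p. ends G e = {p})}"
  have S1: "balanced S1" unfolding balanced_def
  proof (intro allI impI)
    fix C assume C: "cycle C" "C \<subseteq> S1"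
    show "C \<in> \<B>"
    proof (cases "\<exists>e\<in>C. \<exists>p. ends G e = {p}")
      case True
      then obtain e p where e: "e \<in> C" "ends G e = {p}" by blast
      then have "C = {e}" using cycle_loop[OF C(1)] by blast
      then have "VS C = {p}" using e unfolding vertex_set_def by simp
      then show ?thesis using B[OF C(1)] d by auto
    next
      case False
      then have "VS C \<inter> {x, y} = {}" using C(2) unfolding S1_def vertex_set_def by blast
      then show ?thesis using B[OF C(1)] by blast
    qed
  qed
  define R where "R z = {e \<in> E. \<exists>a\<in>V0. ends G e = {z, a}}" for z
  have finR: "finite (R z)" for z unfolding R_def using finite_edges by simp
  have pair: "\<exists>C\<in>\<B>. e \<in> C \<and> e' \<in> C \<and> C \<subseteq> insert e (insert e' S1)"
    if e: "e \<in> R z" "e' \<in> R z" "e \<noteq> e'" "z = x \<or> z = y" for e e' z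
  proof -
    obtain a where a: "ends G e = {z, a}" "a \<in> V0" using e unfolding R_def by blast
    obtain b where b: "ends G e' = {z, b}" "b \<in> V0" using e unfolding R_def by blast
    have V0V: "V0 \<subseteq> V" unfolding V0_def by auto
    obtain P W where P: "simple_path G a b P W" "P \<subseteq> {e \<in> E. ends G e \<subseteq> V0}" "W \<subseteq> V0"
      by (rule conn_path[OF c[folded V0_def] a(2) b(2) V0V])
    have z: "z \<notin> W" "z \<in> V" using P e(4) V unfolding V0_def by auto
    have eE: "e \<in> E" "e' \<in> E" using e unfolding R_def by auto
    note C = cycle_via_vertex[OF P(1) z eE a(1) b(1) e(3)]
    have "VS (insert e (insert e' P)) \<inter> {u, v} = {}" unfolding C(2) using P(3) e(4) d unfolding V0_def by auto
    then have "insert e (insert e' P) \<in> \<B>" using B[OF C(1)] by blast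
    moreover have "P \<subseteq> S1" using P(2) unfolding S1_def V0_def by auto
    ultimately show ?thesis by blast
  qed
  have star: "z \<in> ends G e \<and> ends G e \<noteq> {z}" if "e \<in> R z" "z = x \<or> z = y" for e z
    using that unfolding R_def V0_def by auto
  have loop: "ends G e = {z}" if "e \<in> S1" "z \<in> ends G e" "z = x \<or> z = y" for e z
    using that unfolding S1_def by auto
  have Rx: "balanced (S1 \<union> R x)"
    by (rule balanced_Un_star[OF S1 finR star]) (use loop pair in auto)
  have Ry: "balanced (S1 \<union> R x \<union> R y)"
  proof (rule balanced_Un_star[OF Rx finR])
    show "y \<in> ends G e \<and> ends G e \<noteq> {y}" if "e \<in> R y" for e using star that by blast
    show "ends G e = {y}" if "e \<in> S1 \<union> R x" "y \<in> ends G e" for e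
      using that loop d unfolding R_def V0_def by auto
    show "\<exists>C\<in>\<B>. e \<in> C \<and> e' \<in> C \<and> C \<subseteq> insert e (insert e' (S1 \<union> R x))"
      if "e \<in> R y" "e' \<in> R y" "e \<noteq> e'" for e e'
      using pair[OF that] by blast
  qed
  have "S1 \<union> R x \<union> R y \<subseteq> E" unfolding S1_def R_def by auto
  then obtain S where S: "S1 \<union> R x \<union> R y \<subseteq> S" "max_balanced S"
    using max_balanced_extend[OF Ry] by blast
  have "\<exists>p\<in>{x, y}. \<exists>q\<in>{u, v}. ends G e = {p, q}" if e: "e \<in> E - S" for e
  proof -
    have eE: "e \<in> E" and nS: "e \<notin> S1" "e \<notin> R x" "e \<notin> R y" using e S(1) by auto
    then obtain p where p: "p \<in> {x, y}" "p \<in> ends G e" "ends G e \<noteq> {p}" unfolding S1_def by auto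
    obtain a where a: "ends G e = {p, a}" "p \<noteq> a" "a \<in> V" using edge_other_end[OF eE p(2,3)] by metis
    have "a \<notin> V0" using nS eE a p(1) unfolding R_def by auto
    moreover have "adj p a" using a eE unfolding adj_iff by blast
    then have "a \<notin> {x, y}" using p(1) a(2) n(1) adj_sym by auto
    ultimately have "a \<in> {u, v}" using a(3) unfolding V0_def by auto
    then show ?thesis using a p(1) by blast
  qed
  then have "frame x y u v S" unfolding frame_def using np c S(2) by blast
  then show ?thesis by (rule that)
qed

section \<open>Adjacencies forced by a frame\<close>

definition nbrs :: "'v \<Rightarrow> 'v \<Rightarrow> 'v \<Rightarrow> 'v \<Rightarrow> 'v \<Rightarrow> 'v set" where
  "nbrs x y u v s = {t \<in> V - {x, y, u, v}. adj s t}"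

lemma nbrs_sym: "nbrs u v x y s = nbrs x y u v s" "nbrs y x u v s = nbrs x y u v s"
    "nbrs x y v u s = nbrs x y u v s"
proof -
  note eq = four_set_sym[where x = x and y = y and u = u and v = v]
  show "nbrs u v x y s = nbrs x y u v s" "nbrs y x u v s = nbrs x y u v s" "nbrs x y v u s = nbrs x y u v s"
    unfolding nbrs_def eq by simp_all
qed

lemma frameD:
  assumes "frame x y u v S"
  shows "x \<in> V" "y \<in> V" "u \<in> V" "v \<in> V" "distinct [x, y, u, v]" "\<not> adj x y" "\<not> adj u v"
    "conn adj (V - {x, y, u, v})" "max_balanced S"
    "\<And>e. e \<in> E - S \<Longrightarrow> \<exists>p\<in>{x, y}. \<exists>q\<in>{u, v}. ends G e = {p, q}"
proof -
  have *: "conn adj (V - {x, y, u, v})" "max_balanced S"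
    "\<forall>e\<in>E - S. \<exists>p\<in>{x, y}. \<exists>q\<in>{u, v}. ends G e = {p, q}"
    and np: "graph.nonedge_pair x y u v" using assms unfolding frame_def by blast+
  show "conn adj (V - {x, y, u, v})" "max_balanced S" by fact+
  show "\<exists>p\<in>{x, y}. \<exists>q\<in>{u, v}. ends G e = {p, q}" if "e \<in> E - S" for e using *(3) that by blast
  show "x \<in> V" "y \<in> V" "u \<in> V" "v \<in> V" "distinct [x, y, u, v]" "\<not> adj x y" "\<not> adj u v"
    using np unfolding graph.nonedge_pair_def by auto
qed

lemma frame_distinct:
  assumes "frame x y u v S"
  shows "x \<noteq> y" "x \<noteq> u" "x \<noteq> v" "y \<noteq> u" "y \<noteq> v" "u \<noteq> v"
  using frameD(5)[OF assms] by auto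

text \<open>Some unbalanced cycle avoids \<open>x\<close> and has to leave \<open>S\<close>. By
  symmetry no vertex of the frame lies on all edges outside \<open>S\<close>.\<close>

lemma frame_edge_avoiding:
  assumes f: "frame x y u v S"
  shows "\<exists>e\<in>E - S. x \<notin> ends G e"
proof -
  note f' = frameD[OF f]
  have "x \<noteq> y" using f'(5) by simp
  from nonedge_unbalanced_avoiding[OF f'(1,2) this f'(6)]
  obtain C where C: "cycle C" "C \<notin> \<B>" "x \<notin> VS C" .
  then have "\<not> C \<subseteq> S" using f'(9) balancedD unfolding max_balanced_def by blast
  then obtain e where "e \<in> C" "e \<in> E - S" using cycle_basic(1)[OF C(1)] by blast
  then show ?thesis using C(3) unfolding vertex_set_def by blast
qed

lemma frame_edge_in:
  assumes f: "frame x y u v S" and e: "e \<in> E" "w \<in> ends G e" "w \<in> V - {x, y, u, v}"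
  shows "e \<in> S"
proof (rule ccontr)
  assume "e \<notin> S"
  then show False using frameD(10)[OF f, of e] e by auto
qed

text \<open>A path through \<open>T\<close> closes with \<open>e\<close> to a cycle whose only edge
  outside the maximal \<open>S\<close> is \<open>e\<close>. It is therefore unbalanced, and the
  vertices it misses are pairwise adjacent.\<close>

lemma frame_clique:
  assumes f: "frame x y u v S" and e: "e \<in> E - S" "ends G e = {x, u}"
    and T: "conn adj T" "T \<subseteq> V - {x, y, u, v}" "a \<in> T" "adj x a" "b \<in> T" "adj u b"
    and pq: "p \<in> V - {x, u} - T" "q \<in> V - {x, u} - T" "p \<noteq> q"
  shows "adj p q"
proof -
  note f' = frameD[OF f]
  have TV: "T \<subseteq> V" using T by auto
  obtain P W where P: "simple_path G a b P W" "P \<subseteq> {e \<in> E. ends G e \<subseteq> T}" "W \<subseteq> T"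
    by (rule conn_path[OF T(1,3,5) TV])
  obtain g where g: "g \<in> E" "ends G g = {x, a}" using T(4) unfolding adj_iff by blast
  obtain h where h: "h \<in> E" "ends G h = {u, b}" using T(6) unfolding adj_iff by blast
  have "x \<notin> W" "u \<notin> W" "x \<noteq> u" using P(3) T(2) f'(5) by auto
  have xP: "simple_path G x b (insert g P) (insert x W)"
    by (rule simple_path.step[OF P(1) g f'(1) \<open>x \<notin> W\<close>])
  have "simple_path G u x (insert h (insert g P)) (insert u (insert x W))"
    by (rule simple_path.step[OF simple_path_rev[OF xP] h f'(3)]) (use \<open>u \<notin> W\<close> \<open>x \<noteq> u\<close> in auto)
  then have sp: "simple_path G x u (insert h (insert g P)) (insert u (insert x W))" by (rule simple_path_rev)
  have gS: "g \<in> S" by (rule frame_edge_in[OF f g(1), of a]) (use g T in auto)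
  have hS: "h \<in> S" by (rule frame_edge_in[OF f h(1), of b]) (use h T in auto)
  have PS: "P \<subseteq> S"
  proof
    fix k assume k: "k \<in> P"
    then obtain c where "c \<in> ends G k" using simple_path_edge_ends[OF P(1)] by blast
    then show "k \<in> S" using frame_edge_in[OF f, of k c] k P(2) T(2) by blast
  qed
  have sub: "insert h (insert g P) \<subseteq> S" using gS hS PS by auto
  define C where "C = insert e (insert h (insert g P))"
  have C: "cycle C" unfolding C_def
    by (rule is_cycle_pathI[OF sp \<open>x \<noteq> u\<close>]) (use e sub in auto)
  have VC: "VS C = insert u (insert x W)" unfolding C_def
    by (rule cycle_vertex_set[OF sp \<open>x \<noteq> u\<close> e(2)])
  have "C \<notin> \<B>"
    by (rule max_balanced_unbalanced[OF f'(9) e(1) C]) (use sub C_def in auto)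
  then show ?thesis using unbalanced_complement_clique[OF C _ _ _ pq(3)] pq P(3) unfolding VC by blast
qed

lemma frame_nbrs:
  assumes f: "frame x y u v S"
  shows "nbrs x y u v x \<noteq> {}" "nbrs x y u v x = {w} \<Longrightarrow> adj x u \<and> adj x v"
proof -
  note f' = frameD[OF f]
  have sub: "{t \<in> V. adj x t} \<subseteq> nbrs x y u v x \<union> {t \<in> {u, v}. adj x t}"
    using f'(6) unfolding nbrs_def by (auto simp: adj_iff)
  have fin: "finite (nbrs x y u v x)" unfolding nbrs_def using finite_verts by simp
  have "card {t \<in> V. adj x t} \<le> card (nbrs x y u v x \<union> {t \<in> {u, v}. adj x t})"
    using sub fin by (intro card_mono) auto
  also have "\<dots> \<le> card (nbrs x y u v x) + card {t \<in> {u, v}. adj x t}" by (rule card_Un_le)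
  finally have c: "3 \<le> card (nbrs x y u v x) + card {t \<in> {u, v}. adj x t}"
    using graph.degree_ge_3[OF f'(1)] by simp
  have c2: "card {u, v} \<le> 2" by (simp add: card_insert_if)
  have "card {t \<in> {u, v}. adj x t} \<le> card {u, v}" by (intro card_mono) auto
  then show "nbrs x y u v x \<noteq> {}" using c c2 by auto
  assume "nbrs x y u v x = {w}"
  then have "2 \<le> card {t \<in> {u, v}. adj x t}" using c by simp
  show "adj x u \<and> adj x v"
  proof (rule ccontr)
    assume "\<not> ?thesis"
    then have "{t \<in> {u, v}. adj x t} \<subseteq> {if adj x u then u else v}" by auto
    then have "card {t \<in> {u, v}. adj x t} \<le> card {if adj x u then u else v}" by (intro card_mono) auto
    then show False using \<open>2 \<le> _\<close> by simp
  qed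
qed

text \<open>If \<open>w\<close> is not a cut vertex of the middle part, then some outer vertex hangs on \<open>w\<close> alone in
  \<open>(V, S)\<close>, since otherwise the star of \<open>w\<close> could be separated.\<close>

lemma frame_noncut:
  assumes f: "frame x y u v S" and w: "w \<in> V - {x, y, u, v}" "conn adj (V - {x, y, u, v} - {w})"
    and ne: "V - {x, y, u, v} - {w} \<noteq> {}"
  obtains s where "s \<in> {x, y, u, v}" "nbrs x y u v s = {w}"
    "\<And>q. q \<in> {x, y, u, v} \<Longrightarrow> eadj G S s q \<Longrightarrow> nbrs x y u v q = {w}"
proof -
  note f' = frameD[OF f]
  define D where "D = V - {x, y, u, v} - {w}"
  obtain d where d: "d \<in> D" using ne D_def by blast
  \<comment> \<open>\<open>d\<close> stands for the middle part without \<open>w\<close>, which is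
    connected by edges of \<open>S\<close>.\<close>
  define link where "link s = reach (eadj G S) (V - {w}) s d" for s
  have symS: "symp (eadj G S)" by (rule sympI) (rule eadj_sym)
  have inS: "e \<in> S" if e: "e \<in> E" "ends G e \<subseteq> D" for e
  proof -
    obtain a b where "ends G e = {a, b}" by (rule edge_ends[OF e(1)])
    then show ?thesis using frame_edge_in[OF f e(1), of a] e(2) unfolding D_def by auto
  qed
  have DD: "link a" if "a \<in> D" for a unfolding link_def
    by (rule reach_in_edge_set[OF w(2)[folded D_def] inS that d]) (auto simp: D_def)
  have step: "link s" if "eadj G S s t" "link t" "s \<in> V - {w}" "t \<in> V - {w}" for s t
    using reach_trans[OF reach_step[OF that(3,4), where R = "eadj G S"]] that(1,2) unfolding link_def by blast
  \<comment> \<open>If all neighbours of \<open>w\<close> were linked, the star of \<open>w\<close>,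
    which lies in \<open>S\<close>, could be separated.\<close>
  have "\<exists>s. adj w s \<and> \<not> link s"
  proof (rule ccontr)
    assume "\<nexists>s. adj w s \<and> \<not> link s"
    then have all: "reach (eadj G S) (V - {w}) a b" if "adj w a" "adj w b" for a b
      using that reach_trans reach_sym[OF symS] unfolding link_def by metis
    obtain c where c: "adj w c" using ex_adj w by blast
    have "x \<noteq> y" using f'(5) by simp
    obtain e where e: "e \<in> E - S" by (rule max_balanced_proper[OF f'(9,1,2) \<open>x \<noteq> y\<close> f'(6)])
    show False
      by (rule max_balanced_star_separation[OF f'(9) e _ c all]) (use frame_edge_in[OF f _ _ w(1)] in auto)
  qed
  then obtain s where s: "adj w s" "\<not> link s" by blast
  have sV: "s \<in> V - {w}" using s adj_verts unfolding adj_iff by blast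
  have sp: "s \<in> {x, y, u, v}" using DD[of s] s sV D_def by auto
  have ne: "nbrs x y u v q \<noteq> {}" if "q \<in> {x, y, u, v}" for q
    using that frame_nbrs(1)[OF f] frame_nbrs(1)[OF frame_sym(1)[OF f]] frame_nbrs(1)[OF frame_sym(2)[OF f]]
      frame_nbrs(1)[OF frame_sym(2)[OF frame_sym(1)[OF f]]]
    by (auto simp: nbrs_sym(1)[of u v x y] nbrs_sym(1)[of v u x y] nbrs_sym(2)[of y x u v] nbrs_sym(3)[of x y v u])
  \<comment> \<open>Edges from an outer vertex to \<open>D\<close> lie in \<open>S\<close>, so an
    unlinked one has no middle neighbour except \<open>w\<close>.\<close>
  have unlinked: "nbrs x y u v q = {w}" if q: "q \<in> {x, y, u, v}" "\<not> link q" for q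
  proof -
    have qV: "q \<in> V - {w}" using q f'(1-4) w by auto
    have "t = w" if t: "t \<in> nbrs x y u v q" for t
    proof (rule ccontr)
      assume "t \<noteq> w"
      then have tD: "t \<in> D" using t unfolding nbrs_def D_def by auto
      obtain e where e: "e \<in> E" "ends G e = {q, t}" "q \<noteq> t" using t unfolding nbrs_def adj_iff by blast
      have "e \<in> S" by (rule frame_edge_in[OF f e(1), of t]) (use e tD D_def in auto)
      then have "eadj G S q t" using e unfolding eadj_def by blast
      then show False using step[OF _ DD[OF tD] qV] tD q D_def by auto
    qed
    then show ?thesis using ne[OF q(1)] by blast
  qed
  show ?thesis
  proof (rule that[OF sp unlinked[OF sp s(2)]])
    fix q assume q: "q \<in> {x, y, u, v}" "eadj G S s q"
    then have "\<not> link q" using step[of s q] s sV f'(1-4) w by auto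
    then show "nbrs x y u v q = {w}" by (rule unlinked[OF q(1)])
  qed
qed

text \<open>As \<open>V0\<close> is a minimal connected set containing \<open>w1\<close> and
  \<open>w2\<close>, the vertex \<open>w3\<close> has at most two neighbours inside it, and none
  outside.\<close>

lemma frame_inner_vertex:
  assumes f: "frame x y u v S" and V0: "V0 = V - {x, y, u, v}" and w: "w1 \<in> V0" "w2 \<in> V0" "w3 \<in> V0"
    and min: "\<And>T. T \<subseteq> V0 \<Longrightarrow> conn adj T \<Longrightarrow> w1 \<in> T \<Longrightarrow> w2 \<in> T \<Longrightarrow> T = V0"
    and n: "\<not> adj w3 x" "\<not> adj w3 y" "\<not> adj w3 u" "\<not> adj w3 v"
  shows False
proof -
  have "card {s \<in> V0. adj w3 s} \<le> 2"
    using minimal_connector_degree[of adj V0 w1 w2 w3] graph.symp_R graph.irrefl_R frameD(8)[OF f] w V0 min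
    by auto
  moreover have "{s \<in> V. adj w3 s} = {s \<in> V0. adj w3 s}" using n V0 by auto
  moreover have "w3 \<in> V" using w V0 by auto
  ultimately show False using graph.degree_ge_3[of w3] by simp
qed

text \<open>In each of the three configurations below, some path through the middle part misses two
  non-adjacent vertices, or the middle part is a path with an inner vertex of degree two.\<close>

lemma frame_pendant_pair:
  assumes f: "frame x y u v S" and V0: "V0 = V - {x, y, u, v}"
    and w: "w1 \<in> V0" "w2 \<in> V0" "w3 \<in> V0" "w1 \<noteq> w2" "w3 \<noteq> w1" "w3 \<noteq> w2"
    and c2: "conn adj (V0 - {w2})"
    and N: "nbrs x y u v x = {w1}" "nbrs x y u v u = {w1}" "nbrs x y u v t = {w2}" "t \<in> {x, y, u, v}"
  shows False
proof -
  note f' = frameD[OF f]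
  note d = frame_distinct[OF f]
  have Nx: "adj x s \<longleftrightarrow> s = w1" "adj u s \<longleftrightarrow> s = w1" "adj t s \<longleftrightarrow> s = w2" if "s \<in> V0" for s
    using N that unfolding nbrs_def V0 by auto
  have t: "t = y \<or> t = v" using N w by auto
  have tV: "t \<in> V - V0" using N(4) f' V0 by auto
  have c1: "conn adj {w1}" by (rule conn_singleton)
  \<comment> \<open>The cycle on \<open>x\<close>, \<open>w1\<close>, \<open>u\<close> would miss
    \<open>t\<close> and \<open>w3\<close>, which are not adjacent.\<close>
  have no: "ends G e \<noteq> {x, u}" if e: "e \<in> E - S" for e
  proof
    assume eq: "ends G e = {x, u}"
    have "adj t w3"
      by (rule frame_clique[OF f e eq c1, where a = w1 and b = w1]) (use V0 w Nx t tV d f'(1-4) in auto)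
    then show False using Nx(3) w by blast
  qed
  \<comment> \<open>Some edge outside \<open>S\<close> avoids \<open>y\<close> and some avoids
    \<open>v\<close>. Neither joins \<open>x\<close> to \<open>u\<close>, so they join
    \<open>x\<close> to \<open>v\<close> and \<open>y\<close> to \<open>u\<close>.\<close>
  obtain e1 where e1: "e1 \<in> E - S" "ends G e1 = {x, v}"
  proof -
    have fy: "frame y x u v S" using f by (rule frame_sym)
    obtain e where e: "e \<in> E - S" "y \<notin> ends G e" using frame_edge_avoiding[OF fy] by blast
    then show ?thesis using f'(10)[OF e(1)] no[OF e(1)] that by auto
  qed
  obtain e2 where e2: "e2 \<in> E - S" "ends G e2 = {y, u}"
  proof -
    have fv: "frame v u x y S" by (rule frame_sym(1)[OF frame_sym(3)[OF f]])
    obtain e where e: "e \<in> E - S" "v \<notin> ends G e" using frame_edge_avoiding[OF fv] by blast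
    then show ?thesis using f'(10)[OF e(1)] no[OF e(1)] that by auto
  qed
  have fv: "frame x y v u S" by (rule frame_sym(3)[OF f])
  have fu: "frame y x u v S" by (rule frame_sym(2)[OF f])
  \<comment> \<open>Closing a path through \<open>T\<close> by \<open>e1\<close> gives a cycle
    missing \<open>u\<close> and every middle vertex outside \<open>T\<close>, but the only middle
    neighbour of \<open>u\<close> is \<open>w1\<close>.\<close>
  have all_v: "T = V0" if T: "conn adj T" "T \<subseteq> V0" "w1 \<in> T" "b \<in> T" "adj v b" for T b
  proof (rule ccontr)
    assume "T \<noteq> V0"
    then obtain z where z: "z \<in> V0" "z \<notin> T" using T by blast
    have "adj u z"
      by (rule frame_clique[OF fv e1 T(1) _ T(3) _ T(4,5)]) (use T V0 z w Nx d f'(1-4) in auto)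
    then show False using Nx(2)[OF z(1)] z T by blast
  qed
  have all_y: "T = V0" if T: "conn adj T" "T \<subseteq> V0" "w1 \<in> T" "b \<in> T" "adj y b" for T b
  proof (rule ccontr)
    assume "T \<noteq> V0"
    then obtain z where z: "z \<in> V0" "z \<notin> T" using T by blast
    have "adj x z"
      by (rule frame_clique[OF fu e2 T(1) _ T(4,5) T(3)]) (use T V0 z w Nx d f'(1-4) in auto)
    then show False using Nx(1)[OF z(1)] z T by blast
  qed
  have min: "T = V0" if T: "T \<subseteq> V0" "conn adj T" "w1 \<in> T" "w2 \<in> T" for T
  proof -
    have "adj t w2" using Nx(3) w by blast
    then show ?thesis using t all_v[OF T(2,1,3,4)] all_y[OF T(2,1,3,4)] by blast
  qed
  have "\<not> adj w3 x" "\<not> adj w3 u" using Nx w adj_sym by blast+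
  moreover have "w1 \<in> V0 - {w2}" "w3 \<in> V0 - {w2}" "V0 - {w2} \<subseteq> V0" "V0 - {w2} \<noteq> V0" using w by auto
  then have "\<not> adj w3 v" "\<not> adj w3 y"
    using all_v[OF c2, of w3] all_y[OF c2, of w3] adj_sym by blast+
  ultimately show False using frame_inner_vertex[OF f V0 w(1,2,3) min] by blast
qed

text \<open>Cycles on \<open>y\<close>, \<open>w2\<close> and \<open>u\<close> or \<open>v\<close>
  would miss \<open>x\<close> and \<open>w3\<close>, so neither \<open>u\<close> nor
  \<open>v\<close> is adjacent to \<open>w2\<close>. But a cycle through \<open>e1\<close> and
  \<open>V0 - {w2}\<close> misses \<open>v\<close> and \<open>w2\<close>.\<close>

lemma frame_pendant_same_side:
  assumes f: "frame x y u v S" and V0: "V0 = V - {x, y, u, v}"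
    and w: "w1 \<in> V0" "w2 \<in> V0" "w3 \<in> V0" "w1 \<noteq> w2" "w3 \<noteq> w1" "w3 \<noteq> w2"
    and c2: "conn adj (V0 - {w2})"
    and N: "nbrs x y u v x = {w1}" "nbrs x y u v y = {w2}"
    and e: "e1 \<in> E - S" "ends G e1 = {x, u}" "e2 \<in> E - S" "ends G e2 = {y, u}" "e3 \<in> E - S" "ends G e3 = {y, v}"
  shows False
proof -
  note f' = frameD[OF f]
  note d = frame_distinct[OF f]
  have Nx: "adj x s \<longleftrightarrow> s = w1" "adj y s \<longleftrightarrow> s = w2" if "s \<in> V0" for s
    using N that unfolding nbrs_def V0 by auto
  have sub: "{w2} \<subseteq> V0" using w by auto
  have fyu: "frame y x u v S" by (rule frame_sym(2)[OF f])
  have fyv: "frame y x v u S" by (rule frame_sym(3)[OF fyu])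
  have nv: "\<not> adj v w2"
  proof
    assume a: "adj v w2"
    have "adj x w3"
      by (rule frame_clique[OF fyv e(5,6) conn_singleton[of adj w2] _ _ _ _ a, where a = w2]) (use V0 w Nx d f'(1-4) in auto)
    then show False using Nx(1) w by blast
  qed
  have nu: "\<not> adj u w2"
  proof
    assume a: "adj u w2"
    have "adj x w3"
      by (rule frame_clique[OF fyu e(3,4) conn_singleton[of adj w2] _ _ _ _ a, where a = w2]) (use V0 w Nx d f'(1-4) in auto)
    then show False using Nx(1) w by blast
  qed
  have "nbrs u v x y u \<noteq> {}" by (rule frame_nbrs(1)[OF frame_sym(1)[OF f]])
  then obtain b where b: "b \<in> V0" "adj u b" unfolding nbrs_def V0 by auto
  have "b \<noteq> w2" using b nu by auto
  have "adj v w2"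
    by (rule frame_clique[OF f e(1,2) c2 _ _ _ _ b(2), of w1]) (use V0 w b \<open>b \<noteq> w2\<close> Nx d f'(1-4) in auto)
  then show False using nv by blast
qed

text \<open>A cycle on \<open>y\<close>, \<open>w2\<close>, \<open>u\<close> would miss
  \<open>x\<close> and \<open>w3\<close>. If \<open>v\<close> had another middle neighbour,
  \<open>e2\<close> and a path through \<open>V0 - {w2}\<close> would form a cycle missing the
  non-adjacent \<open>y\<close> and \<open>w2\<close>.\<close>

lemma frame_pendant_opposite_half:
  assumes f: "frame x y u v S" and V0: "V0 = V - {x, y, u, v}"
    and w: "w1 \<in> V0" "w2 \<in> V0" "w3 \<in> V0" "w1 \<noteq> w2" "w3 \<noteq> w1" "w3 \<noteq> w2"
    and c2: "conn adj (V0 - {w2})"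
    and N: "nbrs x y u v x = {w1}" "nbrs x y u v u = {w2}"
    and e: "e2 \<in> E - S" "ends G e2 = {x, v}" "e3 \<in> E - S" "ends G e3 = {y, u}"
  shows "\<not> adj y w2" "b \<in> V0 \<Longrightarrow> adj v b \<Longrightarrow> b = w2"
proof -
  note f' = frameD[OF f]
  note d = frame_distinct[OF f]
  have Nx: "adj x s \<longleftrightarrow> s = w1" "adj u s \<longleftrightarrow> s = w2" if "s \<in> V0" for s
    using N that unfolding nbrs_def V0 by auto
  have fyu: "frame y x u v S" by (rule frame_sym(2)[OF f])
  have fxv: "frame x y v u S" by (rule frame_sym(3)[OF f])
  show ny: "\<not> adj y w2"
  proof
    assume a: "adj y w2"
    have "adj x w3"
      by (rule frame_clique[OF fyu e(3,4) conn_singleton[of adj w2] _ _ a, where b = w2]) (use V0 w Nx d f'(1-4) in auto)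
    then show False using Nx(1) w by blast
  qed
  assume b: "b \<in> V0" "adj v b"
  show "b = w2"
  proof (rule ccontr)
    assume "b \<noteq> w2"
    have "adj y w2"
      by (rule frame_clique[OF fxv e(1,2) c2 _ _ _ _ b(2), of w1]) (use V0 w b \<open>b \<noteq> w2\<close> Nx d f'(1-4) in auto)
    then show False using ny by blast
  qed
qed

text \<open>By the previous lemma and its mirror image, \<open>v\<close> hangs on \<open>w2\<close>
  and \<open>y\<close> on \<open>w1\<close>. A cycle through \<open>e2\<close> and a connected
  \<open>T\<close> containing \<open>w1\<close> and \<open>w2\<close> misses \<open>u\<close>, which
  sees only \<open>w2\<close>, so \<open>T\<close> is all of \<open>V0\<close> and \<open>w3\<close>
  has too few neighbours.\<close>

lemma frame_pendant_opposite:
  assumes f: "frame x y u v S" and V0: "V0 = V - {x, y, u, v}"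
    and w: "w1 \<in> V0" "w2 \<in> V0" "w3 \<in> V0" "w1 \<noteq> w2" "w3 \<noteq> w1" "w3 \<noteq> w2"
    and c: "conn adj (V0 - {w1})" "conn adj (V0 - {w2})"
    and N: "nbrs x y u v x = {w1}" "nbrs x y u v u = {w2}"
    and e: "e2 \<in> E - S" "ends G e2 = {x, v}" "e3 \<in> E - S" "ends G e3 = {y, u}"
  shows False
proof -
  note f' = frameD[OF f]
  note d = frame_distinct[OF f]
  have Nx: "adj x s \<longleftrightarrow> s = w1" "adj u s \<longleftrightarrow> s = w2" if "s \<in> V0" for s
    using N that unfolding nbrs_def V0 by auto
  note h1 = frame_pendant_opposite_half[OF f V0 w c(2) N e]
  have V0': "V0 = V - {u, v, x, y}" using V0 by auto
  have e': "ends G e3 = {u, y}" "ends G e2 = {v, x}" using e by auto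
  note h2 = frame_pendant_opposite_half[OF frame_sym(1)[OF f] V0' w(2,1,3) w(4)[symmetric] w(6,5) c(1)
      N(2)[folded nbrs_sym(1)] N(1)[folded nbrs_sym(1)] e(3) e'(1) e(1) e'(2)]
  have "nbrs v u x y v \<noteq> {}" by (rule frame_nbrs(1)[OF frame_sym(1)[OF frame_sym(3)[OF f]]])
  then obtain b where "b \<in> V0" "adj v b" unfolding nbrs_def V0 by auto
  then have vw: "adj v w2" using h1(2) by blast
  have "T = V0" if T: "T \<subseteq> V0" "conn adj T" "w1 \<in> T" "w2 \<in> T" for T
  proof (rule ccontr)
    assume "T \<noteq> V0"
    then obtain z where z: "z \<in> V0" "z \<notin> T" using T by blast
    have "adj u z"
      by (rule frame_clique[OF frame_sym(3)[OF f] e(1,2) T(2) _ T(3) _ T(4) vw])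
        (use T V0 z w Nx d f'(1-4) in auto)
    then show False using Nx(2)[OF z(1)] z T by blast
  qed
  moreover have "\<not> adj w3 x" "\<not> adj w3 u" "\<not> adj w3 v" "\<not> adj w3 y"
    using Nx w adj_sym h1(2)[of w3] h2(2)[of w3] by blast+
  ultimately show False using frame_inner_vertex[OF f V0 w(1,2,3)] by blast
qed

text \<open>In \<open>(V, S)\<close>, the vertex \<open>w\<close> separates \<open>s\<close> from the rest of the middle part.\<close>

definition pendant :: "'v \<Rightarrow> 'v \<Rightarrow> 'v \<Rightarrow> 'v \<Rightarrow> 'e set \<Rightarrow> 'v \<Rightarrow> 'v \<Rightarrow> bool" where
  "pendant x y u v S w s \<longleftrightarrow> s \<in> {x, y, u, v} \<and> nbrs x y u v s = {w} \<and>
     (\<forall>q\<in>{x, y, u, v}. eadj G S s q \<longrightarrow> nbrs x y u v q = {w})"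

section \<open>Two pendant vertices exclude a frame\<close>

lemma pendant_sym:
  assumes "pendant x y u v S w s"
  shows "pendant u v x y S w s" "pendant y x u v S w s" "pendant x y v u S w s"
proof -
  note eq = four_set_sym[where x = x and y = y and u = u and v = v]
  show "pendant u v x y S w s" "pendant y x u v S w s" "pendant x y v u S w s"
    using assms unfolding pendant_def eq nbrs_sym(1)[of u v x y] nbrs_sym(2)[of y x u v] nbrs_sym(3)[of x y v u]
    by simp_all
qed

text \<open>With only one middle neighbour, \<open>x\<close> needs both \<open>u\<close> and
  \<open>v\<close>. Were an edge to \<open>u\<close> in \<open>S\<close>, then \<open>u\<close>
  would hang on \<open>w\<close> as well.\<close>

lemma pendant_unbalancing_edge:
  assumes f: "frame x y u v S" and p: "pendant x y u v S w x" and nu: "nbrs x y u v u \<noteq> {w}"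
  obtains e where "e \<in> E - S" "ends G e = {x, u}"
proof -
  have "adj x u" using frame_nbrs(2)[OF f] p unfolding pendant_def by blast
  moreover have "\<not> eadj G S x u" using p nu unfolding pendant_def by blast
  ultimately show ?thesis using that unfolding adj_iff eadj_def by blast
qed

text \<open>\<open>frame_pendant_pair\<close> excludes that \<open>u\<close> or \<open>v\<close>
  hangs on \<open>w1\<close>, so edges from \<open>x\<close> to both lie outside \<open>S\<close>.
  The position of \<open>s\<close> then selects the same-side or the opposite configuration.\<close>

lemma frame_False_pendants:
  assumes f: "frame x y u v S" and V0: "V0 = V - {x, y, u, v}"
    and w: "w1 \<in> V0" "w2 \<in> V0" "w3 \<in> V0" "w1 \<noteq> w2" "w3 \<noteq> w1" "w3 \<noteq> w2"
    and c: "conn adj (V0 - {w1})" "conn adj (V0 - {w2})"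
    and p: "pendant x y u v S w1 x" "pendant x y u v S w2 s"
  shows False
proof -
  note sy = nbrs_sym(1)[of u v x y] nbrs_sym(2)[of y x u v] nbrs_sym(3)[of x y v u]
  have N: "nbrs x y u v x = {w1}" "nbrs x y u v s = {w2}" "s \<in> {x, y, u, v}" using p unfolding pendant_def by auto
  have V0': "V0 = V - {x, y, v, u}" "V0 = V - {y, x, u, v}" "V0 = V - {y, x, v, u}" "V0 = V - {u, v, x, y}"
     "V0 = V - {u, v, y, x}" "V0 = V - {v, u, x, y}" "V0 = V - {v, u, y, x}" using V0 by auto
  have nu: "nbrs x y u v u \<noteq> {w1}"
    using frame_pendant_pair[OF f V0 w c(2) N(1) _ N(2,3)] by blast
  have nv: "nbrs x y u v v \<noteq> {w1}"
    using frame_pendant_pair[OF frame_sym(3)[OF f] V0'(1) w c(2), of s] N unfolding sy by auto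
  obtain e1 where e1: "e1 \<in> E - S" "ends G e1 = {x, u}" by (rule pendant_unbalancing_edge[OF f p(1) nu])
  obtain e2 where e2: "e2 \<in> E - S" "ends G e2 = {x, v}"
    by (rule pendant_unbalancing_edge[OF frame_sym(3)[OF f] pendant_sym(3)[OF p(1)]]) (use nv sy in auto)
  have "s \<noteq> x" using N w by auto
  then consider "s = y" | "s = u" | "s = v" using N(3) by auto
  then show False
  proof cases
    case 1
    have fy: "frame y x u v S" by (rule frame_sym(2)[OF f])
    have py: "pendant y x u v S w2 y" using pendant_sym(2)[OF p(2)] 1 by simp
    have nu2: "nbrs x y u v u \<noteq> {w2}"
      using frame_pendant_pair[OF fy V0'(2) w(2,1,3) w(4)[symmetric] w(6,5) c(1), of x] N 1 unfolding sy by auto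
    have nv2: "nbrs x y u v v \<noteq> {w2}"
      using frame_pendant_pair[OF frame_sym(3)[OF fy] V0'(3) w(2,1,3) w(4)[symmetric] w(6,5) c(1), of x] N 1
      unfolding nbrs_sym(3)[of y x v u] sy by auto
    obtain g1 where g1: "g1 \<in> E - S" "ends G g1 = {y, u}"
      by (rule pendant_unbalancing_edge[OF fy py]) (use nu2 sy in auto)
    obtain g2 where g2: "g2 \<in> E - S" "ends G g2 = {y, v}"
      by (rule pendant_unbalancing_edge[OF frame_sym(3)[OF fy] pendant_sym(3)[OF py]])
        (use nv2 sy nbrs_sym(3)[of y x v u] in auto)
    show False by (rule frame_pendant_same_side[OF f V0 w c(2) N(1) _ e1 g1 g2]) (use N 1 in auto)
  next
    case 2
    have fu: "frame u v y x S" by (rule frame_sym(3)[OF frame_sym(1)[OF f]])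
    have pu: "pendant u v y x S w2 u" using pendant_sym(3)[OF pendant_sym(1)[OF p(2)]] 2 by simp
    have ny: "nbrs x y u v y \<noteq> {w2}"
      using frame_pendant_pair[OF fu V0'(5) w(2,1,3) w(4)[symmetric] w(6,5) c(1), of x] N 2
      unfolding nbrs_sym(3)[of u v y x] sy by auto
    obtain g where g: "g \<in> E - S" "ends G g = {u, y}"
      by (rule pendant_unbalancing_edge[OF fu pu]) (use ny sy nbrs_sym(3)[of u v y x] in auto)
    show False by (rule frame_pendant_opposite[OF f V0 w c N(1) _ e2 g(1)]) (use N 2 g in auto)
  next
    case 3
    have fv': "frame x y v u S" by (rule frame_sym(3)[OF f])
    have fv: "frame v u y x S" by (rule frame_sym(3)[OF frame_sym(1)[OF fv']])
    have pv: "pendant v u y x S w2 v" using pendant_sym(3)[OF pendant_sym(1)[OF pendant_sym(3)[OF p(2)]]] 3 by simp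
    have eq: "nbrs v u y x = nbrs x y u v"
      by (rule ext) (simp only: nbrs_sym(3)[of v u y x] nbrs_sym(1)[of v u x y] nbrs_sym(3)[of x y v u])
    have ny: "nbrs x y u v y \<noteq> {w2}"
      using frame_pendant_pair[OF fv V0'(7) w(2,1,3) w(4)[symmetric] w(6,5) c(1), of x] N 3
      unfolding eq by auto
    obtain g where g: "g \<in> E - S" "ends G g = {v, y}"
      by (rule pendant_unbalancing_edge[OF fv pv]) (use ny eq in auto)
    show False by (rule frame_pendant_opposite[OF fv' V0'(1) w c _ _ e1 g(1)]) (use N 3 g sy in auto)
  qed
qed

text \<open>The middle part has at least three vertices: two non-cut vertices, each with a pendant
  vertex by \<open>frame_noncut\<close>, and a third one \<open>w3\<close>. Symmetry moves the first
  pendant vertex to \<open>x\<close>.\<close>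

lemma frame_False: "\<not> frame x y u v S"
proof
  assume f: "frame x y u v S"
  note f' = frameD[OF f]
  define V0 where "V0 = V - {x, y, u, v}"
  have fin: "finite V0" using finite_verts V0_def by simp
  have "card V \<le> card (V0 \<union> {x, y, u, v})" using fin V0_def by (intro card_mono) auto
  also have "\<dots> \<le> card V0 + card {x, y, u, v}" by (rule card_Un_le)
  also have "card {x, y, u, v} \<le> 4" by (simp add: card_insert_if)
  finally have "\<not> card V0 \<le> 2" using card_verts by simp
  then obtain z1 z2 z3 where z: "z1 \<in> V0" "z2 \<in> V0" "z3 \<in> V0" "z1 \<noteq> z2" "z1 \<noteq> z3" "z2 \<noteq> z3"
    by (rule card_ge_3)
  have cV0: "conn adj V0" using f'(8) V0_def by simp
  have "{z1} \<subset> V0" using z by auto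
  from conn_grow[OF graph.symp_R fin cV0 conn_singleton this]
  obtain w1 where w1: "w1 \<in> V0" "conn adj (V0 - {w1})" by auto
  \<comment> \<open>Growing from \<open>w1\<close> keeps it in the connected set, so the second
    non-cut vertex differs from it.\<close>
  have "{w1} \<subset> V0" using z w1 by auto
  from conn_grow[OF graph.symp_R fin cV0 conn_singleton this]
  obtain w2 where w2: "w2 \<in> V0" "w1 \<noteq> w2" "conn adj (V0 - {w2})" by auto
  obtain w3 where w3: "w3 \<in> V0" "w3 \<noteq> w1" "w3 \<noteq> w2" using z by metis
  have pend: "\<exists>s. pendant x y u v S w s" if "w \<in> V0" "conn adj (V0 - {w})" for w
  proof -
    have "V0 - {w} \<noteq> {}" using z by auto
    then show ?thesis using frame_noncut[OF f that[unfolded V0_def]] unfolding pendant_def V0_def by metis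
  qed
  obtain s1 where s1: "pendant x y u v S w1 s1" using pend w1 by blast
  obtain s2 where s2: "pendant x y u v S w2 s2" using pend w2 by blast
  have V0': "V0 = V - {x, y, u, v}" "V0 = V - {y, x, u, v}" "V0 = V - {u, v, x, y}"
     "V0 = V - {v, u, x, y}" unfolding V0_def by auto
  note ww = w1(1) w2(1) w3(1) w2(2) w3(2,3) w1(2) w2(3)
  have "s1 \<in> {x, y, u, v}" using s1 unfolding pendant_def by blast
  then consider "s1 = x" | "s1 = y" | "s1 = u" | "s1 = v" by auto
  then show False
  proof cases
    case 1
    show False by (rule frame_False_pendants[OF f V0'(1) ww s1[unfolded 1] s2])
  next
    case 2
    show False
      by (rule frame_False_pendants[OF frame_sym(2)[OF f] V0'(2) ww pendant_sym(2)[OF s1[unfolded 2]] pendant_sym(2)[OF s2]])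
  next
    case 3
    show False
      by (rule frame_False_pendants[OF frame_sym(1)[OF f] V0'(3) ww pendant_sym(1)[OF s1[unfolded 3]] pendant_sym(1)[OF s2]])
  next
    case 4
    show False
      by (rule frame_False_pendants[OF frame_sym(1)[OF frame_sym(3)[OF f]] V0'(4) ww
            pendant_sym(1)[OF pendant_sym(3)[OF s1[unfolded 4]]] pendant_sym(1)[OF pendant_sym(3)[OF s2]]])
  qed
qed

lemma nonedges_meet: "\<not> graph.nonedge_pair x y u v"
proof
  assume "graph.nonedge_pair x y u v"
  then obtain x' y' u' v' where "graph.nonedge_pair x' y' u' v'" "conn adj (V - {x', y', u', v'})"
    by (rule graph.connected_complement_of_nonedges)
  then obtain S where "frame x' y' u' v' S" by (rule frame_exists)
  then show False using frame_False by blast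
qed

end

section \<open>The simplification\<close>

context unbreakable_3_connected
begin

definition nonadj :: "'v \<Rightarrow> 'v \<Rightarrow> bool" where
  "nonadj x y \<longleftrightarrow> x \<in> V \<and> y \<in> V \<and> x \<noteq> y \<and> \<not> adj x y"

lemma nonadj_sym: "nonadj x y \<Longrightarrow> nonadj y x"
  unfolding nonadj_def using adj_sym by blast

lemma nonadj_meet:
  assumes "nonadj x y" "nonadj a b"
  shows "a = x \<or> a = y \<or> b = x \<or> b = y"
  using nonedges_meet[of x y a b] assms unfolding nonadj_def graph.nonedge_pair_def by auto

text \<open>Every other non-adjacent pair contains \<open>x\<close> or \<open>y\<close>, so what
  remains is a clique.\<close>

lemma conn_minus_nonadj:
  assumes "nonadj x y"
  shows "conn adj (V - {x, y, z})"
  unfolding conn_def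
proof (intro ballI)
  fix a b assume ab: "a \<in> V - {x, y, z}" "b \<in> V - {x, y, z}"
  show "reach adj (V - {x, y, z}) a b"
  proof (cases "a = b")
    case True
    then show ?thesis by (simp add: reach_refl)
  next
    case False
    then have "adj a b" using nonadj_meet[OF assms, of a b] ab unfolding nonadj_def by blast
    then show ?thesis using reach_step ab by metis
  qed
qed

text \<open>Pairs that pairwise meet form a star or a triangle. \<open>no_nonadjacent_triple\<close>
  excludes the triangle, and \<open>no_three_nonneighbours\<close> a third ray of the star.\<close>

lemma nonadj_two:
  assumes xy: "nonadj x y" and xz: "nonadj x z" and "y \<noteq> z" and ab: "nonadj a b"
  shows "{a, b} = {x, y} \<or> {a, b} = {x, z}"
proof -
  have yz: "\<not> nonadj y z"
    using no_nonadjacent_triple[of x y z] conn_minus_nonadj[OF xy, of z] xy xz \<open>y \<noteq> z\<close>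
    unfolding nonadj_def by blast
  have t: "t = y \<or> t = z" if "nonadj x t" for t
    using no_three_nonneighbours[of x y z t] conn_minus_nonadj[OF xy, of z] conn_minus_nonadj[OF xy, of t]
      xy xz \<open>y \<noteq> z\<close> that unfolding nonadj_def by blast
  have "a = x \<or> b = x"
  proof (rule ccontr)
    assume "\<not> ?thesis"
    then have "(a = y \<or> b = y) \<and> (a = z \<or> b = z)"
      using nonadj_meet[OF xy ab] nonadj_meet[OF xz ab] by blast
    then show False using ab yz nonadj_sym \<open>y \<noteq> z\<close> by blast
  qed
  then show ?thesis using t ab nonadj_sym[OF ab] by auto
qed

lemma simplification_eq:
  assumes "\<And>a b. a \<in> V \<Longrightarrow> b \<in> V \<Longrightarrow> a \<noteq> b \<Longrightarrow> adj a b \<longleftrightarrow> {a, b} \<notin> P"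
  shows "simplification G = delete_edges (complete_graph V) P"
proof -
  have "{ends G e |e. e \<in> E \<and> card (ends G e) = 2} = {p. p \<subseteq> V \<and> card p = 2} - P"
  proof (intro set_eqI iffI)
    fix p assume "p \<in> {ends G e |e. e \<in> E \<and> card (ends G e) = 2}"
    then obtain e where e: "p = ends G e" "e \<in> E" "card p = 2" by auto
    then obtain a b where ab: "p = {a, b}" "a \<noteq> b" by (meson card_2_iff)
    then have "adj a b" using e unfolding adj_iff by auto
    then show "p \<in> {p. p \<subseteq> V \<and> card p = 2} - P"
      using assms[of a b] adj_verts[of a b] ab e(3) by auto
  next
    fix p assume p: "p \<in> {p. p \<subseteq> V \<and> card p = 2} - P"
    then obtain a b where ab: "p = {a, b}" "a \<noteq> b" using card_2_iff[of p] by auto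
    then have "adj a b" using assms[of a b] p by auto
    then obtain e where "e \<in> E" "ends G e = p" using ab unfolding adj_iff by auto
    then show "p \<in> {ends G e |e. e \<in> E \<and> card (ends G e) = 2}" using p by auto
  qed
  then show ?thesis unfolding simplification_def delete_edges_def complete_graph_def by simp
qed

lemma complete_path:
  assumes "a \<in> V" "b \<in> V" "a \<noteq> b"
  shows "simple_path (complete_graph V) a b {{a, b}} {a, b}"
  by (rule simple_path_single) (use assms in \<open>auto simp: complete_graph_def\<close>)

theorem simplification_complete_minus_path:
  "\<exists>u v P. path_between (complete_graph V) u v P \<and> card P \<le> 2 \<and>
     simplification G = delete_edges (complete_graph V) P"
proof (cases "\<exists>x y. nonadj x y")
  case False
  \<comment> \<open>Without non-adjacent pairs the deleted path is the trivial one, at any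
    vertex.\<close>
  obtain x where x: "x \<in> V" using card_verts by fastforce
  have "path_between (complete_graph V) x x {}"
    unfolding path_between_iff using simple_path.trivial[of x "complete_graph V"] x
    by (auto simp: complete_graph_def)
  moreover have "simplification G = delete_edges (complete_graph V) {}"
    by (rule simplification_eq) (use False in \<open>auto simp: nonadj_def\<close>)
  ultimately show ?thesis by fastforce
next
  case True
  then obtain x y where xy: "nonadj x y" by blast
  show ?thesis
  proof (cases "\<exists>a b. nonadj a b \<and> {a, b} \<noteq> {x, y}")
    case False
    have "path_between (complete_graph V) x y {{x, y}}"
      unfolding path_between_iff using complete_path xy unfolding nonadj_def by blast
    moreover have "simplification G = delete_edges (complete_graph V) {{x, y}}"
    proof (rule simplification_eq)
      fix a b assume "a \<in> V" "b \<in> V" "a \<noteq> b"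
      then show "adj a b \<longleftrightarrow> {a, b} \<notin> {{x, y}}"
        using False xy adj_sym unfolding nonadj_def by (auto simp: doubleton_eq_iff)
    qed
    ultimately show ?thesis by (intro exI conjI) auto
  next
    case True
    then obtain a b where ab: "nonadj a b" "{a, b} \<noteq> {x, y}" by blast
    then have "a \<in> {x, y} \<or> b \<in> {x, y}" using nonadj_meet[OF xy ab(1)] by blast
    \<comment> \<open>\<open>p\<close> is the common vertex of the two pairs and becomes the middle
      of the path from \<open>q\<close> to \<open>r\<close>.\<close>
    then obtain p q r where pq: "nonadj p q" "nonadj p r" "q \<noteq> r"
      using ab xy nonadj_sym by (metis doubleton_eq_iff insertE singletonD)
    have V: "p \<in> V" "q \<in> V" "r \<in> V" "p \<noteq> q" "p \<noteq> r" using pq unfolding nonadj_def by auto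
    have "simple_path (complete_graph V) q r ({{q, p}} \<union> {{p, r}}) ({q, p} \<union> {p, r})"
      by (rule simple_path_append[OF complete_path complete_path]) (use V pq(3) in auto)
    moreover have "{{q, p}} \<union> {{p, r}} = {{q, p}, {p, r}}" by auto
    ultimately have "path_between (complete_graph V) q r {{q, p}, {p, r}}"
      unfolding path_between_iff by metis
    moreover have "simplification G = delete_edges (complete_graph V) {{q, p}, {p, r}}"
    proof (rule simplification_eq)
      fix a b assume c: "a \<in> V" "b \<in> V" "a \<noteq> b"
      have "\<not> adj a b" if "{a, b} = {q, p} \<or> {a, b} = {p, r}"
        using that pq adj_sym unfolding nonadj_def doubleton_eq_iff by blast
      moreover have "adj a b" if "{a, b} \<noteq> {q, p}" "{a, b} \<noteq> {p, r}"
        using nonadj_two[OF pq, of a b] that c unfolding nonadj_def by (metis insert_commute)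
      ultimately show "adj a b \<longleftrightarrow> {a, b} \<notin> {{q, p}, {p, r}}" by blast
    qed
    moreover have "card {{q, p}, {p, r}} \<le> 2" by (simp add: card_insert_if)
    ultimately show ?thesis by blast
  qed
qed

end

theorem theorem5p1:
  fixes G :: "('v, 'e) mgraph" and \<B> \<L> \<F> :: "'e set set"
  assumes "quasi_biased_graph G \<B> \<L> \<F>"
    and "matroid_n_connected 3 (quasi_graphic_matroid G \<B> \<L> \<F>)"
    and "unbreakable (quasi_graphic_matroid G \<B> \<L> \<F>)"
    and "graph_k_connected 3 G"
    and "card (verts G) \<ge> 7"
  shows "\<exists>u v P. path_between (complete_graph (verts G)) u v P \<and> card P \<le> 2 \<and>
           simplification G = delete_edges (complete_graph (verts G)) P"
proof -
  interpret unbreakable_3_connected G \<B> \<L> \<F>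
    by unfold_locales fact+
  show ?thesis by (rule simplification_complete_minus_path)
qed

end
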